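(* Let $n\ge 1$ and let $I,J,K$ be subsets of $[n-1]$. Let $a^{\emptyset}_{I,J,K}$ be the number of triples $(\sigma_1,\sigma_2,\sigma_3)$ of permutations in $S_n$ such that $\mathrm{set}(\sigma_1)=I$, $\mathrm{set}(\sigma_2)=J$, $\mathrm{set}(\sigma_3)=K$ and $\sigma_1\sigma_2\sigma_3=id_n$. Then $$a^{\emptyset}_{I,J,K}=\sum_{\lambda,\mu,\nu\vdash n}g(\lambda,\mu,\nu)\,d_{\lambda I}\,d_{\mu J}\,d_{\nu K}.$$
   Context: $[m]=\{1,\dots,m\}$, $S_n$ is the symmetric group on $[n]$, and $id_n$ is its identity. The descent set of $\pi\in S_n$ is $\mathrm{set}(\pi)=\{1\le i\le n-1\mid\pi(i)>\pi(i+1)\}$. The number $a^\emptyset_{I,J,K}$ is also the coefficient of $D_\emptyset$ in the product $D_ID_JD_K$ in $\mathbb{C}S_n$, where $D_I$ is the formal sum of all $\pi\in S_n$ with $\mathrm{set}(\pi)=I$. For a standard Young tableau $T$ with $n$ boxes (English convention: rows numbered from top to bottom; entries $1,\dots,n$ each used once, strictly increasing along rows and down columns), its descent set is the set of $1\le i\le n-1$ such that $i$ is in a strictly higher row than $i+1$. For $\lambda\vdash n$ and $I\subseteq[n-1]$, $d_{\lambda I}$ is the number of standard Young tableaux of shape $\lambda$ with descent set $I$. $\chi^\lambda$ is the irreducible character of $S_n$ indexed by the partition $\lambda$, and the Kronecker coefficient is $g(\lambda,\mu,\nu)=\frac1{n!}\sum_{\omega\in S_n}\chi^\lambda(\omega)\chi^\mu(\omega)\chi^\nu(\omega)$.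 *)

theory Defs
  imports Complex_Main "HOL-Library.FuncSet" "HOL-Library.Function_Algebras"
    "HOL-Combinatorics.Permutations"
begin

text \<open>
  The symmetric group on n letters is the set of all p :: nat => nat with
  \<open>p permutes {1..n}\<close>; the product of p and q is \<open>p \<circ> q\<close>.
\<close>

definition descent_set :: "nat \<Rightarrow> (nat \<Rightarrow> nat) \<Rightarrow> nat set" where
  "descent_set n p = {i. 1 \<le> i \<and> i \<le> n - 1 \<and> p i > p (i + 1)}"


section \<open>Partitions and standard Young tableaux\<close>

definition partitions :: "nat \<Rightarrow> nat list set" where
  "partitions n = {l. sorted_wrt (\<ge>) l \<and> (\<forall>x\<in>set l. 0 < x) \<and> sum_list l = n}"

text \<open>Boxes are pairs (row, column), both counted from 0, with row 0 on top.\<close>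

definition diagram :: "nat list \<Rightarrow> (nat \<times> nat) set" where
  "diagram l = {(r, c). r < length l \<and> c < l ! r}"

text \<open>
  Tableaux are taken to be \<open>undefined\<close> outside the diagram, so that counting functions
  is the same as counting fillings.
\<close>

definition standard_tableaux :: "nat list \<Rightarrow> (nat \<times> nat \<Rightarrow> nat) set" where
  "standard_tableaux l = {T \<in> extensional (diagram l).
     bij_betw T (diagram l) {1..sum_list l} \<and>
     (\<forall>r c c'. (r, c) \<in> diagram l \<and> (r, c') \<in> diagram l \<and> c < c' \<longrightarrow> T (r, c) < T (r, c')) \<and>
     (\<forall>r r' c. (r, c) \<in> diagram l \<and> (r', c) \<in> diagram l \<and> r < r' \<longrightarrow> T (r, c) < T (r', c))}"

definition tableau_descent_set :: "nat list \<Rightarrow> (nat \<times> nat \<Rightarrow> nat) \<Rightarrow> nat set" where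
  "tableau_descent_set l T = {i. 1 \<le> i \<and> i \<le> sum_list l - 1 \<and>
     (\<exists>r c r' c'. (r, c) \<in> diagram l \<and> (r', c') \<in> diagram l \<and>
        T (r, c) = i \<and> T (r', c') = i + 1 \<and> r < r')}"

definition num_tableaux :: "nat list \<Rightarrow> nat set \<Rightarrow> nat" where
  "num_tableaux l I = card {T \<in> standard_tableaux l. tableau_descent_set l T = I}"


section \<open>Traces on subspaces of complex function spaces\<close>

global_interpretation cfun: vector_space "\<lambda>(a::complex) (x :: 'a \<Rightarrow> complex) t. a * x t"
  by unfold_locales (auto simp: fun_eq_iff algebra_simps)

text \<open>
  The trace of the restriction of f to V, where V is a finite-dimensional subspace mapped to
  itself by the linear map f. The value does not depend on the chosen basis.
\<close>

definition trace_on :: "('a \<Rightarrow> complex) set \<Rightarrow> (('a \<Rightarrow> complex) \<Rightarrow> ('a \<Rightarrow> complex)) \<Rightarrow> complex" where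
  "trace_on V f = (let B = (SOME B. \<not> cfun.dependent B \<and> cfun.span B = V)
                   in \<Sum>b\<in>B. cfun.representation B (f b) b)"


section \<open>The group algebra and irreducible characters of the symmetric group\<close>

text \<open>
  An element of the complex group algebra is its coefficient function, which vanishes off the
  group; the product is convolution.
\<close>

definition group_algebra :: "nat \<Rightarrow> ((nat \<Rightarrow> nat) \<Rightarrow> complex) set" where
  "group_algebra n = {x. \<forall>g. \<not> g permutes {1..n} \<longrightarrow> x g = 0}"

definition ga_mult ::
    "nat \<Rightarrow> ((nat \<Rightarrow> nat) \<Rightarrow> complex) \<Rightarrow> ((nat \<Rightarrow> nat) \<Rightarrow> complex) \<Rightarrow> ((nat \<Rightarrow> nat) \<Rightarrow> complex)" where
  "ga_mult n x y = (\<lambda>g. if g permutes {1..n}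
     then \<Sum>h | h permutes {1..n}. x h * y (inv h \<circ> g) else 0)"

definition ga_single :: "(nat \<Rightarrow> nat) \<Rightarrow> ((nat \<Rightarrow> nat) \<Rightarrow> complex)" where
  "ga_single p = (\<lambda>g. if g = p then 1 else 0)"

text \<open>
  The tableau whose rows, read from top to bottom and left to right, contain 1, 2, 3, and so on,
  with its row and column stabilizers.
\<close>

definition row_reading_tableau :: "nat list \<Rightarrow> nat \<times> nat \<Rightarrow> nat" where
  "row_reading_tableau l = (\<lambda>(r, c). sum_list (take r l) + c + 1)"

definition row_group :: "nat list \<Rightarrow> (nat \<Rightarrow> nat) set" where
  "row_group l = {p. p permutes {1..sum_list l} \<and>
     (\<forall>r. p ` row_reading_tableau l ` {b \<in> diagram l. fst b = r}
          = row_reading_tableau l ` {b \<in> diagram l. fst b = r})}"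

definition column_group :: "nat list \<Rightarrow> (nat \<Rightarrow> nat) set" where
  "column_group l = {p. p permutes {1..sum_list l} \<and>
     (\<forall>c. p ` row_reading_tableau l ` {b \<in> diagram l. snd b = c}
          = row_reading_tableau l ` {b \<in> diagram l. snd b = c})}"

definition young_symmetrizer :: "nat list \<Rightarrow> ((nat \<Rightarrow> nat) \<Rightarrow> complex)" where
  "young_symmetrizer l = ga_mult (sum_list l)
     (\<Sum>p\<in>row_group l. ga_single p)
     (\<Sum>q\<in>column_group l. (\<lambda>g. of_int (sign q) * ga_single q g))"

text \<open>
  The irreducible module (Specht module) indexed by a partition l is the left ideal generated by
  the Young symmetrizer. With this convention (n) gives the trivial and (1,...,1) the sign
  representation.
\<close>

definition specht_module :: "nat list \<Rightarrow> ((nat \<Rightarrow> nat) \<Rightarrow> complex) set" where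
  "specht_module l =
     (\<lambda>x. ga_mult (sum_list l) x (young_symmetrizer l)) ` group_algebra (sum_list l)"

definition irr_character :: "nat list \<Rightarrow> (nat \<Rightarrow> nat) \<Rightarrow> complex" where
  "irr_character l w = trace_on (specht_module l) (ga_mult (sum_list l) (ga_single w))"

definition kronecker_coeff :: "nat \<Rightarrow> nat list \<Rightarrow> nat list \<Rightarrow> nat list \<Rightarrow> complex" where
  "kronecker_coeff n l m k = 1 / fact n *
     (\<Sum>w | w permutes {1..n}. irr_character l w * irr_character m w * irr_character k w)"

end

theory Submission
  imports Defs "HOL-Library.Product_Lexorder"
begin

text \<open>
  For an integer vector b let \<open>\<phi>\<^sub>b\<close> be the permutation character of \<open>S\<^sub>n\<close> on the colorings of
  \<open>{1..n}\<close> with b i points of color i; this is the action on the cosets of a Young subgroup.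
  A function of I, J and K is determined by its sums over all subsets of I, J and K
  (\<open>subset_sums_determine\<close>), so it is enough to compare these sums. Both of them turn out to be
  \<open>(1 / n!) \<cdot> (\<Sum>w. \<phi>\<^sub>a w \<cdot> \<phi>\<^sub>b w \<cdot> \<phi>\<^sub>c w)\<close>, where a, b and c are the sizes of the blocks into which
  \<open>{1..n}\<close> is cut behind the elements of I, J and K.

  Counting side. The sum over w counts triples of colorings (f, g, h), each weighted by the order
  of its stabilizer. This order is the number of ways to arrange the n points so that (f, h, g) is
  lexicographically sorted, because the stabilizer permutes these arrangements simply
  transitively. Such an arrangement extends in exactly one way to three linear orders of the points,
  sorted by the cyclic rotations (f, h, g), (h, g, f) and (g, f, h), with ties broken in the same
  way in all three. Neighbouring orders agree on the points with a common leading color, so the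
  three permutations that compare them have descents at block ends only, and their product is the
  identity; conversely every such triple of permutations arises (\<open>stabilizer_triple\<close>).

  Character side. The claim is Young's rule (\<open>youngs_rule\<close>): \<open>\<phi>\<^sub>a\<close> is the sum of the irreducible
  characters, each taken as often as there are standard tableaux of its shape with descents in I.
  The proof avoids any decomposition of modules. The Jacobi-Trudi class function \<open>\<psi>\<^sub>l\<close> of a partition l
  is the alternating sum over all permutations p of \<open>\<phi>\<^sub>b\<close> with \<open>b i = l i - i + p i\<close>.
  \<^item> A sign-reversing involution (\<open>alternating_words_eq_lattice_words\<close>) shows that the inner product
    of \<open>\<psi>\<^sub>l\<close> and \<open>\<phi>\<^sub>a\<close> counts the lattice words of content l that ascend at elements of I only, and
    these are the standard tableaux of shape l with descents in I
    (\<open>card_tableaux_eq_card_lattice_words\<close>).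
  \<^item> A lattice word cannot have more weight, the sum of its letters, than the sorted word with the
    block sizes as its content. Hence the inner products are unitriangular with respect to the
    weight, which makes the \<open>\<psi>\<^sub>l\<close> orthonormal (\<open>jacobi_trudi_orthonormal\<close>), and they span all \<open>\<phi>\<^sub>b\<close>
    (\<open>perm_character_in_span\<close>).
  \<^item> The irreducible character \<open>\<chi>\<^sub>l\<close> is a trace on a left ideal generated by a multiple of an
    idempotent, so it has an explicit formula in terms of the Young symmetrizer. Von Neumann's lemma
    gives \<open>\<chi>\<^sub>l\<close> norm 1, and a minimality property of the row index among functions that are injective on
    columns gives \<open>\<chi>\<^sub>l\<close> inner product 1 with \<open>\<phi>\<^sub>l\<close> and 0 with every \<open>\<phi>\<^sub>b\<close> of smaller weight. So
    \<open>\<chi>\<^sub>l\<close> and \<open>\<psi>\<^sub>l\<close> are real unit vectors with inner product 1, and therefore equal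
    (\<open>irr_character_eq_jacobi_trudi\<close>).
\<close>

section \<open>Sorting permutations and stabilizers of colorings\<close>

text \<open>
  Keeps the intervals \<open>{1..n}\<close>, on which all permutations live, in one syntactic form.
\<close>

declare One_nat_def [simp del]

abbreviation Sym :: "nat \<Rightarrow> (nat \<Rightarrow> nat) set" where
  "Sym n \<equiv> {p. p permutes {1..n}}"

lemma finite_Sym: "finite (Sym n)"
  by (rule finite_permutations) simp

lemma card_Sym: "card (Sym n) = fact n"
  by (rule card_permutations) auto

text \<open>
  F and G have the same multiset of values, and a sorted list is determined by its multiset.
\<close>

lemma sorted_rearrangement_unique:
  fixes F G :: "nat \<Rightarrow> 'b::linorder"
  assumes s: "s permutes {1..n}" and F: "mono_on {1..n} F" and G: "mono_on {1..n} G"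
    and eq: "\<And>x. x \<in> {1..n} \<Longrightarrow> G x = F (s x)"
    and x: "x \<in> {1..n}"
  shows "G x = F x"
proof -
  have srt: "sorted (map H [1..<Suc n])" if "mono_on {1..n} H" for H :: "nat \<Rightarrow> 'b"
    using that by (auto simp: sorted_iff_nth_mono mono_on_def nth_append simp del: upt_Suc)
  have "image_mset F (mset_set {1..n}) = image_mset G (mset_set {1..n})"
    by (rule permutes_implies_image_mset_eq[OF s]) (use eq in auto)
  then have "mset (map F [1..<Suc n]) = mset (map G [1..<Suc n])"
    by (simp add: atLeastLessThanSuc_atLeastAtMost del: upt_Suc)
  then have "map F [1..<Suc n] = map G [1..<Suc n]"
    using srt[OF F] srt[OF G] by (metis properties_for_sort)
  then show ?thesis using x by (auto simp del: upt_Suc)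
qed

lemma exists_sorting_permutation:
  fixes G :: "nat \<Rightarrow> 'b::linorder"
  obtains t where "t permutes {1..n}" "mono_on {1..n} (G \<circ> t)"
proof -
  let ?L = "sort (map G [1..<Suc n])"
  let ?F = "\<lambda>i. ?L ! (i - 1)"
  have len: "length ?L = n" by simp
  have "map ?F [1..<Suc n] = ?L"
    by (rule nth_equalityI) (auto simp del: upt_Suc)
  then have "mset (map ?F [1..<Suc n]) = mset (map G [1..<Suc n])" by (metis mset_sort)
  then have "image_mset ?F (mset_set {1..n}) = image_mset G (mset_set {1..n})"
    by (simp add: atLeastLessThanSuc_atLeastAtMost del: upt_Suc)
  \<comment> \<open>F lists the values of G in increasing order, so some permutation turns G into F.\<close>
  from image_mset_eq_implies_permutes[OF finite_atLeastAtMost this]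
  obtain p where p: "p permutes {1..n}" "\<forall>x\<in>{1..n}. ?F x = G (p x)" by blast
  have "mono_on {1..n} (G \<circ> p)"
  proof (rule mono_onI)
    fix r s assume rs: "r \<in> {1..n}" "s \<in> {1..n}" "r \<le> s"
    then have "?F r \<le> ?F s"
      by (intro sorted_nth_mono) (auto simp del: upt_Suc)
    then show "(G \<circ> p) r \<le> (G \<circ> p) s" using p(2) rs by auto
  qed
  with p(1) show ?thesis by (rule that)
qed

text \<open>
  One sorting permutation t gives all of them: by uniqueness of the sorted rearrangement,
  composition with t maps the stabilizer of G bijectively onto the sorting permutations.
\<close>

lemma card_stabilizer_eq_card_sorting:
  fixes G :: "nat \<Rightarrow> 'b::linorder"
  shows "card {w \<in> Sym n. \<forall>x\<in>{1..n}. G (w x) = G x} = card {t \<in> Sym n. mono_on {1..n} (G \<circ> inv t)}"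
proof -
  obtain u where u: "u permutes {1..n}" "mono_on {1..n} (G \<circ> u)"
    by (rule exists_sorting_permutation)
  define t where "t = inv u"
  have t: "t permutes {1..n}" "mono_on {1..n} (G \<circ> inv t)"
    using u by (auto simp: t_def permutes_inv permutes_inv_inv)
  have "bij_betw (\<lambda>w. t \<circ> w) {w \<in> Sym n. \<forall>x\<in>{1..n}. G (w x) = G x}
     {t \<in> Sym n. mono_on {1..n} (G \<circ> inv t)}"
  proof (rule bij_betw_byWitness[where f' = "\<lambda>w. inv t \<circ> w"])
    show "\<forall>w\<in>{w \<in> Sym n. \<forall>x\<in>{1..n}. G (w x) = G x}. inv t \<circ> (t \<circ> w) = w"
      using permutes_inv_o(2)[OF t(1)] by (simp flip: comp_assoc)
  next
    show "\<forall>v\<in>{t \<in> Sym n. mono_on {1..n} (G \<circ> inv t)}. t \<circ> (inv t \<circ> v) = v"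
      using permutes_inv_o(1)[OF t(1)] by (simp flip: comp_assoc)
  next
    show "(\<lambda>w. t \<circ> w) ` {w \<in> Sym n. \<forall>x\<in>{1..n}. G (w x) = G x}
       \<subseteq> {t \<in> Sym n. mono_on {1..n} (G \<circ> inv t)}"
    proof clarsimp
      fix w assume w: "w permutes {1..n}" and st: "\<forall>x\<in>{1..n}. G (w x) = G x"
      have 1: "inv (t \<circ> w) = inv w \<circ> inv t"
        using t w by (simp add: o_inv_distrib permutes_bij)
      have "G (inv w (inv t x)) = G (inv t x)" if "x \<in> {1..n}" for x
      proof -
        have "inv w (inv t x) \<in> {1..n}"
          using that t w by (simp add: permutes_in_image permutes_inv del: atLeastAtMost_iff)
        with st have "G (w (inv w (inv t x))) = G (inv w (inv t x))" by auto
        then show ?thesis using permutes_inverses[OF w] by simp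
      qed
      then show "t \<circ> w permutes {1..n} \<and> mono_on {1..n} (G \<circ> inv (t \<circ> w))"
        using t w 1 by (auto simp: permutes_compose mono_on_def)
    qed
  next
    show "(\<lambda>w. inv t \<circ> w) ` {t \<in> Sym n. mono_on {1..n} (G \<circ> inv t)}
       \<subseteq> {w \<in> Sym n. \<forall>x\<in>{1..n}. G (w x) = G x}"
    proof clarsimp
      fix v assume v: "v permutes {1..n}" and mv: "mono_on {1..n} (G \<circ> inv v)"
      have eq: "(G \<circ> inv v) x = (G \<circ> inv t) x" if "x \<in> {1..n}" for x
        by (rule sorted_rearrangement_unique[of "t \<circ> inv v" n "G \<circ> inv t" "G \<circ> inv v"])
          (use t v mv that in \<open>auto simp: permutes_compose permutes_inv permutes_inverses\<close>)
      have "G (inv t (v x)) = G x" if "x \<in> {1..n}" for x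
        using eq[of "v x"] v that permutes_in_image[OF v]
        by (auto simp: permutes_inverses)
      then show "inv t \<circ> v permutes {1..n} \<and> (\<forall>x\<in>{1..n}. G (inv t (v x)) = G x)"
        using t v by (auto simp: permutes_compose permutes_inv)
    qed
  qed
  then show ?thesis by (rule bij_betw_same_card)
qed

text \<open>
  The content b is integer-valued because the contents \<open>l i - i + p i\<close> of the Jacobi-Trudi expansion
  may have negative entries; then there is no coloring, as it should be.
\<close>

definition colorings :: "nat \<Rightarrow> (nat \<Rightarrow> int) \<Rightarrow> (nat \<Rightarrow> nat) set" where
  "colorings n b = {f \<in> {1..n} \<rightarrow>\<^sub>E {..<n}. \<forall>i. int (card {x \<in> {1..n}. f x = i}) = b i}"

definition fixed_colorings :: "nat \<Rightarrow> (nat \<Rightarrow> int) \<Rightarrow> (nat \<Rightarrow> nat) \<Rightarrow> nat" where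
  "fixed_colorings n b w = card {f \<in> colorings n b. f \<circ> w = f}"

lemma finite_colorings: "finite (colorings n b)"
  unfolding colorings_def by (rule finite_subset[OF _ finite_PiE[of "{1..n}" "\<lambda>_. {..<n}"]]) auto

lemma extensional_comp_permutes:
  "f \<in> extensional S \<Longrightarrow> w permutes S \<Longrightarrow> f \<circ> w \<in> extensional S"
  by (auto simp: extensional_def permutes_not_in)

lemma coloring_fixed_iff:
  assumes "f \<in> extensional S" "w permutes S"
  shows "f \<circ> w = f \<longleftrightarrow> (\<forall>x\<in>S. f (w x) = f x)"
  using assms by (auto simp: fun_eq_iff permutes_def)

lemma card_fiber_comp_permutes:
  assumes "w permutes S"
  shows "card {x \<in> S. f (w x) = i} = card {x \<in> S. f x = i}"
proof (rule bij_betw_same_card[of w])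
  show "bij_betw w {x \<in> S. f (w x) = i} {x \<in> S. f x = i}"
    by (rule bij_betw_byWitness[where f' = "inv w"])
      (use assms in \<open>auto simp: permutes_inverses permutes_in_image permutes_inv\<close>)
qed

lemma colorings_comp_iff:
  assumes w: "w permutes {1..n}"
  shows "f \<circ> w \<in> colorings n b \<longleftrightarrow> f \<in> colorings n b"
proof -
  have 1: "f \<circ> w \<in> colorings n b" if "f \<in> colorings n b" "w permutes {1..n}" for f w
  proof -
    have "(f \<circ> w) \<in> {1..n} \<rightarrow>\<^sub>E {..<n}"
      using that extensional_comp_permutes[of f "{1..n}" w] permutes_in_image[OF that(2)]
      unfolding colorings_def PiE_def Pi_def by (auto simp del: atLeastAtMost_iff)
    then show ?thesis using that card_fiber_comp_permutes[OF that(2), of f]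
      by (auto simp: colorings_def)
  qed
  show ?thesis
    using 1[OF _ w] 1[of "f \<circ> w" "inv w"] w
    by (auto simp: permutes_inv comp_assoc permutes_inv_o)
qed

lemma colorings_orbit:
  assumes k: "k \<in> colorings n a"
  shows "f \<in> colorings n a \<longleftrightarrow> (\<exists>t. t permutes {1..n} \<and> f = k \<circ> t)"
proof
  assume f: "f \<in> colorings n a"
  have "image_mset f (mset_set {1..n}) = image_mset k (mset_set {1..n})"
  proof (rule multiset_eqI)
    fix i
    have "int (card {x \<in> {1..n}. f x = i}) = int (card {x \<in> {1..n}. k x = i})"
      using f k by (simp add: colorings_def)
    then show "count (image_mset f (mset_set {1..n})) i = count (image_mset k (mset_set {1..n})) i"
      by (simp add: count_image_mset_eq_card_vimage)
  qed
  from image_mset_eq_implies_permutes[OF finite_atLeastAtMost this]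
  obtain p where p: "p permutes {1..n}" "\<forall>x\<in>{1..n}. f x = k (p x)" by blast
  have "f = k \<circ> p"
  proof
    fix x show "f x = (k \<circ> p) x"
    proof (cases "x \<in> {1..n}")
      case False
      then have "f x = undefined" "k x = undefined"
        using f k by (auto simp: colorings_def PiE_def extensional_def)
      then show ?thesis using permutes_not_in[OF p(1) False] by simp
    qed (use p in auto)
  qed
  with p show "\<exists>t. t permutes {1..n} \<and> f = k \<circ> t" by blast
next
  assume "\<exists>t. t permutes {1..n} \<and> f = k \<circ> t"
  then show "f \<in> colorings n a" using k colorings_comp_iff by blast
qed

lemma sum_card_swap:
  assumes "finite A" "finite B"
  shows "(\<Sum>a\<in>A. card {b \<in> B. R a b}) = (\<Sum>b\<in>B. card {a \<in> A. R a b})"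
proof -
  have "(\<Sum>a\<in>A. card {b \<in> B. R a b}) = (\<Sum>a\<in>A. \<Sum>b\<in>B. if R a b then 1 else 0)"
    using assms by (simp add: sum.If_cases Int_def)
  also have "\<dots> = (\<Sum>b\<in>B. \<Sum>a\<in>A. if R a b then 1 else 0)" by (rule sum.swap)
  also have "\<dots> = (\<Sum>b\<in>B. card {a \<in> A. R a b})"
    using assms by (simp add: sum.If_cases Int_def)
  finally show ?thesis .
qed

text \<open>
  The coloring can be recovered from the sorting permutation, since f after sorting must be k.
\<close>

lemma sorted_coloring_unique:
  assumes k: "k \<in> colorings n a" "mono_on {1..n} k" and f: "f \<in> colorings n a"
    and t: "t permutes {1..n}" and m: "mono_on {1..n} (f \<circ> inv t)"
  shows "f = k \<circ> t"
proof -
  obtain s where s: "s permutes {1..n}" "f = k \<circ> s"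
    using f colorings_orbit[OF k(1)] by blast
  have eq: "(f \<circ> inv t) x = k x" if "x \<in> {1..n}" for x
    by (rule sorted_rearrangement_unique[of "s \<circ> inv t" n k "f \<circ> inv t"])
      (use s t k m that in \<open>auto simp: permutes_compose permutes_inv\<close>)
  show ?thesis
  proof
    fix x show "f x = (k \<circ> t) x"
    proof (cases "x \<in> {1..n}")
      case True
      then show ?thesis using eq[of "t x"] t permutes_in_image[OF t]
        by (auto simp: permutes_inverses)
    next
      case False
      then show ?thesis using s t by (auto simp: permutes_not_in)
    qed
  qed
qed

definition decreasing_on_blocks :: "nat \<Rightarrow> (nat \<Rightarrow> nat) \<Rightarrow> (nat \<Rightarrow> nat) \<Rightarrow> bool" where
  "decreasing_on_blocks n k h \<longleftrightarrow> (\<forall>x\<in>{1..n}. \<forall>y\<in>{1..n}. x < y \<longrightarrow> k x = k y \<longrightarrow> h y \<le> h x)"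

definition increasing_on_blocks :: "nat \<Rightarrow> (nat \<Rightarrow> nat) \<Rightarrow> (nat \<Rightarrow> nat) \<Rightarrow> bool" where
  "increasing_on_blocks n k s \<longleftrightarrow> (\<forall>x\<in>{1..n}. \<forall>y\<in>{1..n}. x < y \<longrightarrow> k x = k y \<longrightarrow> s x < s y)"

text \<open>
  Sort by f first and then by decreasing g. The first key of the sorted arrangement is k itself, and
  the second key is decreasing where the first one is constant.
\<close>

lemma stabilizer_pair:
  assumes k: "k \<in> colorings n a" "mono_on {1..n} k" and f: "f \<in> colorings n a"
    and g: "g \<in> colorings n b"
  shows "card {w \<in> Sym n. f \<circ> w = f \<and> g \<circ> w = g} =
    card {t \<in> Sym n. f = k \<circ> t \<and> decreasing_on_blocks n k (g \<circ> inv t)}"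
proof -
  \<comment> \<open>The sign reverses the order of the second key.\<close>
  let ?G = "\<lambda>x. (f x, - int (g x))"
  have ext: "f \<in> extensional {1..n}" "g \<in> extensional {1..n}"
    using f g by (auto simp: colorings_def PiE_def)
  have "{w \<in> Sym n. f \<circ> w = f \<and> g \<circ> w = g} = {w \<in> Sym n. \<forall>x\<in>{1..n}. ?G (w x) = ?G x}"
    using coloring_fixed_iff[OF ext(1)] coloring_fixed_iff[OF ext(2)] by auto
  moreover have "{t \<in> Sym n. f = k \<circ> t \<and> decreasing_on_blocks n k (g \<circ> inv t)} =
     {t \<in> Sym n. mono_on {1..n} (?G \<circ> inv t)}"
  proof (rule Collect_cong, rule conj_cong[OF refl])
    fix t assume "t \<in> Sym n"
    then have t: "t permutes {1..n}" by simp
    show "(f = k \<circ> t \<and> decreasing_on_blocks n k (g \<circ> inv t)) = mono_on {1..n} (?G \<circ> inv t)"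
    proof (intro iffI conjI)
      assume L: "f = k \<circ> t \<and> decreasing_on_blocks n k (g \<circ> inv t)"
      then have "f (inv t x) = k x" for x using permutes_inverses[OF t] by auto
      note fk = this
      show "mono_on {1..n} (?G \<circ> inv t)"
      proof (rule mono_onI)
        fix r s assume rs: "r \<in> {1..n}" "s \<in> {1..n}" "r \<le> s"
        have "k r \<le> k s" using mono_onD[OF k(2)] rs by blast
        moreover have "g (inv t s) \<le> g (inv t r)" if "k r = k s"
          using L rs that by (cases "r = s") (auto simp: decreasing_on_blocks_def)
        ultimately show "(?G \<circ> inv t) r \<le> (?G \<circ> inv t) s"
          by (cases "k r = k s") (auto simp: fk less_eq_prod_def)
      qed
    next
      assume m: "mono_on {1..n} (?G \<circ> inv t)"
      then have "mono_on {1..n} (f \<circ> inv t)"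
        by (fastforce simp: less_eq_prod_def intro!: mono_onI dest: mono_onD)
      then show feq: "f = k \<circ> t" by (rule sorted_coloring_unique[OF k f t])
      then have "f (inv t x) = k x" for x using permutes_inverses[OF t] by auto
      note fk = this
      show "decreasing_on_blocks n k (g \<circ> inv t)"
        unfolding decreasing_on_blocks_def
      proof (intro ballI impI)
        fix x y assume "x \<in> {1..n}" "y \<in> {1..n}" "x < y" "k x = k y"
        then show "(g \<circ> inv t) y \<le> (g \<circ> inv t) x"
          using mono_onD[OF m, of x y] by (auto simp: fk less_eq_prod_def)
      qed
    qed
  qed
  ultimately show ?thesis by (simp only: card_stabilizer_eq_card_sorting[of n ?G])
qed

lemma card_Times_filter:
  "card {x \<in> A. P x} * card {y \<in> B. Q y} = card {z \<in> A \<times> B. P (fst z) \<and> Q (snd z)}"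
  by (simp flip: card_cartesian_product) (rule arg_cong[of _ _ card], auto)

text \<open>
  For every t there is one coloring f with \<open>f = k \<circ> t\<close>, so the pairs (f, g) drop out of the count:
  only the rearranged coloring \<open>h = g \<circ> inv t\<close> remains, once for every t.
\<close>

lemma sum_fixed_colorings_mult:
  assumes k: "k \<in> colorings n a" "mono_on {1..n} k"
  shows "(\<Sum>w\<in>Sym n. fixed_colorings n a w * fixed_colorings n b w) =
    fact n * card {h \<in> colorings n b. decreasing_on_blocks n k h}"
proof -
  let ?C = "colorings n a \<times> colorings n b"
  have fin: "finite ?C" by (simp add: finite_colorings)
  have "(\<Sum>w\<in>Sym n. fixed_colorings n a w * fixed_colorings n b w) =
     (\<Sum>w\<in>Sym n. card {z \<in> ?C. fst z \<circ> w = fst z \<and> snd z \<circ> w = snd z})"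
    by (simp add: fixed_colorings_def card_Times_filter)
  also have "\<dots> = (\<Sum>z\<in>?C. card {w \<in> Sym n. fst z \<circ> w = fst z \<and> snd z \<circ> w = snd z})"
    by (rule sum_card_swap[OF finite_Sym fin])
  also have "\<dots> = (\<Sum>z\<in>?C. card {t \<in> Sym n. fst z = k \<circ> t \<and> decreasing_on_blocks n k (snd z \<circ> inv t)})"
    by (intro sum.cong refl stabilizer_pair[OF k]) auto
  also have "\<dots> = (\<Sum>t\<in>Sym n. card {z \<in> ?C. fst z = k \<circ> t \<and> decreasing_on_blocks n k (snd z \<circ> inv t)})"
    by (rule sum_card_swap[OF fin finite_Sym])
  also have "\<dots> = (\<Sum>t\<in>Sym n. card {h \<in> colorings n b. decreasing_on_blocks n k h})"
  proof (rule sum.cong[OF refl])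
    fix t assume "t \<in> Sym n"
    then have t: "t permutes {1..n}" by simp
    have it: "inv t permutes {1..n}" by (rule permutes_inv[OF t])
    have kt: "k \<circ> t \<in> colorings n a" using k(1) colorings_comp_iff[OF t] by blast
    have c1: "h \<circ> t \<circ> inv t = h" "h \<circ> inv t \<circ> t = h" for h :: "nat \<Rightarrow> nat"
      by (simp_all add: comp_assoc permutes_inv_o[OF t])
    show "card {z \<in> ?C. fst z = k \<circ> t \<and> decreasing_on_blocks n k (snd z \<circ> inv t)} =
       card {h \<in> colorings n b. decreasing_on_blocks n k h}"
      by (rule bij_betw_same_card[of "\<lambda>z. snd z \<circ> inv t"],
          rule bij_betw_byWitness[where f' = "\<lambda>h. (k \<circ> t, h \<circ> t)"])
        (use kt c1 colorings_comp_iff[OF t] colorings_comp_iff[OF it] in auto)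
  qed
  also have "\<dots> = fact n * card {h \<in> colorings n b. decreasing_on_blocks n k h}"
    by (simp add: card_Sym)
  finally show ?thesis .
qed

lemma permutation_determined_by_order:
  fixes p q :: "nat \<Rightarrow> nat"
  assumes p: "p permutes {1..n}" and q: "q permutes {1..n}"
    and ord: "\<And>x y. x \<in> {1..n} \<Longrightarrow> y \<in> {1..n} \<Longrightarrow> p x < p y \<longleftrightarrow> q x < q y"
  shows "p = q"
proof
  fix x show "p x = q x"
  proof (cases "x \<in> {1..n}")
    case True
    have m: "mono_on {1..n} (q \<circ> inv p)"
    proof (rule mono_onI)
      fix r s assume rs: "r \<in> {1..n}" "s \<in> {1..n}" "r \<le> s"
      have "inv p r \<in> {1..n}" "inv p s \<in> {1..n}"
        using rs permutes_in_image[OF permutes_inv[OF p]] by auto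
      then have "s < r \<longleftrightarrow> q (inv p s) < q (inv p r)"
        using ord[of "inv p s" "inv p r"] by (simp add: permutes_inverses[OF p])
      with rs(3) have "\<not> q (inv p s) < q (inv p r)" by simp
      then show "(q \<circ> inv p) r \<le> (q \<circ> inv p) s" by simp
    qed
    have "(q \<circ> inv p) (p x) = id (p x)"
      by (rule sorted_rearrangement_unique[of "q \<circ> inv p" n id])
        (use m p q True permutes_in_image[OF p] in \<open>auto simp: permutes_compose permutes_inv mono_on_def\<close>)
    then show ?thesis by (simp add: permutes_inverses[OF p])
  next
    case False
    then show ?thesis using p q by (simp add: permutes_not_in)
  qed
qed

lemma exists_permutation_inducing_order:
  fixes G :: "nat \<Rightarrow> 'b::linorder"
  assumes inj: "inj_on G {1..n}"
  obtains p where "p permutes {1..n}"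
    "\<And>x y. x \<in> {1..n} \<Longrightarrow> y \<in> {1..n} \<Longrightarrow> p x < p y \<longleftrightarrow> G x < G y"
proof -
  obtain t where t: "t permutes {1..n}" "mono_on {1..n} (G \<circ> t)"
    by (rule exists_sorting_permutation)
  have le: "G x \<le> G y" if "inv t x \<le> inv t y" "x \<in> {1..n}" "y \<in> {1..n}" for x y
  proof -
    have "inv t x \<in> {1..n}" "inv t y \<in> {1..n}"
      using that permutes_in_image[OF permutes_inv[OF t(1)]] by auto
    then show ?thesis
      using mono_onD[OF t(2), of "inv t x" "inv t y"] that permutes_inverses[OF t(1)] by simp
  qed
  show ?thesis
  proof (rule that)
    show "inv t permutes {1..n}" using t by (simp add: permutes_inv)
    fix x y assume xy: "x \<in> {1..n}" "y \<in> {1..n}"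
    have "inv t x = inv t y \<Longrightarrow> x = y" using permutes_inverses[OF t(1)] by metis
    then show "inv t x < inv t y \<longleftrightarrow> G x < G y"
      using le[OF _ xy] le[OF _ xy(2,1)] inj_onD[OF inj _ xy]
      by (metis less_imp_le nat_le_linear not_less order.strict_iff_order)
  qed
qed

section \<open>Triples of permutations as triples of sorted orders\<close>

lemma increasing_on_blocks_comp_inv:
  assumes p: "p permutes {1..n}" and q: "q permutes {1..n}"
  shows "increasing_on_blocks n k (p \<circ> inv q) \<longleftrightarrow>
    (\<forall>x\<in>{1..n}. \<forall>y\<in>{1..n}. q x < q y \<longrightarrow> k (q x) = k (q y) \<longrightarrow> p x < p y)"
proof -
  have "(\<forall>x\<in>{1..n}. A x) \<longleftrightarrow> (\<forall>x\<in>{1..n}. A (q x))" for A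
    using permutes_image[OF q] by (metis (no_types, lifting) image_iff)
  note 1 = this
  show ?thesis unfolding increasing_on_blocks_def
    by (subst 1, subst (2) 1) (simp add: permutes_inverses[OF q])
qed

text \<open>
  Here p and \<open>p'\<close> are the positions of two points in the first order, q and r likewise. If the
  leading colors agree, the comparison moves on to the next order of the cycle, which is sorted by the
  next color; this is why each order is lexicographic in the rotated triple of colors.
\<close>

lemma cyclic_lexicographic_orders_aux:
  fixes p q r f g h p' q' r' f' g' h' :: nat
  assumes "p \<noteq> p'" "q \<noteq> q'" "r \<noteq> r'"
    and fm: "f < f' \<longrightarrow> q < q'" and gm: "g < g' \<longrightarrow> r < r'" and hm: "h < h' \<longrightarrow> p < p'"
    and fb: "f = f' \<longrightarrow> q < q' \<longrightarrow> p < p'" and gb: "g = g' \<longrightarrow> r < r' \<longrightarrow> q < q'" and hb: "h = h' \<longrightarrow> p < p' \<longrightarrow> r < r'"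
    and fb': "f' = f \<longrightarrow> q' < q \<longrightarrow> p' < p" and gb': "g' = g \<longrightarrow> r' < r \<longrightarrow> q' < q" and hb': "h' = h \<longrightarrow> p' < p \<longrightarrow> r' < r"
  shows "(h, g, f, q) < (h', g', f', q') \<Longrightarrow> p < p'"
    and "(g, f, h, q) < (g', f', h', q') \<Longrightarrow> r < r'"
    and "(f, h, g) < (f', h', g') \<Longrightarrow> q < q'"
proof -
  note tri = assms(1-3)[unfolded nat_neq_iff]
  show "p < p'" if "(h, g, f, q) < (h', g', f', q')"
  proof -
    have "h < h' \<or> h = h' \<and> (g < g' \<or> g = g' \<and> (f < f' \<or> f = f' \<and> q < q'))"
      using that by auto
    then show ?thesis using tri fm gm hm fb gb' hb' by (metis less_asym)
  qed
  show "r < r'" if "(g, f, h, q) < (g', f', h', q')"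
  proof -
    have "g < g' \<or> g = g' \<and> (f < f' \<or> f = f' \<and> (h < h' \<or> h = h' \<and> q < q'))"
      using that by auto
    then show ?thesis using tri fm gm hm fb gb' hb fb' by (metis less_asym)
  qed
  show "q < q'" if "(f, h, g) < (f', h', g')"
  proof -
    have "f < f' \<or> f = f' \<and> (h < h' \<or> h = h' \<and> g < g')"
      using that by auto
    then show ?thesis using tri fm gm hm fb gb hb fb' hb' by (metis less_asym)
  qed
qed

lemma cyclic_lexicographic_orders:
  fixes p q r f g h p' q' r' f' g' h' :: nat
  assumes ne: "p \<noteq> p'" "q \<noteq> q'" "r \<noteq> r'"
    and 1: "f < f' \<longrightarrow> q < q'" "g < g' \<longrightarrow> r < r'" "h < h' \<longrightarrow> p < p'"
    and 2: "f' < f \<longrightarrow> q' < q" "g' < g \<longrightarrow> r' < r" "h' < h \<longrightarrow> p' < p"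
    and 3: "f = f' \<longrightarrow> q < q' \<longrightarrow> p < p'" "g = g' \<longrightarrow> r < r' \<longrightarrow> q < q'" "h = h' \<longrightarrow> p < p' \<longrightarrow> r < r'"
    and 4: "f' = f \<longrightarrow> q' < q \<longrightarrow> p' < p" "g' = g \<longrightarrow> r' < r \<longrightarrow> q' < q" "h' = h \<longrightarrow> p' < p \<longrightarrow> r' < r"
  shows "p < p' \<longleftrightarrow> (h, g, f, q) < (h', g', f', q')"
    and "r < r' \<longleftrightarrow> (g, f, h, q) < (g', f', h', q')"
    and "q < q' \<Longrightarrow> (f, h, g) \<le> (f', h', g')"
proof -
  note up = cyclic_lexicographic_orders_aux[OF ne 1 3 4]
    and down = cyclic_lexicographic_orders_aux[OF ne[symmetric] 2 4 3]
  have "(h, g, f, q) \<noteq> (h', g', f', q')" "(g, f, h, q) \<noteq> (g', f', h', q')" using ne by auto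
  then show "p < p' \<longleftrightarrow> (h, g, f, q) < (h', g', f', q')"
    and "r < r' \<longleftrightarrow> (g, f, h, q) < (g', f', h', q')"
    using up(1,2) down(1,2) by (meson less_asym linorder_less_linear)+
  show "(f, h, g) \<le> (f', h', g')" if "q < q'"
    using down(3) that by (meson less_asym not_le)
qed
text \<open>
  The triple (p, q, r) of orders is determined by q alone: p and r compare points by the rotated color
  triples and use q to break ties. So the projection to q is a bijection onto the arrangements
  sorted by (f, h, g), which are as many as the stabilizer has elements.
\<close>

lemma stabilizer_triple:
  assumes k1: "k1 \<in> colorings n a1" "mono_on {1..n} k1"
    and k2: "k2 \<in> colorings n a2" "mono_on {1..n} k2"
    and k3: "k3 \<in> colorings n a3" "mono_on {1..n} k3"
    and f: "f \<in> colorings n a1" and g: "g \<in> colorings n a2" and h: "h \<in> colorings n a3"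
  shows "card {w \<in> Sym n. f \<circ> w = f \<and> g \<circ> w = g \<and> h \<circ> w = h} =
    card {(p, q, r). p \<in> Sym n \<and> q \<in> Sym n \<and> r \<in> Sym n \<and>
      f = k1 \<circ> q \<and> g = k2 \<circ> r \<and> h = k3 \<circ> p \<and>
      increasing_on_blocks n k1 (p \<circ> inv q) \<and> increasing_on_blocks n k2 (q \<circ> inv r) \<and>
      increasing_on_blocks n k3 (r \<circ> inv p)}" (is "_ = card ?T")
proof -
  let ?G = "\<lambda>x. (f x, h x, g x)"
  have ext: "f \<in> extensional {1..n}" "g \<in> extensional {1..n}" "h \<in> extensional {1..n}"
    using f g h by (auto simp: colorings_def PiE_def)
  have "{w \<in> Sym n. f \<circ> w = f \<and> g \<circ> w = g \<and> h \<circ> w = h} =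
      {w \<in> Sym n. \<forall>x\<in>{1..n}. ?G (w x) = ?G x}" (is "?W = ?W'")
    using coloring_fixed_iff[OF ext(1)] coloring_fixed_iff[OF ext(2)] coloring_fixed_iff[OF ext(3)]
    by auto
  then have "card ?W = card ?W'" by (rule arg_cong)
  also note card_stabilizer_eq_card_sorting[of n ?G]
  finally have W: "card ?W = card {t \<in> Sym n. mono_on {1..n} (?G \<circ> inv t)}" .
  have "bij_betw (\<lambda>(p, q, r). q) ?T {t \<in> Sym n. mono_on {1..n} (?G \<circ> inv t)}"
    unfolding bij_betw_def
  proof (intro conjI)
    define D where "D p q r \<longleftrightarrow> p permutes {1..n} \<and> q permutes {1..n} \<and> r permutes {1..n} \<and>
      f = k1 \<circ> q \<and> g = k2 \<circ> r \<and> h = k3 \<circ> p \<and>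
      (\<forall>x\<in>{1..n}. \<forall>y\<in>{1..n}. (f x = f y \<longrightarrow> q x < q y \<longrightarrow> p x < p y) \<and>
          (g x = g y \<longrightarrow> r x < r y \<longrightarrow> q x < q y) \<and> (h x = h y \<longrightarrow> p x < p y \<longrightarrow> r x < r y))" for p q r
    have T: "?T = {(p, q, r). D p q r}"
      unfolding D_def by (auto simp: increasing_on_blocks_comp_inv)
    have ord: "(p x < p y \<longleftrightarrow> (h x, g x, f x, q x) < (h y, g y, f y, q y)) \<and>
        (r x < r y \<longleftrightarrow> (g x, f x, h x, q x) < (g y, f y, h y, q y)) \<and>
        (q x < q y \<longrightarrow> (f x, h x, g x) \<le> (f y, h y, g y))"
      if D: "D p q r" and xy: "x \<in> {1..n}" "y \<in> {1..n}" for p q r x y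
    proof -
      have perms: "p permutes {1..n}" "q permutes {1..n}" "r permutes {1..n}"
        and fgh: "\<And>u. f u = k1 (q u)" "\<And>u. g u = k2 (r u)" "\<And>u. h u = k3 (p u)"
        using D by (auto simp: D_def)
      have mono: "F u < F v \<longrightarrow> s u < s v" if s: "s permutes {1..n}" and k: "mono_on {1..n} k"
        and F: "\<And>u. F u = k (s u)" and uv: "u \<in> {1..n}" "v \<in> {1..n}"
        for s k and F :: "nat \<Rightarrow> nat" and u v
      proof (intro impI, rule ccontr)
        assume lt: "F u < F v" and "\<not> s u < s v"
        then have "k (s v) \<le> k (s u)"
          using uv by (intro mono_onD[OF k]) (simp_all add: permutes_in_image[OF s] del: atLeastAtMost_iff)
        then show False using lt by (simp add: F)
      qed
      note mono = mono[OF perms(2) k1(2) fgh(1)] mono[OF perms(3) k2(2) fgh(2)]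
        mono[OF perms(1) k3(2) fgh(3)]
      have blk: "\<And>u v. u \<in> {1..n} \<Longrightarrow> v \<in> {1..n} \<Longrightarrow> f u = f v \<longrightarrow> q u < q v \<longrightarrow> p u < p v"
        "\<And>u v. u \<in> {1..n} \<Longrightarrow> v \<in> {1..n} \<Longrightarrow> g u = g v \<longrightarrow> r u < r v \<longrightarrow> q u < q v"
        "\<And>u v. u \<in> {1..n} \<Longrightarrow> v \<in> {1..n} \<Longrightarrow> h u = h v \<longrightarrow> p u < p v \<longrightarrow> r u < r v"
        using D unfolding D_def by blast+
      have inj: "s x = s y \<longleftrightarrow> x = y" if "s permutes {1..n}" for s
        using permutes_inj[OF that] by (auto dest: injD)
      show ?thesis
      proof (cases "x = y")
        case False
        have "p x \<noteq> p y" "q x \<noteq> q y" "r x \<noteq> r y"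
          using False perms by (simp_all add: inj)
        note c = cyclic_lexicographic_orders[OF this mono[OF xy] mono[OF xy(2,1)] blk[OF xy] blk[OF xy(2,1)]]
        show ?thesis using c by blast
      qed simp
    qed
    show "inj_on (\<lambda>(p, q, r). q) ?T"
      unfolding T
    proof (rule inj_onI, clarsimp)
      fix p q r p' r' assume D: "D p q r" "D p' q r'"
      then have "p permutes {1..n}" "p' permutes {1..n}" "r permutes {1..n}" "r' permutes {1..n}"
        by (auto simp: D_def)
      note perms = this
      have "p = p'"
        by (rule permutation_determined_by_order[OF perms(1,2)])
          (use ord[OF D(1)] ord[OF D(2)] in blast)
      moreover have "r = r'"
        by (rule permutation_determined_by_order[OF perms(3,4)])
          (use ord[OF D(1)] ord[OF D(2)] in blast)
      ultimately show "p = p' \<and> r = r'" by simp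
    qed
    show "(\<lambda>(p, q, r). q) ` ?T = {t \<in> Sym n. mono_on {1..n} (?G \<circ> inv t)}"
      unfolding T
    proof (intro equalityI subsetI)
      fix q assume "q \<in> (\<lambda>(p, q, r). q) ` {(p, q, r). D p q r}"
      then obtain p r where D: "D p q r" by auto
      then have q: "q permutes {1..n}" by (simp add: D_def)
      have "mono_on {1..n} (?G \<circ> inv q)"
      proof (rule mono_onI)
        fix x y assume xy: "x \<in> {1..n}" "y \<in> {1..n}" "x \<le> y"
        have "inv q x \<in> {1..n}" "inv q y \<in> {1..n}"
          using xy permutes_in_image[OF permutes_inv[OF q]] by auto
        from ord[OF D this] show "(?G \<circ> inv q) x \<le> (?G \<circ> inv q) y"
          using xy permutes_inverses[OF q] by (cases "x = y") auto
      qed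
      with q show "q \<in> {t \<in> Sym n. mono_on {1..n} (?G \<circ> inv t)}" by simp
    next
      fix q assume "q \<in> {t \<in> Sym n. mono_on {1..n} (?G \<circ> inv t)}"
      then have q: "q permutes {1..n}" and mq: "mono_on {1..n} (?G \<circ> inv q)" by auto
      have injq: "q x = q y \<longleftrightarrow> x = y" for x y using permutes_inj[OF q] by (auto dest: injD)
      obtain p where p: "p permutes {1..n}" and po: "\<And>x y. x \<in> {1..n} \<Longrightarrow> y \<in> {1..n} \<Longrightarrow>
          p x < p y \<longleftrightarrow> (h x, g x, f x, q x) < (h y, g y, f y, q y)"
        by (rule exists_permutation_inducing_order[of "\<lambda>x. (h x, g x, f x, q x)" n])
          (auto simp: inj_on_def injq)
      obtain r where r: "r permutes {1..n}" and ro: "\<And>x y. x \<in> {1..n} \<Longrightarrow> y \<in> {1..n} \<Longrightarrow>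
          r x < r y \<longleftrightarrow> (g x, f x, h x, q x) < (g y, f y, h y, q y)"
        by (rule exists_permutation_inducing_order[of "\<lambda>x. (g x, f x, h x, q x)" n])
          (auto simp: inj_on_def injq)
      have qo: "?G x \<le> ?G y" if "x \<in> {1..n}" "y \<in> {1..n}" "q x < q y" for x y
        using mono_onD[OF mq, of "q x" "q y"] that permutes_in_image[OF q]
        by (auto simp: permutes_inverses[OF q])
      have inv_in: "inv s x \<in> {1..n} \<and> inv s y \<in> {1..n}"
        if "s permutes {1..n}" "x \<in> {1..n}" "y \<in> {1..n}" for s x y
        using that permutes_in_image[OF permutes_inv[OF that(1)]] by blast
      have mono_of: "mono_on {1..n} (F \<circ> inv s)"
        if s: "s permutes {1..n}" and F: "\<And>x y. x \<in> {1..n} \<Longrightarrow> y \<in> {1..n} \<Longrightarrow> s x < s y \<Longrightarrow> F x \<le> F y"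
        for s and F :: "nat \<Rightarrow> nat"
      proof (rule mono_onI)
        fix x y assume xy: "x \<in> {1..n}" "y \<in> {1..n}" "x \<le> y"
        then show "(F \<circ> inv s) x \<le> (F \<circ> inv s) y"
          using F[of "inv s x" "inv s y"] inv_in[OF s xy(1,2)] permutes_inverses[OF s]
          by (cases "x = y") auto
      qed
      have "f = k1 \<circ> q"
        by (rule sorted_coloring_unique[OF k1 f q], rule mono_of[OF q]) (use qo in fastforce)
      moreover have "g = k2 \<circ> r"
        by (rule sorted_coloring_unique[OF k2 g r], rule mono_of[OF r]) (auto simp: ro)
      moreover have "h = k3 \<circ> p"
        by (rule sorted_coloring_unique[OF k3 h p], rule mono_of[OF p]) (auto simp: po)
      moreover have "\<forall>x\<in>{1..n}. \<forall>y\<in>{1..n}. (f x = f y \<longrightarrow> q x < q y \<longrightarrow> p x < p y) \<and>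
          (g x = g y \<longrightarrow> r x < r y \<longrightarrow> q x < q y) \<and> (h x = h y \<longrightarrow> p x < p y \<longrightarrow> r x < r y)"
      proof (intro ballI conjI impI)
        fix x y assume xy: "x \<in> {1..n}" "y \<in> {1..n}"
        note o = qo[OF xy] qo[OF xy(2,1)] injq[of x y]
        show "p x < p y" if "f x = f y" "q x < q y" using that o by (auto simp: po[OF xy])
        show "q x < q y" if "g x = g y" "r x < r y"
          using that o by (cases "q x" "q y" rule: linorder_cases) (auto simp: ro[OF xy])
        show "r x < r y" if "h x = h y" "p x < p y"
          using that o by (auto simp: po[OF xy] ro[OF xy])
      qed
      ultimately have "D p q r" using p q r unfolding D_def by simp
      then show "q \<in> (\<lambda>(p, q, r). q) ` {(p, q, r). D p q r}" by force
    qed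
  qed
  then have "card ?T = card {t \<in> Sym n. mono_on {1..n} (?G \<circ> inv t)}"
    by (rule bij_betw_same_card)
  with W show ?thesis by (rule trans[OF _ sym])
qed

text \<open>
  The colorings are determined by the orders (p, q, r), so the sum counts triples of orders.
  Relabelling the points multiplies all three orders by a common permutation; factoring it out leaves
  the triple \<open>s1 = p \<circ> inv q\<close>, \<open>s2 = q \<circ> inv r\<close>, \<open>s3 = r \<circ> inv p\<close> with product id.
\<close>

lemma sum_fixed_colorings_mult3:
  assumes k1: "k1 \<in> colorings n a1" "mono_on {1..n} k1"
    and k2: "k2 \<in> colorings n a2" "mono_on {1..n} k2"
    and k3: "k3 \<in> colorings n a3" "mono_on {1..n} k3"
  shows "(\<Sum>w\<in>Sym n. fixed_colorings n a1 w * fixed_colorings n a2 w * fixed_colorings n a3 w) =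
    fact n * card {(s1, s2, s3). s1 permutes {1..n} \<and> s2 permutes {1..n} \<and> s3 permutes {1..n} \<and>
      increasing_on_blocks n k1 s1 \<and> increasing_on_blocks n k2 s2 \<and> increasing_on_blocks n k3 s3 \<and>
      s1 \<circ> s2 \<circ> s3 = id}" (is "_ = fact n * card ?S")
proof -
  let ?C = "colorings n a1 \<times> colorings n a2 \<times> colorings n a3"
  let ?P = "Sym n \<times> Sym n \<times> Sym n"
  let ?I = "\<lambda>(p, q, r). increasing_on_blocks n k1 (p \<circ> inv q) \<and>
      increasing_on_blocks n k2 (q \<circ> inv r) \<and> increasing_on_blocks n k3 (r \<circ> inv p)"
  let ?K = "\<lambda>(p, q, r). (k1 \<circ> q, k2 \<circ> r, k3 \<circ> p)"
  have fin: "finite ?C" "finite ?P" by (simp_all add: finite_colorings finite_Sym)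
  have "(\<Sum>w\<in>Sym n. fixed_colorings n a1 w * fixed_colorings n a2 w * fixed_colorings n a3 w) =
     (\<Sum>w\<in>Sym n. card {z \<in> ?C. fst z \<circ> w = fst z \<and> fst (snd z) \<circ> w = fst (snd z) \<and> snd (snd z) \<circ> w = snd (snd z)})"
    unfolding fixed_colorings_def mult.assoc
    by (simp only: card_Times_filter)
  also have "\<dots> = (\<Sum>z\<in>?C. card {w \<in> Sym n. fst z \<circ> w = fst z \<and> fst (snd z) \<circ> w = fst (snd z) \<and> snd (snd z) \<circ> w = snd (snd z)})"
    by (rule sum_card_swap[OF finite_Sym fin(1)])
  also have "\<dots> = (\<Sum>z\<in>?C. card {t \<in> ?P. z = ?K t \<and> ?I t})"
  proof (rule sum.cong[OF refl])
    fix z assume "z \<in> ?C"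
    then obtain f g h where z: "z = (f, g, h)" "f \<in> colorings n a1" "g \<in> colorings n a2" "h \<in> colorings n a3"
      by auto
    have "{t \<in> ?P. z = ?K t \<and> ?I t} = {(p, q, r). p \<in> Sym n \<and> q \<in> Sym n \<and> r \<in> Sym n \<and>
      f = k1 \<circ> q \<and> g = k2 \<circ> r \<and> h = k3 \<circ> p \<and>
      increasing_on_blocks n k1 (p \<circ> inv q) \<and> increasing_on_blocks n k2 (q \<circ> inv r) \<and>
      increasing_on_blocks n k3 (r \<circ> inv p)}" by (auto simp: z(1))
    then show "card {w \<in> Sym n. fst z \<circ> w = fst z \<and> fst (snd z) \<circ> w = fst (snd z) \<and> snd (snd z) \<circ> w = snd (snd z)}
        = card {t \<in> ?P. z = ?K t \<and> ?I t}"
      using stabilizer_triple[OF k1 k2 k3 z(2-4)] by (simp add: z(1))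
  qed
  also have "\<dots> = (\<Sum>t\<in>?P. card {z \<in> ?C. z = ?K t \<and> ?I t})"
    by (rule sum_card_swap[OF fin])
  also have "\<dots> = (\<Sum>t\<in>?P. if ?I t then 1 else 0)"
  proof (rule sum.cong[OF refl])
    fix t assume "t \<in> ?P"
    then obtain p q r where t: "t = (p, q, r)" "p permutes {1..n}" "q permutes {1..n}" "r permutes {1..n}"
      by auto
    have "?K t \<in> ?C" using k1(1) k2(1) k3(1) t colorings_comp_iff by auto
    then have "{z \<in> ?C. z = ?K t \<and> ?I t} = (if ?I t then {?K t} else {})" by auto
    then show "card {z \<in> ?C. z = ?K t \<and> ?I t} = (if ?I t then 1 else 0)" by simp
  qed
  also have "\<dots> = card {t \<in> ?P. ?I t}"
    using fin(2) by (simp add: sum.If_cases Int_def case_prod_unfold)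
  also have "\<dots> = card (Sym n \<times> ?S)"
  proof (rule sym, rule bij_betw_same_card[of "\<lambda>(q, s1, s2, s3). (s1 \<circ> q, q, inv s2 \<circ> q)"],
      rule bij_betw_byWitness[where f' = "\<lambda>(p, q, r). (q, p \<circ> inv q, q \<circ> inv r, r \<circ> inv p)"])
    have cancel: "a \<circ> (b \<circ> inv b) = a" "a \<circ> (inv b \<circ> b) = a" "inv b \<circ> (b \<circ> a) = a" "b \<circ> (inv b \<circ> a) = a"
        "(inv b \<circ> b) = id" "(b \<circ> inv b) = id" "inv (inv b) = b"
      if "b permutes {1..n}" for a b :: "nat \<Rightarrow> nat"
      using permutes_inv_o[OF that] by (simp_all flip: comp_assoc add: permutes_inv_inv[OF that])
    have inv_c: "inv (a \<circ> b) = inv b \<circ> inv a" if "a permutes {1..n}" "b permutes {1..n}" for a b :: "nat \<Rightarrow> nat"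
      using that by (simp add: o_inv_distrib permutes_bij)
    have s3: "s3 = inv s2 \<circ> inv s1"
      if "s1 permutes {1..n}" "s2 permutes {1..n}" "s1 \<circ> s2 \<circ> s3 = id" for s1 s2 s3 :: "nat \<Rightarrow> nat"
    proof -
      have "inv s2 \<circ> (inv s1 \<circ> (s1 \<circ> (s2 \<circ> s3))) = inv s2 \<circ> inv s1" using that(3) by (simp add: comp_assoc)
      then show ?thesis by (simp add: cancel that)
    qed
    have fwd: "?I (s1 \<circ> q, q, inv s2 \<circ> q) \<and> (s1 \<circ> q, q, inv s2 \<circ> q) \<in> ?P \<and>
        s1 \<circ> q \<circ> inv q = s1 \<and> q \<circ> inv (inv s2 \<circ> q) = s2 \<and> inv s2 \<circ> q \<circ> inv (s1 \<circ> q) = s3"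
      if q: "q permutes {1..n}" and s: "(s1, s2, s3) \<in> ?S" for q s1 s2 s3
    proof -
      from s have p: "s1 permutes {1..n}" "s2 permutes {1..n}" "s1 \<circ> s2 \<circ> s3 = id"
        and I: "increasing_on_blocks n k1 s1" "increasing_on_blocks n k2 s2" "increasing_on_blocks n k3 s3"
        by auto
      have e: "s1 \<circ> q \<circ> inv q = s1" "q \<circ> inv (inv s2 \<circ> q) = s2" "inv s2 \<circ> q \<circ> inv (s1 \<circ> q) = s3"
        unfolding s3[OF p] by (simp_all add: comp_assoc cancel inv_c permutes_inv q p)
      show ?thesis using I unfolding e by (simp add: e permutes_compose permutes_inv q p)
    qed
    have bwd: "p \<circ> inv q \<circ> q = p \<and> inv (q \<circ> inv r) \<circ> q = r \<and>
        p \<circ> inv q permutes {1..n} \<and> q \<circ> inv r permutes {1..n} \<and> r \<circ> inv p permutes {1..n} \<and>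
        p \<circ> inv q \<circ> (q \<circ> inv r) \<circ> (r \<circ> inv p) = id"
      if "p permutes {1..n}" "q permutes {1..n}" "r permutes {1..n}" for p q r
      using that by (simp add: comp_assoc cancel inv_c permutes_inv permutes_compose)
    show "\<forall>a\<in>Sym n \<times> ?S. (\<lambda>(p, q, r). (q, p \<circ> inv q, q \<circ> inv r, r \<circ> inv p))
        ((\<lambda>(q, s1, s2, s3). (s1 \<circ> q, q, inv s2 \<circ> q)) a) = a"
      using fwd by (clarsimp simp del: mem_Collect_eq split: prod.splits) simp
    show "\<forall>a\<in>{t \<in> ?P. ?I t}. (\<lambda>(q, s1, s2, s3). (s1 \<circ> q, q, inv s2 \<circ> q))
        ((\<lambda>(p, q, r). (q, p \<circ> inv q, q \<circ> inv r, r \<circ> inv p)) a) = a"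
      using bwd by clarsimp
    show "(\<lambda>(q, s1, s2, s3). (s1 \<circ> q, q, inv s2 \<circ> q)) ` (Sym n \<times> ?S) \<subseteq> {t \<in> ?P. ?I t}"
    proof (intro subsetI)
      fix z assume "z \<in> (\<lambda>(q, s1, s2, s3). (s1 \<circ> q, q, inv s2 \<circ> q)) ` (Sym n \<times> ?S)"
      then obtain q s1 s2 s3 where "q permutes {1..n}" "(s1, s2, s3) \<in> ?S" "z = (s1 \<circ> q, q, inv s2 \<circ> q)"
        by auto
      with fwd show "z \<in> {t \<in> ?P. ?I t}" by (metis (lifting) mem_Collect_eq)
    qed
    show "(\<lambda>(p, q, r). (q, p \<circ> inv q, q \<circ> inv r, r \<circ> inv p)) ` {t \<in> ?P. ?I t} \<subseteq> Sym n \<times> ?S"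
      using bwd by clarsimp
  qed
  also have "\<dots> = fact n * card ?S" by (simp add: card_cartesian_product card_Sym)
  finally show ?thesis .
qed

section \<open>Lattice words as an alternating sum of word counts\<close>

text \<open>
  The number \<open>Suc j\<close> is the position, counted from 1, of the letter \<open>x ! j\<close>. A word of row indices of
  a tableau ascends behind position i exactly if i is a descent of the tableau.
\<close>

definition ascents_within :: "nat set \<Rightarrow> nat list \<Rightarrow> bool" where
  "ascents_within I x \<longleftrightarrow> (\<forall>j. Suc j < length x \<longrightarrow> Suc j \<notin> I \<longrightarrow> x ! Suc j \<le> x ! j)"

definition yamanouchi :: "nat list \<Rightarrow> bool" where
  "yamanouchi x \<longleftrightarrow> (\<forall>j\<le>length x. \<forall>i. count_list (take j x) (Suc i) \<le> count_list (take j x) i)"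

definition words :: "nat \<Rightarrow> nat \<Rightarrow> nat set \<Rightarrow> (nat \<Rightarrow> int) \<Rightarrow> nat list set" where
  "words L n I b = {x. length x = n \<and> set x \<subseteq> {..<L} \<and> ascents_within I x \<and>
     (\<forall>i. int (count_list x i) = b i)}"

definition lattice_words :: "nat \<Rightarrow> nat \<Rightarrow> nat set \<Rightarrow> (nat \<Rightarrow> int) \<Rightarrow> nat list set" where
  "lattice_words L n I b = {x \<in> words L n I b. yamanouchi x}"

definition weak_compositions :: "nat \<Rightarrow> nat \<Rightarrow> (nat \<Rightarrow> int) set" where
  "weak_compositions L k = {c. (\<forall>i. 0 \<le> c i) \<and> (\<forall>i\<ge>L. c i = 0) \<and> (\<Sum>i<L. c i) = int k}"

definition decreasing_word :: "(nat \<Rightarrow> int) \<Rightarrow> nat list" where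
  "decreasing_word c = rev (sorted_list_of_multiset (Abs_multiset (\<lambda>i. nat (c i))))"

lemma finite_words: "finite (words L n I b)"
  by (rule finite_subset[OF _ finite_lists_length_eq[of "{..<L}" n]]) (auto simp: words_def)

lemma finite_weak_compositions: "finite (weak_compositions L k)"
proof (rule finite_subset)
  show "weak_compositions L k \<subseteq> {c. \<forall>i. (i \<in> {..<L} \<longrightarrow> c i \<in> {0..int k}) \<and> (i \<notin> {..<L} \<longrightarrow> c i = 0)}"
  proof
    fix c assume c: "c \<in> weak_compositions L k"
    have "c i \<le> int k" if "i < L" for i
    proof -
      have "c i \<le> (\<Sum>i<L. c i)"
        by (rule member_le_sum) (use c that in \<open>auto simp: weak_compositions_def\<close>)
      then show ?thesis using c by (simp add: weak_compositions_def)
    qed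
    then show "c \<in> {c. \<forall>i. (i \<in> {..<L} \<longrightarrow> c i \<in> {0..int k}) \<and> (i \<notin> {..<L} \<longrightarrow> c i = 0)}"
      using c by (auto simp: weak_compositions_def)
  qed
qed (rule finite_set_of_finite_funs; simp)

lemma sorted_rev_iff_nth_Suc:
  "sorted (rev s) \<longleftrightarrow> (\<forall>j. Suc j < length s \<longrightarrow> s ! Suc j \<le> s ! j)" for s :: "nat list"
  by (simp add: sorted_wrt_rev sorted_wrt_iff_nth_Suc_transp)

lemma decreasing_word_props:
  assumes c: "c \<in> weak_compositions L k"
  shows "sorted (rev (decreasing_word c))" "int (count_list (decreasing_word c) i) = c i"
    "length (decreasing_word c) = k" "set (decreasing_word c) \<subseteq> {..<L}"
proof -
  have "{i. 0 < nat (c i)} \<subseteq> {..<L}" using c by (force simp: weak_compositions_def not_le[symmetric])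
  then have fin: "finite {i. 0 < nat (c i)}" by (rule finite_subset) simp
  show "sorted (rev (decreasing_word c))" by (simp add: decreasing_word_def)
  have cnt: "int (count_list (decreasing_word c) i) = c i" for i
  proof -
    have "count_list (decreasing_word c) i = count (mset (decreasing_word c)) i"
      by (simp add: count_mset)
    also have "\<dots> = nat (c i)" using fin by (simp add: decreasing_word_def)
    finally show ?thesis using c by (simp add: weak_compositions_def)
  qed
  show "int (count_list (decreasing_word c) i) = c i" by (rule cnt)
  show sub: "set (decreasing_word c) \<subseteq> {..<L}"
  proof
    fix i assume "i \<in> set (decreasing_word c)"
    then have "count_list (decreasing_word c) i \<noteq> 0" by (simp add: count_list_0_iff)
    then have "c i \<noteq> 0" using cnt[of i] by linarith
    then show "i \<in> {..<L}" using c by (force simp: weak_compositions_def not_le[symmetric])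
  qed
  have "int (length (decreasing_word c)) = (\<Sum>i<L. c i)"
    using sum_count_set[OF sub] by (simp flip: cnt of_nat_sum)
  then show "length (decreasing_word c) = k" using c by (simp add: weak_compositions_def)
qed

lemma decreasing_word_unique:
  assumes s: "sorted (rev s)" and cnt: "\<And>i. int (count_list s i) = c i"
  shows "s = decreasing_word c"
proof -
  have "(\<lambda>i. nat (c i)) = count (mset s)" by (auto simp: count_mset simp flip: cnt)
  then have "decreasing_word c = rev (sorted_list_of_multiset (mset s))"
    by (simp add: decreasing_word_def count_inverse)
  also have "sorted_list_of_multiset (mset s) = rev s"
    using s by (metis mset_rev sorted_list_of_multiset_mset sorted_sort_id)
  finally show ?thesis by simp
qed

lemma ascents_within_append:
  assumes "length y = m" and "m = 0 \<or> m \<in> I" and "\<And>j. m < j \<Longrightarrow> j < m + length s \<Longrightarrow> j \<notin> I"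
  shows "ascents_within I (y @ s) \<longleftrightarrow> ascents_within I y \<and> sorted (rev s)"
proof -
  have "ascents_within I (y @ s) \<longleftrightarrow> ascents_within I y \<and> (\<forall>j. Suc j < length s \<longrightarrow> s ! Suc j \<le> s ! j)"
    (is "?L \<longleftrightarrow> ?A \<and> ?B")
  proof (intro iffI conjI)
    assume L: ?L
    show ?A unfolding ascents_within_def
    proof (intro allI impI)
      fix j assume "Suc j < length y" "Suc j \<notin> I"
      then show "y ! Suc j \<le> y ! j"
        using L[unfolded ascents_within_def, rule_format, of j] by (simp add: nth_append)
    qed
    show ?B
    proof (intro allI impI)
      fix j assume "Suc j < length s"
      then show "s ! Suc j \<le> s ! j"
        using L[unfolded ascents_within_def, rule_format, of "m + j"] assms
        by (simp add: nth_append)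
    qed
  next
    assume AB: "?A \<and> ?B"
    show ?L unfolding ascents_within_def
    proof (intro allI impI)
      fix j assume j: "Suc j < length (y @ s)" "Suc j \<notin> I"
      consider "Suc j < m" | "Suc j = m" | "m \<le> j" by linarith
      then show "(y @ s) ! Suc j \<le> (y @ s) ! j"
      proof cases
        case 1
        then show ?thesis using AB j assms(1) by (simp add: nth_append ascents_within_def)
      next
        case 2
        then show ?thesis using j assms(2) by simp
      next
        case 3
        then show ?thesis using AB j assms(1) by (simp add: nth_append Suc_diff_le)
      qed
    qed
  qed
  then show ?thesis by (simp add: sorted_rev_iff_nth_Suc)
qed

text \<open>
  Between two breaks of I a word is weakly decreasing, hence determined by its content. So the
  last block of a word is the same as a weak composition c of its length.
\<close>

lemma words_split_bij:
  assumes "m \<le> n" and m: "m = 0 \<or> m \<in> I" and I: "\<And>j. m < j \<Longrightarrow> j < n \<Longrightarrow> j \<notin> I"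
  shows "bij_betw (\<lambda>(c, y). y @ decreasing_word c)
    (SIGMA c:weak_compositions L (n - m). words L m I (\<lambda>i. b i - c i)) (words L n I b)"
proof (rule bij_betw_byWitness[where f' = "\<lambda>x. (\<lambda>i. int (count_list (drop m x) i), take m x)"])
  show "\<forall>a\<in>SIGMA c:weak_compositions L (n - m). words L m I (\<lambda>i. b i - c i).
       (\<lambda>x. (\<lambda>i. int (count_list (drop m x) i), take m x)) ((\<lambda>(c, y). y @ decreasing_word c) a) = a"
    using decreasing_word_props by (auto simp: words_def)
  show "(\<lambda>(c, y). y @ decreasing_word c) ` (SIGMA c:weak_compositions L (n - m). words L m I (\<lambda>i. b i - c i))
       \<subseteq> words L n I b"
  proof clarify
    fix c y assume c: "c \<in> weak_compositions L (n - m)" and y: "y \<in> words L m I (\<lambda>i. b i - c i)"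
    note p = decreasing_word_props[OF c]
    have "ascents_within I (y @ decreasing_word c)"
      using ascents_within_append[of y m I "decreasing_word c"] assms y p by (simp add: words_def)
    then show "y @ decreasing_word c \<in> words L n I b" using y p assms(1) by (auto simp: words_def)
  qed
  have split: "drop m x = decreasing_word (\<lambda>i. int (count_list (drop m x) i)) \<and>
      ascents_within I (take m x) \<and> (\<lambda>i. int (count_list (drop m x) i)) \<in> weak_compositions L (n - m)"
    if x: "x \<in> words L n I b" for x
  proof -
    have "ascents_within I (take m x @ drop m x)" using x by (simp add: words_def)
    then have s: "ascents_within I (take m x) \<and> sorted (rev (drop m x))"
      using ascents_within_append[of "take m x" m I "drop m x"] x assms by (simp add: words_def)
    have sub: "set (drop m x) \<subseteq> {..<L}" using x set_drop_subset[of m x] by (auto simp: words_def)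
    have "(\<lambda>i. int (count_list (drop m x) i)) \<in> weak_compositions L (n - m)"
      using x sum_count_set[OF sub] sub
      by (auto simp: words_def weak_compositions_def count_list_0_iff simp flip: of_nat_sum)
    with s show ?thesis by (auto intro: decreasing_word_unique)
  qed
  show "\<forall>x\<in>words L n I b. (\<lambda>(c, y). y @ decreasing_word c)
      ((\<lambda>i. int (count_list (drop m x) i)), take m x) = x"
    using split by (metis (mono_tags, lifting) append_take_drop_id case_prod_conv)
  show "(\<lambda>x. (\<lambda>i. int (count_list (drop m x) i), take m x)) ` words L n I b
      \<subseteq> (SIGMA c:weak_compositions L (n - m). words L m I (\<lambda>i. b i - c i))"
  proof clarify
    fix x assume x: "x \<in> words L n I b"
    have "count_list x i = count_list (take m x) i + count_list (drop m x) i" for i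
      by (metis append_take_drop_id count_list_append)
    then show "(\<lambda>i. int (count_list (drop m x) i)) \<in> weak_compositions L (n - m) \<and>
       take m x \<in> words L m I (\<lambda>i. b i - int (count_list (drop m x) i))"
      using split[OF x] x assms(1) by (auto simp: words_def dest!: in_set_takeD) (metis add_diff_cancel_right' of_nat_add)
  qed
qed

lemma card_words_split:
  assumes "m \<le> n" "m = 0 \<or> m \<in> I" "\<And>j. m < j \<Longrightarrow> j < n \<Longrightarrow> j \<notin> I"
  shows "card (words L n I b) = (\<Sum>c\<in>weak_compositions L (n - m). card (words L m I (\<lambda>i. b i - c i)))"
  using bij_betw_same_card[OF words_split_bij[OF assms]]
  by (simp add: finite_weak_compositions finite_words)

lemma count_list_takeWhile_decreasing:
  assumes "sorted (rev s)"
  shows "count_list (takeWhile (\<lambda>l. i < l) s) (Suc i) = count_list s (Suc i)"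
  using assms
proof (induction s)
  case (Cons a s)
  then have "sorted (rev s)" "\<forall>l\<in>set s. l \<le> a" by (auto simp: sorted_append)
  then show ?case using Cons.IH by (fastforce simp: count_list_0_iff)
qed simp

text \<open>
  In a decreasing block all letters above i come before the letters i. The critical prefix for
  the letter \<open>i + 1\<close> therefore contains all its new copies but no new copy of i. This is the
  interlacing condition of a horizontal strip.
\<close>

lemma yamanouchi_append_decreasing:
  assumes s: "sorted (rev s)"
  shows "yamanouchi (y @ s) \<longleftrightarrow> yamanouchi y \<and> (\<forall>i. count_list (y @ s) (Suc i) \<le> count_list y i)"
proof (intro iffI conjI allI)
  assume Y: "yamanouchi (y @ s)"
  show "yamanouchi y" unfolding yamanouchi_def
  proof (intro allI impI)
    fix j i assume "j \<le> length y"
    then show "count_list (take j y) (Suc i) \<le> count_list (take j y) i"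
      using Y[unfolded yamanouchi_def, rule_format, of j i] by simp
  qed
  fix i
  let ?t = "takeWhile (\<lambda>l. i < l) s"
  have t: "take (length ?t) s = ?t" by (metis takeWhile_eq_take length_takeWhile_le takeWhile_dropWhile_id append_eq_conv_conj)
  have "length ?t \<le> length s" by (rule length_takeWhile_le)
  then have "count_list (take (length y + length ?t) (y @ s)) (Suc i) \<le> count_list (take (length y + length ?t) (y @ s)) i"
    using Y[unfolded yamanouchi_def, rule_format, of "length y + length ?t" i] by simp
  moreover have "count_list ?t i = 0" by (auto simp: count_list_0_iff dest: set_takeWhileD)
  ultimately show "count_list (y @ s) (Suc i) \<le> count_list y i"
    using count_list_takeWhile_decreasing[OF s] by (simp add: t)
next
  assume A: "yamanouchi y \<and> (\<forall>i. count_list (y @ s) (Suc i) \<le> count_list y i)"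
  show "yamanouchi (y @ s)" unfolding yamanouchi_def
  proof (intro allI impI)
    fix j i assume "j \<le> length (y @ s)"
    show "count_list (take j (y @ s)) (Suc i) \<le> count_list (take j (y @ s)) i"
    proof (cases "j \<le> length y")
      case True
      then show ?thesis using A by (simp add: yamanouchi_def)
    next
      case False
      let ?t = "take (j - length y) s"
      have t: "take j (y @ s) = y @ ?t" using False by simp
      have "count_list s (Suc i) = count_list ?t (Suc i) + count_list (drop (j - length y) s) (Suc i)"
        by (metis append_take_drop_id count_list_append)
      then have "count_list (y @ ?t) (Suc i) \<le> count_list (y @ s) (Suc i)" by simp
      also have "\<dots> \<le> count_list y i" using A by simp
      finally show ?thesis unfolding t by simp
    qed
  qed
qed

lemma card_lattice_words_split:
  assumes "m \<le> n" "m = 0 \<or> m \<in> I" "\<And>j. m < j \<Longrightarrow> j < n \<Longrightarrow> j \<notin> I" and supp: "\<forall>i\<ge>L. b i = 0"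
  shows "card (lattice_words L n I b) =
    (\<Sum>c | c \<in> weak_compositions L (n - m) \<and> (\<forall>i. Suc i < L \<longrightarrow> b (Suc i) \<le> b i - c i).
       card (lattice_words L m I (\<lambda>i. b i - c i)))"
proof -
  let ?W = "\<lambda>c. words L m I (\<lambda>i. b i - c i)"
  let ?f = "\<lambda>(c, y). y @ decreasing_word c"
  let ?S = "SIGMA c:weak_compositions L (n - m). ?W c"
  let ?T = "SIGMA c:{c \<in> weak_compositions L (n - m). \<forall>i. Suc i < L \<longrightarrow> b (Suc i) \<le> b i - c i}.
     lattice_words L m I (\<lambda>i. b i - c i)"
  have bij: "bij_betw ?f ?S (words L n I b)" by (rule words_split_bij[OF assms(1-3)])
  have iff: "yamanouchi (y @ decreasing_word c) \<longleftrightarrow>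
       yamanouchi y \<and> (\<forall>i. Suc i < L \<longrightarrow> b (Suc i) \<le> b i - c i)"
    if "c \<in> weak_compositions L (n - m)" "y \<in> ?W c" for c y
  proof -
    have tot: "int (count_list (y @ decreasing_word c) i) = b i" for i
      using that(2) decreasing_word_props(2)[OF that(1), of i] by (simp add: words_def)
    have yc: "int (count_list y i) = b i - c i" for i using that(2) by (simp add: words_def)
    have "(count_list (y @ decreasing_word c) (Suc i) \<le> count_list y i) \<longleftrightarrow> b (Suc i) \<le> b i - c i" for i
      using tot[of "Suc i"] yc[of i] by linarith
    \<comment> \<open>For the last letter the condition only says that the remaining content is nonnegative.\<close>
    moreover have "b (Suc i) \<le> b i - c i" if "\<not> Suc i < L" for i
      using supp that by (simp flip: yc)
    ultimately show ?thesis
      using yamanouchi_append_decreasing[OF decreasing_word_props(1)[OF \<open>c \<in> _\<close>], of y] by blast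
  qed
  have sub: "?T \<subseteq> ?S" by (auto simp: lattice_words_def)
  have img: "?f ` ?T = lattice_words L n I b"
  proof (intro equalityI subsetI)
    fix x assume "x \<in> ?f ` ?T"
    then obtain c y where cy: "(c, y) \<in> ?T" "x = y @ decreasing_word c" by auto
    then have "(c, y) \<in> ?S" using sub by blast
    then have "x \<in> words L n I b" using bij cy(2) by (force simp: bij_betw_def)
    then show "x \<in> lattice_words L n I b" using cy iff by (auto simp: lattice_words_def)
  next
    fix x assume x: "x \<in> lattice_words L n I b"
    then have "x \<in> ?f ` ?S" using bij by (simp add: bij_betw_def lattice_words_def)
    then obtain c y where cy: "(c, y) \<in> ?S" "x = y @ decreasing_word c" by auto
    then have "(c, y) \<in> ?T" using x iff by (auto simp: lattice_words_def)
    then show "x \<in> ?f ` ?T" using cy(2) by (force simp: image_iff)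
  qed
  have "inj_on ?f ?T" using bij sub by (meson bij_betw_def inj_on_subset)
  from card_image[OF this] have "card (lattice_words L n I b) = card ?T" by (simp only: img)
  also have "\<dots> = (\<Sum>c | c \<in> weak_compositions L (n - m) \<and> (\<forall>i. Suc i < L \<longrightarrow> b (Suc i) \<le> b i - c i).
       card (lattice_words L m I (\<lambda>i. b i - c i)))"
    by (simp add: finite_weak_compositions finite_words lattice_words_def)
  finally show ?thesis .
qed

lemma last_break_exists:
  fixes n :: nat
  assumes "n > 0"
  obtains m where "m < n" "m = 0 \<or> m \<in> I" "\<And>j. m < j \<Longrightarrow> j < n \<Longrightarrow> j \<notin> I"
proof -
  define A where "A = insert 0 (I \<inter> {..<n})"
  have fin: "finite A" "A \<noteq> {}" by (simp_all add: A_def)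
  show ?thesis
  proof (rule that[of "Max A"])
    have "Max A \<in> A" by (rule Max_in[OF fin])
    then have "Max A = 0 \<or> Max A \<in> I \<and> Max A < n" by (subst (asm) (2) A_def) blast
    with assms show "Max A < n" "Max A = 0 \<or> Max A \<in> I" by auto
    show "j \<notin> I" if "Max A < j" "j < n" for j
    proof
      assume "j \<in> I"
      then have "j \<in> A" using that(2) by (simp add: A_def)
      from Max_ge[OF fin(1) this] that(1) show False by simp
    qed
  qed
qed

lemma weak_compositions_comp_permutes:
  assumes r: "r permutes {..<L}"
  shows "bij_betw (\<lambda>c. c \<circ> r) (weak_compositions L k) (weak_compositions L k)"
proof -
  have 1: "c \<circ> p \<in> weak_compositions L k" if p: "p permutes {..<L}" and c: "c \<in> weak_compositions L k" for c p
  proof -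
    have "(\<Sum>i<L. c (p i)) = (\<Sum>i<L. c i)" using sum.permute[OF p, of c] by (simp add: o_def)
    moreover have "p i = i" if "i \<ge> L" for i using permutes_not_in[OF p] that by simp
    ultimately show ?thesis using c by (simp add: weak_compositions_def)
  qed
  show ?thesis
    by (rule bij_betw_byWitness[where f' = "\<lambda>c. c \<circ> inv r"])
      (use 1 r permutes_inv[OF r] permutes_inv_o[OF r] in \<open>auto simp: comp_assoc\<close>)
qed

text \<open>
  The Bender-Knuth symmetry of the count: letters may be permuted because, block by block, only the
  contents of the blocks matter.
\<close>

lemma card_words_comp_permutes:
  assumes r: "r permutes {..<L}"
  shows "card (words L n I (b \<circ> r)) = card (words L n I b)"
proof (induction n arbitrary: b rule: less_induct)
  case (less n)
  show ?case
  proof (cases "n = 0")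
    case True
    have "(\<forall>i. 0 = b (r i)) \<longleftrightarrow> (\<forall>i. 0 = b i)"
      using permutes_inverses[OF r] by metis
    then have "words L n I (b \<circ> r) = words L n I b"
      using True by (auto simp: words_def)
    then show ?thesis by (rule arg_cong)
  next
    case False
    then obtain m where m: "m < n" "m = 0 \<or> m \<in> I" "\<And>j. m < j \<Longrightarrow> j < n \<Longrightarrow> j \<notin> I"
      using last_break_exists[of n I] by blast
    have "card (words L n I (b \<circ> r)) = (\<Sum>c\<in>weak_compositions L (n - m). card (words L m I (\<lambda>i. (b \<circ> r) i - c i)))"
      by (rule card_words_split) (use m in auto)
    also have "\<dots> = (\<Sum>c\<in>weak_compositions L (n - m). card (words L m I (\<lambda>i. (b \<circ> r) i - (c \<circ> r) i)))"
      by (rule sum.reindex_bij_betw[OF weak_compositions_comp_permutes[OF r], symmetric])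
    also have "\<dots> = (\<Sum>c\<in>weak_compositions L (n - m). card (words L m I ((\<lambda>i. b i - c i) \<circ> r)))"
      by (simp add: o_def)
    also have "\<dots> = (\<Sum>c\<in>weak_compositions L (n - m). card (words L m I (\<lambda>i. b i - c i)))"
      by (intro sum.cong refl less.IH m)
    also have "\<dots> = card (words L n I b)"
      by (rule card_words_split[symmetric]) (use m in auto)
    finally show ?thesis .
  qed
qed

text \<open>
  With \<open>u i = l i - i\<close> this is the coefficient extraction behind the Jacobi-Trudi determinant.
\<close>

definition alternating_words :: "nat \<Rightarrow> nat \<Rightarrow> nat set \<Rightarrow> (nat \<Rightarrow> int) \<Rightarrow> int" where
  "alternating_words L n I u =
     (\<Sum>p | p permutes {..<L}. sign p * int (card (words L n I (\<lambda>i. u i + int (p i)))))"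

lemma alternating_words_comp_permutes:
  assumes r: "r permutes {..<L}"
  shows "alternating_words L n I (u \<circ> r) = sign r * alternating_words L n I u"
proof -
  have "alternating_words L n I (u \<circ> r) =
      (\<Sum>p | p permutes {..<L}. sign (p \<circ> r) * int (card (words L n I (\<lambda>i. (u \<circ> r) i + int ((p \<circ> r) i)))))"
    unfolding alternating_words_def by (rule sum_permutations_compose_right[OF r])
  also have "\<dots> = (\<Sum>p | p permutes {..<L}. sign r * (sign p * int (card (words L n I (\<lambda>i. u i + int (p i))))))"
  proof (rule sum.cong[OF refl])
    fix p assume "p \<in> {p. p permutes {..<L}}"
    then have "sign (p \<circ> r) = sign p * sign r"
      using r by (auto intro!: sign_compose permutes_imp_permutation[of "{..<L}"])
    moreover have "(\<lambda>i. (u \<circ> r) i + int ((p \<circ> r) i)) = (\<lambda>i. u i + int (p i)) \<circ> r" by auto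
    ultimately show "sign (p \<circ> r) * int (card (words L n I (\<lambda>i. (u \<circ> r) i + int ((p \<circ> r) i)))) =
       sign r * (sign p * int (card (words L n I (\<lambda>i. u i + int (p i)))))"
      by (simp add: card_words_comp_permutes[OF r])
  qed
  also have "\<dots> = sign r * alternating_words L n I u"
    by (simp add: alternating_words_def sum_distrib_left)
  finally show ?thesis .
qed

lemma alternating_words_split:
  assumes "m \<le> n" "m = 0 \<or> m \<in> I" "\<And>j. m < j \<Longrightarrow> j < n \<Longrightarrow> j \<notin> I"
  shows "alternating_words L n I u =
     (\<Sum>c\<in>weak_compositions L (n - m). alternating_words L m I (\<lambda>i. u i - c i))"
proof -
  have e: "(\<lambda>i. u i + int (p i) - c i) = (\<lambda>i. u i - c i + int (p i))" for c and p :: "nat \<Rightarrow> nat"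
    by auto
  have "alternating_words L n I u = (\<Sum>p | p permutes {..<L}. \<Sum>c\<in>weak_compositions L (n - m).
      sign p * int (card (words L m I (\<lambda>i. u i - c i + int (p i)))))"
    unfolding alternating_words_def
  proof (rule sum.cong[OF refl])
    fix p
    have "card (words L n I (\<lambda>i. u i + int (p i))) =
        (\<Sum>c\<in>weak_compositions L (n - m). card (words L m I (\<lambda>i. u i + int (p i) - c i)))"
      by (rule card_words_split) (use assms in auto)
    then show "sign p * int (card (words L n I (\<lambda>i. u i + int (p i)))) =
      (\<Sum>c\<in>weak_compositions L (n - m). sign p * int (card (words L m I (\<lambda>i. u i - c i + int (p i)))))"
      by (simp add: sum_distrib_left e)
  qed
  also have "\<dots> = (\<Sum>c\<in>weak_compositions L (n - m). alternating_words L m I (\<lambda>i. u i - c i))"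
    unfolding alternating_words_def by (rule sum.swap)
  finally show ?thesis .
qed

text \<open>
  For \<open>u i = l i - i\<close> the inequality says that part i of l, after removal of c, is smaller than part
  \<open>i + 1\<close> of l, so that c is not a horizontal strip.
\<close>

definition overtaking :: "nat \<Rightarrow> (nat \<Rightarrow> int) \<Rightarrow> (nat \<Rightarrow> int) \<Rightarrow> nat \<Rightarrow> bool" where
  "overtaking L u c i \<longleftrightarrow> Suc i < L \<and> u i - c i \<le> u (Suc i)"

text \<open>
  Exchanging the entries i and \<open>i + 1\<close> of \<open>u - c\<close> changes the sign of the term. For the least
  overtaking index i this is an involution on the overtaking c, so these terms cancel.
\<close>

lemma sum_overtaking_cancels:
  assumes u: "\<And>i. Suc i < L \<Longrightarrow> u (Suc i) < u i"
  shows "(\<Sum>c | c \<in> weak_compositions L k \<and> (\<exists>i. overtaking L u c i).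
     alternating_words L m I (\<lambda>i. u i - c i)) = 0" (is "sum ?F ?B = 0")
proof -
  define ix where "ix c = (LEAST i. overtaking L u c i)" for c
  \<comment> \<open>T c is the content for which the vector u - T c has the entries i and i + 1 of u - c exchanged.\<close>
  define T where "T c = (\<lambda>j. u j - (u (transpose (ix c) (Suc (ix c)) j) - c (transpose (ix c) (Suc (ix c)) j)))" for c
  have main: "T c \<in> ?B \<and> T (T c) = c \<and> ?F (T c) = - ?F c" if c: "c \<in> ?B" for c
  proof -
    define i where "i = ix c"
    have i: "overtaking L u c i" and least: "\<And>j. j < i \<Longrightarrow> \<not> overtaking L u c j"
      using c unfolding i_def ix_def by (auto intro: LeastI dest: not_less_Least)
    have iL: "Suc i < L" "u i - c i \<le> u (Suc i)" using i by (auto simp: overtaking_def)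
    let ?t = "transpose i (Suc i)"
    have t: "?t permutes {..<L}" using iL by (intro permutes_swap_id) auto
    have Tc: "T c j = u j - (u (?t j) - c (?t j))" for j by (simp add: T_def i_def)
    have Ti: "T c i = u i - u (Suc i) + c (Suc i)" "T c (Suc i) = u (Suc i) - u i + c i"
      by (simp_all add: Tc)
    have To: "T c j = c j" if "j \<noteq> i" "j \<noteq> Suc i" for j using that by (simp add: Tc)
    have wc: "\<And>j. 0 \<le> c j" "\<And>j. L \<le> j \<Longrightarrow> c j = 0" "(\<Sum>j<L. c j) = int k"
      using c by (auto simp: weak_compositions_def)
    have "(\<Sum>j<L. T c j) = (\<Sum>j<L. u j) - (\<Sum>j<L. (\<lambda>j. u j - c j) (?t j))"
      unfolding Tc sum_subtractf by simp
    also have "(\<Sum>j<L. (\<lambda>j. u j - c j) (?t j)) = (\<Sum>j<L. u j - c j)"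
      using sum.permute[OF t, of "\<lambda>j. u j - c j"] by (simp add: o_def)
    finally have sumT: "(\<Sum>j<L. T c j) = int k" using wc(3) by (simp add: sum_subtractf)
    have nonneg: "0 \<le> T c j" for j
    proof -
      consider "j = i" | "j = Suc i" | "j \<noteq> i" "j \<noteq> Suc i" by blast
      then show ?thesis
      proof cases
        case 1
        then show ?thesis using Ti(1) wc(1)[of "Suc i"] u[OF iL(1)] by simp
      next
        case 2
        then show ?thesis using Ti(2) iL(2) by simp
      next
        case 3
        then show ?thesis using To[of j] wc(1)[of j] by simp
      qed
    qed
    have T0: "T c j = 0" if "L \<le> j" for j using To[of j] wc(2)[OF that] that iL(1) by simp
    have TW: "T c \<in> weak_compositions L k"
      using nonneg sumT T0 by (simp add: weak_compositions_def)
    have ot: "overtaking L u (T c) i" using iL wc(1)[of "Suc i"] by (simp add: overtaking_def Ti)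
    have ol: "\<not> overtaking L u (T c) j" if "j < i" for j
      using least[OF that] that To[of j] by (simp add: overtaking_def)
    \<comment> \<open>Entries below i are untouched, so i is the least overtaking index of T c as well.\<close>
    have "ix (T c) = i" unfolding ix_def
      by (rule Least_equality[of "overtaking L u (T c)", OF ot]) (use ol not_less in blast)
    then have TTc: "T (T c) j = u j - (u (?t j) - T c (?t j))" for j by (simp add: T_def)
    have "T (T c) = c" by (rule ext) (simp add: TTc Tc)
    moreover have "?F (T c) = - ?F c"
    proof -
      have "(\<lambda>j. u j - T c j) = (\<lambda>j. u j - c j) \<circ> ?t" by (auto simp: Tc)
      then have "?F (T c) = sign ?t * ?F c"
        using alternating_words_comp_permutes[OF t, of m I "\<lambda>j. u j - c j"] by simp
      then show ?thesis by (simp add: sign_swap_id)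
    qed
    ultimately show ?thesis using TW ot by blast
  qed
  have "sum ?F ?B = sum (\<lambda>c. ?F (T c)) ?B"
    by (rule sum.reindex_bij_witness[of _ T T]) (use main in auto)
  also have "\<dots> = - sum ?F ?B" using main by (simp add: sum_negf)
  finally show ?thesis by simp
qed

lemma strict_mono_permutes_id:
  fixes p :: "nat \<Rightarrow> nat"
  assumes p: "p permutes {..<L}" and mono: "\<And>i. Suc i < L \<Longrightarrow> p i < p (Suc i)"
  shows "p = id"
proof -
  have "i \<le> p i" if "i < L" for i
    using that
  proof (induction i)
    case (Suc i)
    then show ?case using mono[of i] by fastforce
  qed simp
  then have "\<forall>x\<in>{..<L}. x \<le> p x" by simp
  then show ?thesis using permutes_natset_ge[OF p] by blast
qed

text \<open>
  A permutation p with \<open>l i = i - p i\<close> for all i is strictly increasing, as l is weakly decreasing.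
\<close>

lemma alternating_words_0:
  assumes dec: "\<And>i. Suc i < L \<Longrightarrow> lam (Suc i) \<le> lam i"
  shows "alternating_words L 0 I (\<lambda>i. lam i - int i) = (if \<forall>i. lam i = 0 then 1 else 0)"
proof -
  have card_words_0: "card (words L 0 I b) = (if \<forall>i. b i = 0 then 1 else 0)" for b
  proof -
    have "words L 0 I b = (if \<forall>i. b i = 0 then {[]} else {})"
      by (auto simp: words_def ascents_within_def)
    then show ?thesis by simp
  qed
  have "p = id" if p: "p permutes {..<L}" and z: "\<forall>i. lam i - int i + int (p i) = 0" for p
  proof (rule strict_mono_permutes_id[OF p])
    fix i assume "Suc i < L"
    from dec[OF this] z[rule_format, of i] z[rule_format, of "Suc i"] show "p i < p (Suc i)" by simp
  qed
  then have "alternating_words L 0 I (\<lambda>i. lam i - int i) =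
     (\<Sum>p | p permutes {..<L}. if p = id then (if \<forall>i. lam i = 0 then 1 else 0) else 0)"
    unfolding alternating_words_def by (intro sum.cong refl) (auto simp: card_words_0)
  also have "\<dots> = (if \<forall>i. lam i = 0 then 1 else 0)"
    by (simp add: finite_permutations)
  finally show ?thesis .
qed

text \<open>
  Remove the last block. Contents c that overtake cancel, and the other ones are horizontal
  strips: they leave a weakly decreasing vector, and lattice words obey the same recursion.
\<close>

theorem alternating_words_eq_lattice_words:
  assumes "\<And>i. Suc i < L \<Longrightarrow> lam (Suc i) \<le> lam i" and "\<And>i. i \<ge> L \<Longrightarrow> lam i = 0"
  shows "alternating_words L n I (\<lambda>i. lam i - int i) = int (card (lattice_words L n I lam))"
  using assms
proof (induction n arbitrary: lam rule: less_induct)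
  case (less n)
  show ?case
  proof (cases "n = 0")
    case True
    have "lattice_words L 0 I lam = (if \<forall>i. lam i = 0 then {[]} else {})"
      by (auto simp: lattice_words_def words_def yamanouchi_def ascents_within_def)
    then show ?thesis using alternating_words_0[of L lam I] less.prems(1) True by simp
  next
    case False
    then obtain m where m: "m < n" "m = 0 \<or> m \<in> I" "\<And>j. m < j \<Longrightarrow> j < n \<Longrightarrow> j \<notin> I"
      using last_break_exists[of n I] by blast
    let ?W = "weak_compositions L (n - m)"
    let ?u = "\<lambda>i. lam i - int i"
    let ?F = "\<lambda>c. alternating_words L m I (\<lambda>i. ?u i - c i)"
    let ?G = "{c \<in> ?W. \<forall>i. Suc i < L \<longrightarrow> lam (Suc i) \<le> lam i - c i}"
    let ?B = "{c \<in> ?W. \<exists>i. overtaking L ?u c i}"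
    have dec: "?u (Suc i) < ?u i" if "Suc i < L" for i using less.prems(1)[OF that] by simp
    have W: "?W = ?G \<union> ?B" "?G \<inter> ?B = {}" by (auto simp: overtaking_def not_le)
    have fin: "finite ?G" "finite ?B" using finite_weak_compositions[of L "n - m"] by auto
    have "alternating_words L n I ?u = sum ?F ?W"
      by (rule alternating_words_split) (use m in auto)
    also have "\<dots> = sum ?F ?G + sum ?F ?B"
      using sum.union_disjoint[OF fin W(2), of ?F] W(1) by simp
    also have "sum ?F ?B = 0" by (rule sum_overtaking_cancels[of L ?u]) (rule dec)
    also have "sum ?F ?G + 0 = (\<Sum>c\<in>?G. int (card (lattice_words L m I (\<lambda>i. lam i - c i))))"
      unfolding add_0_right
    proof (rule sum.cong[OF refl])
      fix c assume c: "c \<in> ?G"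
      have e: "(\<lambda>i. ?u i - c i) = (\<lambda>i. (lam i - c i) - int i)" by auto
      have pos: "0 \<le> c i" for i using c by (simp add: weak_compositions_def)
      show "?F c = int (card (lattice_words L m I (\<lambda>i. lam i - c i)))"
        unfolding e
      proof (rule less.IH[OF m(1)])
        fix i assume "Suc i < L"
        then have "lam (Suc i) \<le> lam i - c i" using c by simp
        then show "lam (Suc i) - c (Suc i) \<le> lam i - c i" using pos[of "Suc i"] by simp
      qed (use c less.prems(2) in \<open>auto simp: weak_compositions_def\<close>)
    qed
    also have "\<dots> = int (card (lattice_words L n I lam))"
      by (subst card_lattice_words_split[of m n I L lam]) (use m less.prems(2) in auto)
    finally show ?thesis .
  qed
qed

section \<open>Standard tableaux as lattice words\<close>

definition row_lengths :: "nat list \<Rightarrow> nat \<Rightarrow> int" where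
  "row_lengths l i = (if i < length l then int (l ! i) else 0)"

definition row_word :: "nat list \<Rightarrow> (nat \<times> nat \<Rightarrow> nat) \<Rightarrow> nat list" where
  "row_word l T = map (\<lambda>i. fst (inv_into (diagram l) T i)) [1..<Suc (sum_list l)]"

text \<open>
  The box of the entry \<open>Suc i\<close> in the tableau whose entries have the row indices x.
\<close>

definition word_box :: "nat list \<Rightarrow> nat \<Rightarrow> nat \<times> nat" where
  "word_box x i = (x ! i, count_list (take i x) (x ! i))"

lemma partition_nonincreasing:
  assumes "l \<in> partitions n" "i \<le> j" "j < length l"
  shows "l ! j \<le> l ! i"
  using assms by (cases "i = j") (auto simp: partitions_def sorted_wrt_iff_nth_less)

lemma length_le_sum_list: "\<forall>x\<in>set l. 0 < x \<Longrightarrow> length l \<le> sum_list l" for l :: "nat list"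
  by (induction l) auto

lemma partition_length_le: "l \<in> partitions n \<Longrightarrow> length l \<le> n"
  using length_le_sum_list by (auto simp: partitions_def)

lemma row_lengths_nonincreasing:
  assumes "l \<in> partitions n"
  shows "row_lengths l (Suc i) \<le> row_lengths l i"
  using partition_nonincreasing[OF assms, of i "Suc i"] by (auto simp: row_lengths_def)

lemma row_lengths_beyond: "l \<in> partitions n \<Longrightarrow> i \<ge> n \<Longrightarrow> row_lengths l i = 0"
  using partition_length_le[of l n] by (simp add: row_lengths_def)

lemma diagram_Sigma: "diagram l = (SIGMA r:{..<length l}. {..<l ! r})"
  by (auto simp: diagram_def)

lemma finite_diagram: "finite (diagram l)"
  by (simp add: diagram_Sigma)

lemma card_diagram: "card (diagram l) = sum_list l"
  by (simp add: diagram_Sigma sum_list_sum_nth atLeast0LessThan)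

lemma int_card_diagram_row: "int (card {c. (r, c) \<in> diagram l}) = row_lengths l r"
  by (auto simp: diagram_def row_lengths_def)

lemma count_list_map_upt: "count_list (map f [1..<Suc j]) r = card {i \<in> {1..j}. f i = r}"
proof (induction j)
  case (Suc j)
  have "{i \<in> {1..Suc j}. f i = r} = {i \<in> {1..j}. f i = r} \<union> (if f (Suc j) = r then {Suc j} else {})"
    by (auto simp: le_Suc_eq)
  moreover have "card ({i \<in> {1..j}. f i = r} \<union> {Suc j}) = Suc (card {i \<in> {1..j}. f i = r})"
    by (subst Un_commute) simp
  ultimately show ?case using Suc by auto
qed simp

context
  fixes l n T
  assumes l: "l \<in> partitions n" and T: "T \<in> standard_tableaux l"
begin

lemma sum_list_partition: "sum_list l = n"
  using l by (simp add: partitions_def)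

lemma tableau_bij: "bij_betw T (diagram l) {1..n}"
  using T by (simp add: standard_tableaux_def sum_list_partition)

lemma tableau_row_less: "(r, c) \<in> diagram l \<Longrightarrow> (r, c') \<in> diagram l \<Longrightarrow> T (r, c) < T (r, c') \<longleftrightarrow> c < c'"
  using T unfolding standard_tableaux_def by (metis (no_types, lifting) mem_Collect_eq not_less_iff_gr_or_eq)

lemma tableau_column_less: "(r, c) \<in> diagram l \<Longrightarrow> (r', c) \<in> diagram l \<Longrightarrow> r < r' \<Longrightarrow> T (r, c) < T (r', c)"
  using T unfolding standard_tableaux_def by blast

lemma tableau_inv: "i \<in> {1..n} \<Longrightarrow> inv_into (diagram l) T i \<in> diagram l"
  "i \<in> {1..n} \<Longrightarrow> T (inv_into (diagram l) T i) = i"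
  using tableau_bij inv_into_into[of i T "diagram l"] f_inv_into_f[of i T "diagram l"]
  by (auto simp: bij_betw_def)

lemma tableau_inv_eq: "b \<in> diagram l \<Longrightarrow> inv_into (diagram l) T (T b) = b"
  using tableau_bij by (simp add: bij_betw_def)

lemma length_row_word: "length (row_word l T) = n"
  by (simp add: row_word_def sum_list_partition del: upt_Suc)

lemma nth_row_word: "j < n \<Longrightarrow> row_word l T ! j = fst (inv_into (diagram l) T (Suc j))"
  by (simp add: row_word_def sum_list_partition One_nat_def del: upt_Suc)

text \<open>
  Counts the boxes of row r that are occupied after the first j entries. The lattice condition on
  words and the column condition on tableaux are both statements about these numbers.
\<close>

lemma count_take_row_word:
  assumes "j \<le> n"
  shows "count_list (take j (row_word l T)) r = card {c. (r, c) \<in> diagram l \<and> T (r, c) \<le> j}"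
proof -
  have "take j (row_word l T) = map (\<lambda>i. fst (inv_into (diagram l) T i)) [1..<Suc j]"
    using assms by (intro nth_equalityI) (simp_all add: row_word_def sum_list_partition del: upt_Suc)
  then have "count_list (take j (row_word l T)) r = card {i \<in> {1..j}. fst (inv_into (diagram l) T i) = r}"
    by (simp only: count_list_map_upt)
  also have "\<dots> = card {c. (r, c) \<in> diagram l \<and> T (r, c) \<le> j}"
  proof (rule sym, rule bij_betw_same_card[of "\<lambda>c. T (r, c)"],
      rule bij_betw_byWitness[where f' = "\<lambda>i. snd (inv_into (diagram l) T i)"])
    show "\<forall>c\<in>{c. (r, c) \<in> diagram l \<and> T (r, c) \<le> j}. snd (inv_into (diagram l) T (T (r, c))) = c"
      by (simp add: tableau_inv_eq)
    show "\<forall>i\<in>{i \<in> {1..j}. fst (inv_into (diagram l) T i) = r}. T (r, snd (inv_into (diagram l) T i)) = i"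
      using tableau_inv(2) assms by fastforce
    show "(\<lambda>c. T (r, c)) ` {c. (r, c) \<in> diagram l \<and> T (r, c) \<le> j}
        \<subseteq> {i \<in> {1..j}. fst (inv_into (diagram l) T i) = r}"
      using bij_betwE[OF tableau_bij] by (auto simp: tableau_inv_eq)
    show "(\<lambda>i. snd (inv_into (diagram l) T i)) ` {i \<in> {1..j}. fst (inv_into (diagram l) T i) = r}
        \<subseteq> {c. (r, c) \<in> diagram l \<and> T (r, c) \<le> j}"
    proof clarify
      fix i assume i: "i \<in> {1..j}" "r = fst (inv_into (diagram l) T i)"
      then have "i \<in> {1..n}" using assms by simp
      from tableau_inv[OF this] i show "(fst (inv_into (diagram l) T i), snd (inv_into (diagram l) T i)) \<in> diagram l \<and>
          T (fst (inv_into (diagram l) T i), snd (inv_into (diagram l) T i)) \<le> j" by simp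
    qed
  qed
  finally show ?thesis .
qed

lemma finite_diagram_row: "finite {c. (r, c) \<in> diagram l \<and> P c}"
  by (rule finite_subset[of _ "{..<l ! r}"]) (auto simp: diagram_def)

lemma row_word_lattice:
  assumes I: "tableau_descent_set l T \<subseteq> I"
  shows "row_word l T \<in> lattice_words n n I (row_lengths l)"
proof -
  have "set (row_word l T) \<subseteq> {..<n}"
  proof
    fix r assume "r \<in> set (row_word l T)"
    then obtain i where "i \<in> {1..n}" "r = fst (inv_into (diagram l) T i)"
      by (auto simp: row_word_def sum_list_partition less_Suc_eq_le simp del: upt_Suc)
    then have "r < length l" using tableau_inv(1)[of i] by (auto simp: diagram_def split: prod.splits)
    then show "r \<in> {..<n}" using partition_length_le[OF l] by simp
  qed
  moreover have "ascents_within I (row_word l T)"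
    unfolding ascents_within_def length_row_word
  proof (intro allI impI, rule ccontr)
    fix j assume j: "Suc j < n" "Suc j \<notin> I" and "\<not> row_word l T ! Suc j \<le> row_word l T ! j"
    then have lt: "fst (inv_into (diagram l) T (Suc j)) < fst (inv_into (diagram l) T (Suc (Suc j)))"
      by (simp add: nth_row_word)
    have "Suc j \<in> {1..n}" "Suc (Suc j) \<in> {1..n}" using j by auto
    note i = tableau_inv[OF this(1)] tableau_inv[OF this(2)]
    have "Suc j \<in> tableau_descent_set l T"
      unfolding tableau_descent_set_def sum_list_partition mem_Collect_eq
      by (intro conjI exI[of _ "fst (inv_into (diagram l) T (Suc j))"]
          exI[of _ "snd (inv_into (diagram l) T (Suc j))"]
          exI[of _ "fst (inv_into (diagram l) T (Suc (Suc j)))"]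
          exI[of _ "snd (inv_into (diagram l) T (Suc (Suc j)))"]) (use j lt i in auto)
    then show False using I j by blast
  qed
  moreover have "int (count_list (row_word l T) r) = row_lengths l r" for r
  proof -
    have "count_list (row_word l T) r = card {c. (r, c) \<in> diagram l \<and> T (r, c) \<le> n}"
      using count_take_row_word[of n r] length_row_word by simp
    also have "{c. (r, c) \<in> diagram l \<and> T (r, c) \<le> n} = {c. (r, c) \<in> diagram l}"
      using bij_betwE[OF tableau_bij] by auto
    finally show ?thesis by (simp add: int_card_diagram_row)
  qed
  moreover have "yamanouchi (row_word l T)"
    unfolding yamanouchi_def length_row_word
  proof (intro allI impI)
    fix j r assume j: "j \<le> n"
    have "{c. (Suc r, c) \<in> diagram l \<and> T (Suc r, c) \<le> j} \<subseteq> {c. (r, c) \<in> diagram l \<and> T (r, c) \<le> j}"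
    proof clarify
      fix c assume c: "(Suc r, c) \<in> diagram l" "T (Suc r, c) \<le> j"
      then have "(r, c) \<in> diagram l"
        using partition_nonincreasing[OF l, of r "Suc r"] by (auto simp: diagram_def)
      with c tableau_column_less[OF this c(1)] show "(r, c) \<in> diagram l \<and> T (r, c) \<le> j" by simp
    qed
    then show "count_list (take j (row_word l T)) (Suc r) \<le> count_list (take j (row_word l T)) r"
      unfolding count_take_row_word[OF j] by (intro card_mono finite_diagram_row)
  qed
  ultimately show ?thesis by (simp add: lattice_words_def words_def length_row_word)
qed

lemma word_box_row_word:
  assumes i: "i < n"
  shows "word_box (row_word l T) i = inv_into (diagram l) T (Suc i)"
proof -
  obtain r c where rc: "inv_into (diagram l) T (Suc i) = (r, c)" by fastforce
  have "Suc i \<in> {1..n}" using i by simp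
  with tableau_inv[OF this] rc have d: "(r, c) \<in> diagram l" "T (r, c) = Suc i" by auto
  have "{c'. (r, c') \<in> diagram l \<and> T (r, c') \<le> i} = {..<c}"
    using tableau_row_less[of r _ c] d by (auto simp: diagram_def less_Suc_eq_le)
  then have "count_list (take i (row_word l T)) r = c"
    using i by (simp add: count_take_row_word)
  then show ?thesis using i by (simp add: word_box_def nth_row_word rc)
qed

end

lemma row_word_inj:
  assumes l: "l \<in> partitions n"
  shows "inj_on (row_word l) (standard_tableaux l)"
proof (rule inj_onI)
  fix S T assume S: "S \<in> standard_tableaux l" and T: "T \<in> standard_tableaux l" and eq: "row_word l S = row_word l T"
  show "S = T"
  proof (rule extensionalityI[of _ "diagram l"])
    show "S \<in> extensional (diagram l)" "T \<in> extensional (diagram l)"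
      using S T by (auto simp: standard_tableaux_def)
    fix b assume b: "b \<in> diagram l"
    have "T b \<in> {1..n}" using bij_betwE[OF tableau_bij[OF l T]] b by blast
    then obtain i where i: "T b = Suc i" "i < n" by (cases "T b") auto
    then have "inv_into (diagram l) S (T b) = b"
      using word_box_row_word[OF l S i(2)] word_box_row_word[OF l T i(2)] tableau_inv_eq[OF l T b] eq by simp
    then show "S b = T b" using tableau_inv(2)[OF l S \<open>T b \<in> {1..n}\<close>] by simp
  qed
qed

lemma count_take_mono: "i \<le> j \<Longrightarrow> count_list (take i x) r \<le> count_list (take j x) r"
  by (metis count_list_append le_add1 le_Suc_ex take_add)

lemma count_take_Suc: "i < length x \<Longrightarrow> count_list (take (Suc i) x) (x ! i) = Suc (count_list (take i x) (x ! i))"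
  by (simp add: take_Suc_conv_app_nth)

text \<open>
  The definition compares neighbouring letters; the column condition needs any two rows.
\<close>

lemma yamanouchi_count_antimono:
  assumes "yamanouchi x" "j \<le> length x" "r \<le> r'"
  shows "count_list (take j x) r' \<le> count_list (take j x) r"
  using assms(3)
proof (induction r' rule: dec_induct)
  case (step k)
  then show ?case using assms(1,2) by (auto simp: yamanouchi_def intro: le_trans)
qed simp

lemma word_box_bij:
  assumes l: "l \<in> partitions n" and x: "x \<in> words n n I (row_lengths l)"
  shows "bij_betw (word_box x) {..<n} (diagram l)"
proof -
  have len: "length x = n" and cnt: "\<And>r. int (count_list x r) = row_lengths l r" using x by (auto simp: words_def)
  have lt: "count_list (take i x) (x ! i) < count_list (take j x) (x ! i)" if "i < j" "j \<le> n" for i j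
    using count_take_Suc[of i x] count_take_mono[of "Suc i" j x "x ! i"] that len by simp
  have inj: "inj_on (word_box x) {..<n}"
  proof (rule inj_onI, rule ccontr)
    fix i j assume "i \<in> {..<n}" "j \<in> {..<n}" "word_box x i = word_box x j" "i \<noteq> j"
    then show False using lt[of i j] lt[of j i] by (auto simp: word_box_def neq_iff)
  qed
  moreover have "word_box x ` {..<n} = diagram l"
  proof (rule card_subset_eq[OF finite_diagram])
    show "word_box x ` {..<n} \<subseteq> diagram l"
    proof
      fix b assume "b \<in> word_box x ` {..<n}"
      then obtain r c i where i: "i \<in> {..<n}" "word_box x i = (r, c)" "b = (r, c)"
        by (metis image_iff surj_pair)
      then have "c < count_list x r" using lt[of i n] len by (auto simp: word_box_def)
      then have "int c < row_lengths l r" by (simp flip: cnt)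
      then show "b \<in> diagram l" by (auto simp: i(3) row_lengths_def diagram_def split: if_splits)
    qed
    show "card (word_box x ` {..<n}) = card (diagram l)"
      using l by (simp add: card_image[OF inj] card_diagram partitions_def)
  qed
  ultimately show ?thesis by (simp add: bij_betw_def)
qed

text \<open>
  Filling the boxes \<open>word_box x 0\<close>, \<open>word_box x 1\<close>, ... in this order gives the tableau. Rows increase
  by construction, and columns increase since by the lattice condition the box in the higher row is
  always occupied first.
\<close>

lemma lattice_word_is_row_word:
  assumes l: "l \<in> partitions n" and x: "x \<in> lattice_words n n I (row_lengths l)"
  shows "\<exists>T\<in>standard_tableaux l. tableau_descent_set l T \<subseteq> I \<and> row_word l T = x"
proof -
  have xw: "x \<in> words n n I (row_lengths l)" and Y: "yamanouchi x" using x by (auto simp: lattice_words_def)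
  then have len: "length x = n" and asc: "ascents_within I x" by (auto simp: words_def)
  have n: "sum_list l = n" using l by (simp add: partitions_def)
  note bij = word_box_bij[OF l xw]
  define T where "T = restrict (\<lambda>b. Suc (inv_into {..<n} (word_box x) b)) (diagram l)"
  have T_box: "T (word_box x i) = Suc i" if "i < n" for i
    using bij_betwE[OF bij] bij that by (simp add: T_def bij_betw_def)
  have box: "\<exists>i<n. b = word_box x i" if "b \<in> diagram l" for b
    using bij that by (auto simp: bij_betw_def)
  have Tbij: "bij_betw T (diagram l) {1..n}"
  proof -
    have "bij_betw (\<lambda>b. Suc (inv_into {..<n} (word_box x) b)) (diagram l) {1..n}"
      using bij_betw_trans[OF bij_betw_inv_into[OF bij], of Suc "{1..n}"]
      by (simp add: o_def bij_betw_def image_Suc_lessThan)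
    then show ?thesis by (subst bij_betw_cong[of _ T]) (simp_all add: T_def)
  qed
  have std: "T \<in> standard_tableaux l"
    unfolding standard_tableaux_def mem_Collect_eq n
  proof (intro conjI allI impI Tbij)
    show "T \<in> extensional (diagram l)" by (simp add: T_def)
  next
    fix r c c' assume "(r, c) \<in> diagram l \<and> (r, c') \<in> diagram l \<and> c < c'"
    then obtain i j where ij: "i < n" "(r, c) = word_box x i" "j < n" "(r, c') = word_box x j" "c < c'"
      using box[of "(r, c)"] box[of "(r, c')"] by blast
    then have "\<not> j \<le> i" using count_take_mono[of j i x r] by (auto simp: word_box_def)
    then show "T (r, c) < T (r, c')" using T_box ij by simp
  next
    fix r r' c assume "(r, c) \<in> diagram l \<and> (r', c) \<in> diagram l \<and> r < r'"
    then obtain i j where ij: "i < n" "(r, c) = word_box x i" "j < n" "(r', c) = word_box x j" "r < r'"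
      using box[of "(r, c)"] box[of "(r', c)"] by blast
    then have xi: "x ! i = r" "x ! j = r'" "count_list (take i x) r = c" "count_list (take j x) r' = c"
      by (auto simp: word_box_def)
    have "\<not> j \<le> i"
    proof
      assume "j \<le> i"
      then have "Suc j \<le> i" using xi ij(5) by (cases "i = j") auto
      have "Suc c = count_list (take (Suc j) x) r'" using count_take_Suc[of j x] len ij xi by simp
      also have "\<dots> \<le> count_list (take (Suc j) x) r"
        using yamanouchi_count_antimono[OF Y, of "Suc j" r r'] len ij by simp
      also have "\<dots> \<le> c" using count_take_mono[OF \<open>Suc j \<le> i\<close>, of x r] xi by simp
      finally show False by simp
    qed
    then show "T (r, c) < T (r', c)" using T_box ij by simp
  qed
  have inv: "inv_into (diagram l) T (Suc i) = word_box x i" if "i < n" for i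
    using tableau_inv_eq[OF l std, of "word_box x i"] T_box[OF that] bij_betwE[OF bij] that by simp
  have "row_word l T = x"
    by (rule nth_equalityI) (simp_all add: length_row_word[OF l std] len nth_row_word[OF l std] inv word_box_def)
  moreover have "tableau_descent_set l T \<subseteq> I"
  proof
    fix i assume "i \<in> tableau_descent_set l T"
    then obtain r c r' c' where d: "(r, c) \<in> diagram l" "(r', c') \<in> diagram l" "T (r, c) = i" "T (r', c') = i + 1" "r < r'"
      by (auto simp: tableau_descent_set_def)
    then obtain a b where ab: "a < n" "(r, c) = word_box x a" "b < n" "(r', c') = word_box x b"
      using box[of "(r, c)"] box[of "(r', c')"] by blast
    then have "i = Suc a" "b = Suc a" using T_box d by auto
    moreover have "x ! a < x ! b" using ab d(5) by (auto simp: word_box_def)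
    ultimately show "i \<in> I"
      using asc[unfolded ascents_within_def, rule_format, of a] ab len by auto
  qed
  ultimately show ?thesis using std by blast
qed

theorem card_tableaux_eq_card_lattice_words:
  assumes l: "l \<in> partitions n"
  shows "card {T \<in> standard_tableaux l. tableau_descent_set l T \<subseteq> I} = card (lattice_words n n I (row_lengths l))"
proof (rule bij_betw_same_card[of "row_word l"], unfold bij_betw_def, intro conjI)
  show "inj_on (row_word l) {T \<in> standard_tableaux l. tableau_descent_set l T \<subseteq> I}"
    using row_word_inj[OF l] by (rule inj_on_subset) auto
  show "row_word l ` {T \<in> standard_tableaux l. tableau_descent_set l T \<subseteq> I} = lattice_words n n I (row_lengths l)"
    using row_word_lattice[OF l] lattice_word_is_row_word[OF l] by blast
qed

section \<open>Traces on subspaces and the group algebra\<close>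

lemma sum_fun_apply: "(\<Sum>a\<in>A. f a) x = (\<Sum>a\<in>A. f a x)" for f :: "'a \<Rightarrow> 'b \<Rightarrow> 'c::comm_monoid_add"
  by (induction A rule: infinite_finite_induct) auto

lemma finite_if_independent_supported:
  assumes G: "finite G" and ind: "\<not> cfun.dependent B" and supp: "\<And>b g. b \<in> B \<Longrightarrow> g \<notin> G \<Longrightarrow> b g = 0"
  shows "finite B"
proof -
  let ?e = "\<lambda>g t. if t = g then 1 else 0 :: complex"
  have "B \<subseteq> cfun.span (?e ` G)"
  proof
    fix b assume b: "b \<in> B"
    have "b = (\<Sum>g\<in>G. (\<lambda>t. b g * ?e g t))"
    proof
      fix t
      have "(\<Sum>g\<in>G. (\<lambda>t. b g * ?e g t)) t = (\<Sum>g\<in>G. if g = t then b g else 0)"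
        unfolding sum_fun_apply by (intro sum.cong) auto
      then show "b t = (\<Sum>g\<in>G. (\<lambda>t. b g * ?e g t)) t"
        using supp[OF b, of t] G by auto
    qed
    also have "\<dots> \<in> cfun.span (?e ` G)"
      by (intro cfun.span_sum cfun.span_scale cfun.span_base) auto
    finally show "b \<in> cfun.span (?e ` G)" .
  qed
  with cfun.independent_span_bound[OF finite_imageI[OF G] ind] show ?thesis by blast
qed

text \<open>
  If f factors through a projection of the whole function space onto V, its trace on V can be read off
  in the standard basis. The functions F g play the role of the images of the standard basis vectors,
  so no basis of V has to be known.
\<close>

lemma trace_on_eq_sum:
  assumes G: "finite G" and V: "cfun.subspace V" and supp: "\<And>v g. v \<in> V \<Longrightarrow> g \<notin> G \<Longrightarrow> v g = 0"
    and F: "\<And>g. g \<in> G \<Longrightarrow> F g \<in> V"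
    and f: "\<And>v. v \<in> V \<Longrightarrow> f v = (\<lambda>t. \<Sum>g\<in>G. v g * F g t)"
  shows "trace_on V f = (\<Sum>g\<in>G. F g g)"
proof -
  define B where "B = (SOME B. \<not> cfun.dependent B \<and> cfun.span B = V)"
  have "\<exists>B. \<not> cfun.dependent B \<and> cfun.span B = V"
    using cfun.basis_exists[of V] cfun.span_minimal[OF _ V] by (metis subset_antisym)
  then have "\<not> cfun.dependent B \<and> cfun.span B = V" unfolding B_def by (rule someI_ex)
  then have B: "\<not> cfun.dependent B" "cfun.span B = V" by auto
  have BV: "B \<subseteq> V" using cfun.span_superset[of B] B(2) by simp
  have fin: "finite B" by (rule finite_if_independent_supported[OF G B(1)]) (use BV supp in blast)
  have "trace_on V f = (\<Sum>b\<in>B. cfun.representation B (f b) b)"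
    by (simp add: trace_on_def B_def[symmetric])
  also have "\<dots> = (\<Sum>b\<in>B. \<Sum>g\<in>G. b g * cfun.representation B (F g) b)"
  proof (rule sum.cong[OF refl])
    fix b assume b: "b \<in> B"
    have "f b = (\<Sum>g\<in>G. (\<lambda>t. b g * F g t))"
      using f[of b] b BV by (auto simp: fun_eq_iff sum_fun_apply)
    then have "cfun.representation B (f b) = (\<lambda>b'. \<Sum>g\<in>G. cfun.representation B (\<lambda>t. b g * F g t) b')"
      using F by (simp only:) (intro cfun.representation_sum B cfun.span_scale; simp add: B)
    also have "\<dots> = (\<lambda>b'. \<Sum>g\<in>G. b g * cfun.representation B (F g) b')"
      using F by (intro ext sum.cong refl) (simp add: cfun.representation_scale B)
    finally show "cfun.representation B (f b) b = (\<Sum>g\<in>G. b g * cfun.representation B (F g) b)" by simp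
  qed
  also have "\<dots> = (\<Sum>g\<in>G. \<Sum>b\<in>B. b g * cfun.representation B (F g) b)" by (rule sum.swap)
  also have "\<dots> = (\<Sum>g\<in>G. F g g)"
  proof (rule sum.cong[OF refl])
    fix g assume g: "g \<in> G"
    have "(\<Sum>b\<in>B. (\<lambda>t. cfun.representation B (F g) b * b t)) = F g"
      by (rule cfun.sum_representation_eq[OF B(1) _ fin]) (use F[OF g] B in auto)
    then have "(\<Sum>b\<in>B. (\<lambda>t. cfun.representation B (F g) b * b t)) g = F g g" by simp
    then show "(\<Sum>b\<in>B. b g * cfun.representation B (F g) b) = F g g"
      by (simp add: sum_fun_apply mult.commute)
  qed
  finally show ?thesis .
qed

lemma permutes_group_simps:
  assumes "p permutes S"
  shows "p \<circ> inv p = id" "inv p \<circ> p = id" "p \<circ> (inv p \<circ> g) = g" "inv p \<circ> (p \<circ> g) = g"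
    "inv (inv p) = p" "inv p permutes S" "p (inv p x) = x" "inv p (p x) = x"
  using assms permutes_inv_o[OF assms] permutes_inv[OF assms] permutes_inv_inv[OF assms] permutes_inverses[OF assms]
  by (simp_all flip: comp_assoc)

lemma inv_comp_permutes: "p permutes S \<Longrightarrow> q permutes S \<Longrightarrow> inv (p \<circ> q) = inv q \<circ> inv p"
  by (simp add: o_inv_distrib permutes_bij)

lemma sum_Sym_left:
  assumes "k permutes {1..n}" shows "(\<Sum>h\<in>Sym n. f (k \<circ> h)) = (\<Sum>h\<in>Sym n. f h)"
  using setum_permutations_compose_left[OF assms, of f] by simp

lemma sum_Sym_right:
  assumes "k permutes {1..n}" shows "(\<Sum>h\<in>Sym n. f (h \<circ> k)) = (\<Sum>h\<in>Sym n. f h)"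
  using sum_permutations_compose_right[OF assms, of f] by simp

lemma sum_Sym_inv: "(\<Sum>h\<in>Sym n. f (inv h)) = (\<Sum>h\<in>Sym n. f h)"
  using sum_permutations_inverse[of f "{1..n}"] by simp

lemma sum_Sym_conj:
  assumes k: "k permutes {1..n}"
  shows "(\<Sum>h\<in>Sym n. f (k \<circ> h \<circ> inv k)) = (\<Sum>h\<in>Sym n. f h)"
proof -
  have "(\<Sum>h\<in>Sym n. f (k \<circ> h \<circ> inv k)) = (\<Sum>h\<in>Sym n. f (h \<circ> inv k))"
    by (rule sum_Sym_left[OF k])
  also have "\<dots> = (\<Sum>h\<in>Sym n. f h)" by (rule sum_Sym_right[OF permutes_inv[OF k]])
  finally show ?thesis .
qed

lemma ga_mult_apply:
  "g permutes {1..n} \<Longrightarrow> ga_mult n x y g = (\<Sum>h\<in>Sym n. x h * y (inv h \<circ> g))"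
  by (simp add: ga_mult_def)

lemma ga_mult_outside: "\<not> g permutes {1..n} \<Longrightarrow> ga_mult n x y g = 0"
  by (simp add: ga_mult_def)

lemma ga_mult_assoc: "ga_mult n (ga_mult n x y) z = ga_mult n x (ga_mult n y z)"
proof
  fix g show "ga_mult n (ga_mult n x y) z g = ga_mult n x (ga_mult n y z) g"
  proof (cases "g permutes {1..n}")
    case g: True
    have "ga_mult n (ga_mult n x y) z g = (\<Sum>h\<in>Sym n. \<Sum>k\<in>Sym n. x k * y (inv k \<circ> h) * z (inv h \<circ> g))"
      by (simp add: ga_mult_apply g sum_distrib_right)
    also have "\<dots> = (\<Sum>k\<in>Sym n. \<Sum>h\<in>Sym n. x k * y (inv k \<circ> h) * z (inv h \<circ> g))"
      by (rule sum.swap)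
    also have "\<dots> = (\<Sum>k\<in>Sym n. \<Sum>h\<in>Sym n. x k * y h * z (inv h \<circ> (inv k \<circ> g)))"
    proof (rule sum.cong[OF refl])
      fix k assume "k \<in> Sym n"
      then have k: "k permutes {1..n}" by simp
      have "(\<Sum>h\<in>Sym n. x k * y (inv k \<circ> h) * z (inv h \<circ> g)) =
          (\<Sum>h\<in>Sym n. x k * y (inv k \<circ> (k \<circ> h)) * z (inv (k \<circ> h) \<circ> g))"
        by (rule sum_Sym_left[OF k, symmetric])
      also have "\<dots> = (\<Sum>h\<in>Sym n. x k * y h * z (inv h \<circ> (inv k \<circ> g)))"
        by (intro sum.cong refl) (simp add: permutes_group_simps[OF k] inv_comp_permutes[OF k] comp_assoc)
      finally show "(\<Sum>h\<in>Sym n. x k * y (inv k \<circ> h) * z (inv h \<circ> g)) =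
          (\<Sum>h\<in>Sym n. x k * y h * z (inv h \<circ> (inv k \<circ> g)))" .
    qed
    also have "\<dots> = ga_mult n x (ga_mult n y z) g"
      by (simp add: ga_mult_apply g permutes_compose permutes_inv sum_distrib_left mult.assoc)
    finally show ?thesis .
  qed (simp add: ga_mult_outside)
qed

lemma ga_mult_single_left:
  assumes "k permutes {1..n}" "g permutes {1..n}"
  shows "ga_mult n (ga_single k) x g = x (inv k \<circ> g)"
proof -
  have "ga_mult n (ga_single k) x g = (\<Sum>h\<in>Sym n. if h = k then x (inv k \<circ> g) else 0)"
    unfolding ga_mult_apply[OF assms(2)] by (intro sum.cong refl) (simp add: ga_single_def)
  also have "\<dots> = x (inv k \<circ> g)" using assms finite_Sym[of n] by simp
  finally show ?thesis .
qed

lemma ga_mult_scale_left: "ga_mult n (\<lambda>g. a * x g) y = (\<lambda>g. a * ga_mult n x y g)"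
  by (auto simp: fun_eq_iff ga_mult_def sum_distrib_left mult.assoc)

lemma ga_mult_scale_right: "ga_mult n x (\<lambda>g. a * y g) = (\<lambda>g. a * ga_mult n x y g)"
  by (auto simp: fun_eq_iff ga_mult_def sum_distrib_left mult.left_commute)

lemma ga_mult_add_left: "ga_mult n (x + y) z = ga_mult n x z + ga_mult n y z"
  by (auto simp: fun_eq_iff ga_mult_def sum.distrib distrib_right)

lemma ga_mult_inv:
  assumes g: "g permutes {1..n}"
  shows "ga_mult n x y (inv g) = ga_mult n (\<lambda>h. y (inv h)) (\<lambda>h. x (inv h)) g"
proof -
  have "ga_mult n x y (inv g) = (\<Sum>h\<in>Sym n. x h * y (inv h \<circ> inv g))"
    by (simp add: ga_mult_apply permutes_inv g)
  also have "\<dots> = (\<Sum>h\<in>Sym n. x (inv g \<circ> h) * y (inv (inv g \<circ> h) \<circ> inv g))"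
    by (rule sum_Sym_left[OF permutes_inv[OF g], symmetric])
  also have "\<dots> = (\<Sum>h\<in>Sym n. y (inv h) * x (inv (inv h \<circ> g)))"
    by (intro sum.cong refl)
      (simp add: inv_comp_permutes[where S = "{1..n}"] permutes_group_simps[OF g]
        permutes_group_simps[where S = "{1..n}"] g comp_assoc)
  also have "\<dots> = ga_mult n (\<lambda>h. y (inv h)) (\<lambda>h. x (inv h)) g" by (simp add: ga_mult_apply g)
  finally show ?thesis .
qed

text \<open>
  The sum over a conjugacy class is a trace on the group algebra.
\<close>

lemma class_sum_ga_mult_commute:
  assumes w: "w permutes {1..n}"
  shows "(\<Sum>h\<in>Sym n. ga_mult n x y (inv h \<circ> w \<circ> h)) = (\<Sum>h\<in>Sym n. ga_mult n y x (inv h \<circ> w \<circ> h))"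
proof -
  let ?L = "\<lambda>h k. x k * y (inv k \<circ> (inv h \<circ> w \<circ> h))"
  let ?R = "\<lambda>h k. x k * y (inv h \<circ> w \<circ> h \<circ> inv k)"
  have conj: "inv h \<circ> w \<circ> h permutes {1..n}" if "h permutes {1..n}" for h
    using that w by (simp add: permutes_compose permutes_inv)
  have "(\<Sum>h\<in>Sym n. ga_mult n x y (inv h \<circ> w \<circ> h)) =
      (\<Sum>h\<in>Sym n. \<Sum>k\<in>Sym n. ?L h k)"
    by (intro sum.cong refl) (simp add: ga_mult_apply conj)
  also have "\<dots> = (\<Sum>k\<in>Sym n. \<Sum>h\<in>Sym n. ?L h k)"
    by (rule sum.swap)
  also have "\<dots> = (\<Sum>k\<in>Sym n. \<Sum>h\<in>Sym n. ?R h k)"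
  proof (rule sum.cong[OF refl])
    fix k assume "k \<in> Sym n"
    then have k: "k permutes {1..n}" by simp
    have "(\<Sum>h\<in>Sym n. ?L h k) =
        (\<Sum>h\<in>Sym n. ?L (h \<circ> inv k) k)"
      by (rule sum_Sym_right[OF permutes_inv[OF k], symmetric])
    also have "\<dots> = (\<Sum>h\<in>Sym n. ?R h k)"
      by (intro sum.cong refl)
        (simp add: inv_comp_permutes[where S = "{1..n}"] permutes_group_simps[OF k] comp_assoc)
    finally show "(\<Sum>h\<in>Sym n. ?L h k) =
        (\<Sum>h\<in>Sym n. ?R h k)" .
  qed
  also have "\<dots> = (\<Sum>h\<in>Sym n. \<Sum>k\<in>Sym n. ?R h k)" by (rule sum.swap)
  also have "\<dots> = (\<Sum>h\<in>Sym n. ga_mult n y x (inv h \<circ> w \<circ> h))"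
  proof (rule sum.cong[OF refl])
    fix h assume "h \<in> Sym n"
    then have h: "h permutes {1..n}" by simp
    define v where "v = inv h \<circ> w \<circ> h"
    have v: "v permutes {1..n}" unfolding v_def by (rule conj[OF h])
    have "ga_mult n y x v = (\<Sum>j\<in>Sym n. y j * x (inv j \<circ> v))" by (rule ga_mult_apply[OF v])
    also have "\<dots> = (\<Sum>j\<in>Sym n. y (v \<circ> j) * x (inv (v \<circ> j) \<circ> v))"
      by (rule sum_Sym_left[OF v, symmetric])
    also have "\<dots> = (\<Sum>j\<in>Sym n. y (v \<circ> j) * x (inv j))"
      by (intro sum.cong refl) (simp add: inv_comp_permutes[OF v] comp_assoc permutes_group_simps[OF v])
    also have "\<dots> = (\<Sum>j\<in>Sym n. y (v \<circ> inv j) * x (inv (inv j)))"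
      by (rule sum_Sym_inv[symmetric])
    also have "\<dots> = (\<Sum>k\<in>Sym n. x k * y (v \<circ> inv k))"
      by (intro sum.cong refl) (simp add: permutes_group_simps[where S = "{1..n}"] mult.commute)
    finally show "(\<Sum>k\<in>Sym n. ?R h k) = ga_mult n y x (inv h \<circ> w \<circ> h)"
      by (simp add: v_def)
  qed
  finally show ?thesis .
qed

section \<open>Row and column groups and the Young symmetrizer\<close>

text \<open>
  Among the sets of h naturals, \<open>{..<h}\<close> has the least sum: elements outside of it are at least h and
  replace elements below h.
\<close>

lemma sum_finite_nat_set_minimal:
  fixes A :: "nat set"
  assumes A: "finite A"
  shows "(\<Sum>i<card A. i) \<le> \<Sum>A" and "\<Sum>A \<le> (\<Sum>i<card A. i) \<Longrightarrow> A = {..<card A}"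
proof -
  let ?h = "card A"
  \<comment> \<open>A and the initial segment have equal size, so they miss equally many elements of each other.\<close>
  have hA: "card ({..<?h} - A) = card (A - {..<?h})"
    using card_Diff_subset_Int[of "{..<?h}" A] card_Diff_subset_Int[of A "{..<?h}"] A
    by (simp add: Int_commute)
  have s1: "\<Sum>A = \<Sum>(A \<inter> {..<?h}) + \<Sum>(A - {..<?h})"
    using A by (metis Int_lower1 sum.Int_Diff)
  have s2: "(\<Sum>i<?h. i) = \<Sum>(A \<inter> {..<?h}) + \<Sum>({..<?h} - A)"
    using sum.Int_Diff[of "{..<?h}" "\<lambda>i. i" A] by (simp add: Int_commute)
  have le1: "card (A - {..<?h}) * ?h \<le> \<Sum>(A - {..<?h})"
    using sum_bounded_below[of "A - {..<?h}" ?h "\<lambda>i. i"] by auto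
  have le2: "\<Sum>({..<?h} - A) \<le> card (A - {..<?h}) * (?h - 1)"
  proof -
    have "\<Sum>({..<?h} - A) \<le> of_nat (card ({..<?h} - A)) * (?h - 1)"
      by (rule sum_bounded_above) auto
    then show ?thesis by (simp add: hA)
  qed
  have le3: "card (A - {..<?h}) * (?h - 1) \<le> card (A - {..<?h}) * ?h" by simp
  show "(\<Sum>i<card A. i) \<le> \<Sum>A" using s1 s2 le1 le2 le3 by linarith
  assume "\<Sum>A \<le> (\<Sum>i<card A. i)"
  then have "card (A - {..<?h}) * ?h \<le> card (A - {..<?h}) * (?h - 1)"
    using s1 s2 le1 le2 by linarith
  then have "card (A - {..<?h}) = 0 \<or> ?h = 0" by (cases ?h) auto
  then have "A - {..<?h} = {}" using A by auto
  then have "A \<subseteq> {..<?h}" by blast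
  then show "A = {..<card A}" by (rule card_subset_eq[rotated]) simp_all
qed

text \<open>
  The coordinates of the entries of a filling in which every column starts in row 0 and has no gaps.
\<close>

locale row_column =
  fixes n :: nat and row col :: "nat \<Rightarrow> nat"
  assumes row_col_inj: "\<And>x y. x \<in> {1..n} \<Longrightarrow> y \<in> {1..n} \<Longrightarrow> row x = row y \<Longrightarrow> col x = col y \<Longrightarrow> x = y"
    and column_top: "\<And>x i. x \<in> {1..n} \<Longrightarrow> i < row x \<Longrightarrow> \<exists>y\<in>{1..n}. col y = col x \<and> row y = i"
begin

definition R :: "(nat \<Rightarrow> nat) set" where
  "R = {p. p permutes {1..n} \<and> (\<forall>x\<in>{1..n}. row (p x) = row x)}"

definition C :: "(nat \<Rightarrow> nat) set" where
  "C = {q. q permutes {1..n} \<and> (\<forall>x\<in>{1..n}. col (q x) = col x)}"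

lemma R_permutes: "p \<in> R \<Longrightarrow> p permutes {1..n}" and C_permutes: "q \<in> C \<Longrightarrow> q permutes {1..n}"
  by (simp_all add: R_def C_def)

lemma R_sub: "R \<subseteq> Sym n" and C_sub: "C \<subseteq> Sym n"
  by (auto simp: R_def C_def)

lemma finite_R: "finite R" and finite_C: "finite C"
  using finite_subset[OF R_sub finite_Sym] finite_subset[OF C_sub finite_Sym] by auto

lemma stabilizer_closed:
  fixes F :: "nat \<Rightarrow> nat"
  defines "H \<equiv> {p. p permutes {1..n} \<and> (\<forall>x\<in>{1..n}. F (p x) = F x)}"
  shows "id \<in> H" "p \<in> H \<Longrightarrow> q \<in> H \<Longrightarrow> p \<circ> q \<in> H" "p \<in> H \<Longrightarrow> inv p \<in> H"
proof -
  show "id \<in> H" by (simp add: H_def permutes_id)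
  show "p \<circ> q \<in> H" if "p \<in> H" "q \<in> H"
    using that permutes_in_image[of q "{1..n}"] by (auto simp: H_def permutes_compose)
  show "inv p \<in> H" if p: "p \<in> H"
  proof -
    have pp: "p permutes {1..n}" using p by (simp add: H_def)
    have "F (inv p x) = F x" if "x \<in> {1..n}" for x
    proof -
      have "inv p x \<in> {1..n}" using that permutes_in_image[OF permutes_inv[OF pp]] by blast
      then have "F (p (inv p x)) = F (inv p x)" using p by (simp add: H_def)
      then show ?thesis by (simp add: permutes_inverses[OF pp])
    qed
    then show ?thesis by (simp add: H_def permutes_inv[OF pp])
  qed
qed

lemma R_closed: "id \<in> R" "p \<in> R \<Longrightarrow> q \<in> R \<Longrightarrow> p \<circ> q \<in> R" "p \<in> R \<Longrightarrow> inv p \<in> R"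
  unfolding R_def by (fact stabilizer_closed)+

lemma C_closed: "id \<in> C" "p \<in> C \<Longrightarrow> q \<in> C \<Longrightarrow> p \<circ> q \<in> C" "p \<in> C \<Longrightarrow> inv p \<in> C"
  unfolding C_def by (fact stabilizer_closed)+

lemma C_sign: "p \<in> C \<Longrightarrow> q \<in> C \<Longrightarrow> sign (p \<circ> q) = sign p * sign q" "p \<in> C \<Longrightarrow> sign (inv p) = sign p"
proof -
  have perm: "permutation q" if "q \<in> C" for q
    by (rule permutes_imp_permutation[OF finite_atLeastAtMost C_permutes[OF that]])
  show "p \<in> C \<Longrightarrow> q \<in> C \<Longrightarrow> sign (p \<circ> q) = sign p * sign q" by (intro sign_compose perm)
  show "p \<in> C \<Longrightarrow> sign (inv p) = sign p" by (intro sign_inverse perm)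
qed

lemma R_C_trivial:
  assumes "p \<in> R" "p \<in> C" shows "p = id"
proof
  fix x show "p x = id x"
  proof (cases "x \<in> {1..n}")
    case True
    then show ?thesis using assms row_col_inj[of "p x" x] permutes_in_image[OF R_permutes[OF assms(1)], of x]
      by (auto simp: R_def C_def)
  qed (use permutes_not_in[OF R_permutes[OF assms(1)]] in auto)
qed

text \<open>
  In each column the row indices are \<open>0, ..., h - 1\<close>, the least possible sum of h distinct values. A
  function with distinct values on each column and a total that is not larger must take just these
  values on each column, and so differs from the row index by a column permutation.
\<close>

lemma column_injective_minimal:
  assumes inj: "\<And>x y. x \<in> {1..n} \<Longrightarrow> y \<in> {1..n} \<Longrightarrow> col x = col y \<Longrightarrow> f x = f y \<Longrightarrow> x = y"
    and le: "(\<Sum>x\<in>{1..n}. f x) \<le> (\<Sum>x\<in>{1..n}. row x)"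
  obtains q where "q \<in> C" "\<And>x. x \<in> {1..n} \<Longrightarrow> f x = row (q x)"
proof -
  define X where "X c = {x \<in> {1..n}. col x = c}" for c
  have fin: "finite (X c)" for c by (simp add: X_def)
  have injf: "inj_on f (X c)" and injr: "inj_on row (X c)" for c
    using inj row_col_inj unfolding inj_on_def X_def by blast+
  have rowX: "row ` X c = {..<card (X c)}" for c
  proof -
    \<comment> \<open>The rows of column c form a down-closed set, hence an initial segment.\<close>
    have down: "i \<in> row ` X c" if ij: "j \<in> row ` X c" "i < j" for i j
    proof -
      obtain x where x: "x \<in> {1..n}" "col x = c" "j = row x" using ij(1) by (auto simp: X_def)
      then obtain y where "y \<in> {1..n}" "col y = c" "row y = i" using column_top[of x i] ij(2) by auto
      then show ?thesis by (auto simp: X_def)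
    qed
    have "row ` X c \<subseteq> {..<card (X c)}"
    proof
      fix j assume j: "j \<in> row ` X c"
      then have "{..j} \<subseteq> row ` X c" using down by (metis atMost_iff le_neq_implies_less subsetI)
      then have "card {..j} \<le> card (row ` X c)" by (intro card_mono) (auto simp: fin)
      then show "j \<in> {..<card (X c)}" by (simp add: card_image[OF injr])
    qed
    then show ?thesis by (rule card_subset_eq[rotated]) (simp_all add: card_image[OF injr])
  qed
  have sums: "(\<Sum>x\<in>{1..n}. F x) = (\<Sum>c\<in>col ` {1..n}. \<Sum>(F ` X c))"
    if "\<And>c. inj_on F (X c)" for F :: "nat \<Rightarrow> nat"
    using sum.image_gen[of "{1..n}" F col] that by (simp add: X_def sum.reindex)
  have ge: "\<Sum>(row ` X c) \<le> \<Sum>(f ` X c)" for c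
    using sum_finite_nat_set_minimal(1)[of "f ` X c"] fin by (simp add: rowX card_image[OF injf])
  have eq: "f ` X c = row ` X c" if "c \<in> col ` {1..n}" for c
  proof -
    have "\<Sum>(f ` X c) \<le> \<Sum>(row ` X c)"
    proof (rule ccontr)
      assume "\<not> \<Sum>(f ` X c) \<le> \<Sum>(row ` X c)"
      then have "(\<Sum>c\<in>col ` {1..n}. \<Sum>(row ` X c)) < (\<Sum>c\<in>col ` {1..n}. \<Sum>(f ` X c))"
        using that ge by (intro sum_strict_mono_ex1 bexI[of _ c]) (auto simp: not_le)
      with le show False by (simp only: sums[OF injf] sums[OF injr])
    qed
    then show ?thesis
      using sum_finite_nat_set_minimal(2)[of "f ` X c"] fin by (simp add: rowX card_image[OF injf])
  qed
  have ex: "\<exists>y\<in>{1..n}. col y = col x \<and> row y = f x" if "x \<in> {1..n}" for x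
  proof -
    have "f x \<in> f ` X (col x)" using that by (auto simp: X_def)
    then have "f x \<in> row ` X (col x)" using eq[of "col x"] that by blast
    then obtain y where "y \<in> X (col x)" "row y = f x" by (metis imageE)
    then show ?thesis by (auto simp: X_def)
  qed
  define q where "q x = (if x \<in> {1..n} then SOME y. y \<in> {1..n} \<and> col y = col x \<and> row y = f x else x)" for x
  have q: "q x \<in> {1..n} \<and> col (q x) = col x \<and> row (q x) = f x" if "x \<in> {1..n}" for x
    using someI_ex[OF ex[OF that, unfolded Bex_def]] that by (simp add: q_def)
  have "q permutes {1..n}"
  proof (rule inj_imp_permutes)
    show "inj_on q {1..n}"
    proof (rule inj_onI)
      fix x y assume xy: "x \<in> {1..n}" "y \<in> {1..n}" "q x = q y"
      show "x = y" by (rule inj[OF xy(1,2)]) (use q[OF xy(1)] q[OF xy(2)] xy(3) in simp_all)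
    qed
    show "\<And>x. x \<in> {1..n} \<Longrightarrow> q x \<in> {1..n}" using q by blast
    show "\<And>i. i \<notin> {1..n} \<Longrightarrow> q i = i" by (auto simp: q_def)
  qed simp
  then have "q \<in> C" using q by (simp add: C_def)
  then show ?thesis by (rule that) (simp add: q)
qed

text \<open>
  The functions on the group that transform like the Young symmetrizer: invariant under R on the left
  and alternating under C on the right.
\<close>

definition equivariant :: "((nat \<Rightarrow> nat) \<Rightarrow> complex) \<Rightarrow> bool" where
  "equivariant x \<longleftrightarrow> (\<forall>g. \<not> g permutes {1..n} \<longrightarrow> x g = 0) \<and>
     (\<forall>p\<in>R. \<forall>g\<in>Sym n. x (p \<circ> g) = x g) \<and> (\<forall>q\<in>C. \<forall>g\<in>Sym n. x (g \<circ> q) = of_int (sign q) * x g)"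

lemma equivariantD:
  assumes "equivariant x"
  shows "\<not> g permutes {1..n} \<Longrightarrow> x g = 0" "p \<in> R \<Longrightarrow> g permutes {1..n} \<Longrightarrow> x (p \<circ> g) = x g"
    "q \<in> C \<Longrightarrow> g permutes {1..n} \<Longrightarrow> x (g \<circ> q) = of_int (sign q) * x g"
  using assms by (auto simp: equivariant_def)

text \<open>
  Von Neumann's lemma. If two points of one column were mapped by g into one row, a transposition in C
  would equal, up to conjugation by g, a transposition in R, and x g would be its own negative.
  Otherwise \<open>row \<circ> g\<close> is injective on columns, hence \<open>row \<circ> g = row \<circ> q\<close> with q in C.
\<close>

lemma equivariant_support:
  assumes x: "equivariant x" and g: "g permutes {1..n}" and nz: "x g \<noteq> 0"
  obtains p q where "p \<in> R" "q \<in> C" "g = p \<circ> q"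
proof -
  have gi: "g y \<in> {1..n} \<longleftrightarrow> y \<in> {1..n}" for y by (rule permutes_in_image[OF g])
  have "y = z" if yz: "y \<in> {1..n}" "z \<in> {1..n}" "col y = col z" "row (g y) = row (g z)" for y z
  proof (rule ccontr)
    assume "y \<noteq> z"
    have 1: "transpose y z \<in> C"
      using yz by (auto simp: C_def permutes_swap_id transpose_def)
    have 2: "transpose (g y) (g z) \<in> R"
      using yz gi by (auto simp: R_def permutes_swap_id transpose_def)
    have 3: "transpose (g y) (g z) \<circ> g = g \<circ> transpose y z"
      using permutes_inj[OF g] by (auto simp: fun_eq_iff transpose_def dest: injD)
    have "x g = x (transpose (g y) (g z) \<circ> g)" using equivariantD(2)[OF x 2 g] by simp
    also have "\<dots> = - x g" using equivariantD(3)[OF x 1 g] \<open>y \<noteq> z\<close> by (simp add: 3 sign_swap_id)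
    finally show False using nz by simp
  qed
  moreover have "(\<Sum>y\<in>{1..n}. row (g y)) \<le> (\<Sum>y\<in>{1..n}. row y)"
    using sum.permute[OF g, of row] by (simp add: o_def)
  ultimately obtain q where q: "q \<in> C" "\<And>y. y \<in> {1..n} \<Longrightarrow> row (g y) = row (q y)"
    using column_injective_minimal[of "\<lambda>y. row (g y)"] by blast
  have qp: "q permutes {1..n}" by (rule C_permutes[OF q(1)])
  have "g \<circ> inv q \<in> R"
  proof -
    have "row (g (inv q y)) = row y" if "y \<in> {1..n}" for y
      using q(2)[of "inv q y"] that permutes_in_image[OF permutes_inv[OF qp]] permutes_inverses[OF qp] by simp
    then show ?thesis by (simp add: R_def permutes_compose permutes_inv g qp)
  qed
  moreover have "g = g \<circ> inv q \<circ> q" by (simp add: comp_assoc permutes_group_simps[OF qp])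
  ultimately show ?thesis using that q(1) by blast
qed

lemma equivariant_proportional:
  assumes x: "equivariant x" and y: "equivariant y" and y1: "y id = 1"
  shows "x = (\<lambda>g. x id * y g)"
proof
  fix g show "x g = x id * y g"
  proof (cases "\<exists>p\<in>R. \<exists>q\<in>C. g = p \<circ> q")
    case True
    then obtain p q where pq: "p \<in> R" "q \<in> C" "g = p \<circ> q" by blast
    have "z g = of_int (sign q) * z id" if "equivariant z" for z
      using equivariantD(2)[OF that pq(1) C_permutes[OF pq(2)]] equivariantD(3)[OF that pq(2) permutes_id]
      by (simp add: pq(3))
    from this[OF x] this[OF y] show ?thesis using y1 by simp
  next
    case False
    have "z g = 0" if "equivariant z" for z
      using equivariant_support[OF that, of g] equivariantD(1)[OF that, of g] False by metis
    from this[OF x] this[OF y] show ?thesis by simp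
  qed
qed

definition row_sum :: "(nat \<Rightarrow> nat) \<Rightarrow> complex" where
  "row_sum g = (if g \<in> R then 1 else 0)"

definition column_sum :: "(nat \<Rightarrow> nat) \<Rightarrow> complex" where
  "column_sum g = (if g \<in> C then of_int (sign g) else 0)"

definition young :: "(nat \<Rightarrow> nat) \<Rightarrow> complex" where
  "young = ga_mult n row_sum column_sum"

lemma sum_row_sum: "(\<Sum>h\<in>Sym n. row_sum h * f h) = (\<Sum>p\<in>R. f p)"
proof -
  have "(\<Sum>h\<in>Sym n. row_sum h * f h) = (\<Sum>h\<in>Sym n. if h \<in> R then f h else 0)"
    by (intro sum.cong) (auto simp: row_sum_def)
  also have "\<dots> = (\<Sum>p\<in>R. f p)"
    using R_sub by (simp add: sum.If_cases finite_Sym Int_absorb1)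
  finally show ?thesis .
qed

lemma sum_column_sum: "(\<Sum>h\<in>Sym n. column_sum h * f h) = (\<Sum>q\<in>C. of_int (sign q) * f q)"
proof -
  have "(\<Sum>h\<in>Sym n. column_sum h * f h) = (\<Sum>h\<in>Sym n. if h \<in> C then of_int (sign h) * f h else 0)"
    by (intro sum.cong) (auto simp: column_sum_def)
  also have "\<dots> = (\<Sum>q\<in>C. of_int (sign q) * f q)"
    using C_sub by (simp add: sum.If_cases finite_Sym Int_absorb1)
  finally show ?thesis .
qed

lemma sum_R_left: "p \<in> R \<Longrightarrow> (\<Sum>h\<in>R. f (p \<circ> h)) = (\<Sum>h\<in>R. f h)"
  by (rule sum.reindex_bij_witness[of _ "\<lambda>h. inv p \<circ> h" "\<lambda>h. p \<circ> h"])
    (auto simp: R_closed permutes_group_simps[OF R_permutes])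

lemma sum_C_left: "p \<in> C \<Longrightarrow> (\<Sum>h\<in>C. f (p \<circ> h)) = (\<Sum>h\<in>C. f h)"
  by (rule sum.reindex_bij_witness[of _ "\<lambda>h. inv p \<circ> h" "\<lambda>h. p \<circ> h"])
    (auto simp: C_closed permutes_group_simps[OF C_permutes])

lemma sum_C_inv: "(\<Sum>h\<in>C. f (inv h)) = (\<Sum>h\<in>C. f h)"
  by (rule sum.reindex_bij_witness[of _ inv inv])
    (auto simp: C_closed permutes_group_simps[OF C_permutes])

lemma young_apply: "g permutes {1..n} \<Longrightarrow> young g = (\<Sum>p\<in>R. column_sum (inv p \<circ> g))"
  by (simp add: young_def ga_mult_apply sum_row_sum)

lemma column_sum_right: "q \<in> C \<Longrightarrow> column_sum (g \<circ> q) = of_int (sign q) * column_sum g"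
proof -
  assume q: "q \<in> C"
  have "g \<circ> q \<in> C \<longleftrightarrow> g \<in> C"
  proof
    assume "g \<circ> q \<in> C"
    then have "g \<circ> q \<circ> inv q \<in> C" using C_closed q by blast
    then show "g \<in> C" by (simp add: comp_assoc permutes_group_simps[OF C_permutes[OF q]])
  qed (use q C_closed in blast)
  then show ?thesis using C_sign(1)[OF _ q] by (simp add: column_sum_def mult.commute)
qed

lemma young_equivariant: "equivariant young"
proof -
  have "young (p \<circ> g) = young g" if p: "p \<in> R" and g: "g permutes {1..n}" for p g
  proof -
    have pp: "p permutes {1..n}" by (rule R_permutes[OF p])
    have "young (p \<circ> g) = (\<Sum>h\<in>R. column_sum (inv (p \<circ> h) \<circ> (p \<circ> g)))"
      unfolding young_apply[OF permutes_compose[OF g pp]]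
      by (rule sum_R_left[OF p, symmetric, of "\<lambda>h. column_sum (inv h \<circ> (p \<circ> g))"])
    also have "\<dots> = young g"
      unfolding young_apply[OF g]
      by (intro sum.cong refl)
        (simp add: inv_comp_permutes[OF pp R_permutes] comp_assoc permutes_group_simps[OF pp])
    finally show ?thesis .
  qed
  moreover have "young (g \<circ> q) = of_int (sign q) * young g" if q: "q \<in> C" and g: "g permutes {1..n}" for q g
    unfolding young_apply[OF permutes_compose[OF C_permutes[OF q] g]] young_apply[OF g]
    by (simp add: sum_distrib_left column_sum_right[OF q, symmetric] comp_assoc)
  ultimately show ?thesis by (simp add: equivariant_def young_def ga_mult_outside)
qed

lemma young_id: "young id = 1"
proof -
  have "young id = (\<Sum>p\<in>R. column_sum (inv p))" by (simp add: young_apply permutes_id)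
  also have "\<dots> = (\<Sum>p\<in>R. if p = id then 1 else 0)"
  proof (rule sum.cong[OF refl])
    fix p assume p: "p \<in> R"
    then have "inv p \<in> R" by (rule R_closed)
    then have "inv p \<in> C \<longleftrightarrow> p = id"
      using R_C_trivial[of "inv p"] permutes_group_simps(5)[OF R_permutes[OF p]] C_closed(1) by (metis inv_id)
    then show "column_sum (inv p) = (if p = id then 1 else 0)" by (simp add: column_sum_def inv_id)
  qed
  also have "\<dots> = 1" using finite_R R_closed(1) by simp
  finally show ?thesis .
qed

lemma ga_mult_young_equivariant: "equivariant (ga_mult n young (ga_mult n z young))"
proof -
  have 1: "ga_mult n young w (p \<circ> g) = ga_mult n young w g"
    if p: "p \<in> R" and g: "g permutes {1..n}" for p g w
  proof -
    have pp: "p permutes {1..n}" by (rule R_permutes[OF p])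
    have "ga_mult n young w (p \<circ> g) = (\<Sum>h\<in>Sym n. young (p \<circ> h) * w (inv (p \<circ> h) \<circ> (p \<circ> g)))"
      unfolding ga_mult_apply[OF permutes_compose[OF g pp]]
      by (rule sum_Sym_left[OF pp, symmetric, of "\<lambda>h. young h * w (inv h \<circ> (p \<circ> g))"])
    also have "\<dots> = ga_mult n young w g"
      unfolding ga_mult_apply[OF g]
      by (intro sum.cong refl)
        (simp add: inv_comp_permutes[OF pp] comp_assoc permutes_group_simps[OF pp] equivariantD(2)[OF young_equivariant p])
    finally show ?thesis .
  qed
  have 2: "ga_mult n w young (g \<circ> q) = of_int (sign q) * ga_mult n w young g"
    if q: "q \<in> C" and g: "g permutes {1..n}" for q g w
    unfolding ga_mult_apply[OF permutes_compose[OF C_permutes[OF q] g]] ga_mult_apply[OF g]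
    using equivariantD(3)[OF young_equivariant q, of "inv _ \<circ> g"] g
    by (simp add: sum_distrib_left comp_assoc[symmetric] permutes_compose permutes_inv mult.left_commute)
  show ?thesis
    using 1 2[of _ _ "ga_mult n young z"]
    by (simp add: equivariant_def ga_mult_outside ga_mult_assoc)
qed

text \<open>
  Both sides are equivariant. In particular the square of the Young symmetrizer is a multiple of it.
\<close>

lemma young_sandwich:
  "ga_mult n young (ga_mult n z young) = (\<lambda>g. ga_mult n young (ga_mult n z young) id * young g)"
  by (rule equivariant_proportional[OF ga_mult_young_equivariant young_equivariant young_id])

text \<open>
  The factor between the Young symmetrizer and its square.
\<close>

definition kappa :: complex where "kappa = ga_mult n young young id"

lemma ga_mult_id_left:
  assumes "\<And>g. \<not> g permutes {1..n} \<Longrightarrow> x g = 0"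
  shows "ga_mult n (ga_single id) x = x"
proof
  fix g show "ga_mult n (ga_single id) x g = x g"
  proof (cases "g permutes {1..n}")
    case True
    then show ?thesis using ga_mult_single_left[OF permutes_id True] by (simp add: inv_id)
  qed (simp add: ga_mult_outside assms)
qed

lemma young_square: "ga_mult n young young = (\<lambda>g. kappa * young g)"
  using young_sandwich[of "ga_single id"] ga_mult_id_left[of young] equivariantD(1)[OF young_equivariant]
  by (simp add: kappa_def)

lemma young_real: "young g \<in> \<real>"
  by (cases "g permutes {1..n}")
    (auto simp: young_apply column_sum_def equivariantD(1)[OF young_equivariant] intro!: sum_in_Reals)

lemma kappa_real: "kappa \<in> \<real>"
  by (auto simp: kappa_def ga_mult_apply permutes_id intro!: sum_in_Reals Reals_mult young_real)

lemma row_sum_inv: "g permutes {1..n} \<Longrightarrow> row_sum (inv g) = row_sum g"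
  using R_closed(3)[of g] R_closed(3)[of "inv g"] permutes_group_simps(5)[of g] by (auto simp: row_sum_def)

lemma column_sum_inv: "g permutes {1..n} \<Longrightarrow> column_sum (inv g) = column_sum g"
  using C_closed(3)[of g] C_closed(3)[of "inv g"] permutes_group_simps(5)[of g] C_sign(2)[of g]
  by (auto simp: column_sum_def)

lemma ga_mult_cong:
  assumes "\<And>h. h permutes {1..n} \<Longrightarrow> x h = x' h" "\<And>h. h permutes {1..n} \<Longrightarrow> y h = y' h"
  shows "ga_mult n x y = ga_mult n x' y'"
  using assms by (auto simp: fun_eq_iff ga_mult_def permutes_compose permutes_inv intro!: sum.cong)

text \<open>
  Write a and b for the row and column sums. If kappa were 0, the element \<open>w = a b a\<close> would have
  square 0. But w is real and invariant under inversion, so the coefficient of its square at id is the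
  sum of the squares of its coefficients, and \<open>w id\<close> is the order of R.
\<close>

lemma kappa_nonzero: "kappa \<noteq> 0"
proof
  assume k0: "kappa = 0"
  let ?w = "ga_mult n young row_sum"
  have sym: "?w (inv g) = ?w g" if g: "g permutes {1..n}" for g
  proof -
    have "?w (inv g) = ga_mult n (\<lambda>h. row_sum (inv h)) (\<lambda>h. young (inv h)) g"
      by (rule ga_mult_inv[OF g])
    also have "ga_mult n (\<lambda>h. row_sum (inv h)) (\<lambda>h. young (inv h)) = ga_mult n row_sum (ga_mult n column_sum row_sum)"
    proof (rule ga_mult_cong)
      fix h assume h: "h permutes {1..n}"
      have "young (inv h) = ga_mult n (\<lambda>h. column_sum (inv h)) (\<lambda>h. row_sum (inv h)) h"
        unfolding young_def by (rule ga_mult_inv[OF h])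
      also have "ga_mult n (\<lambda>h. column_sum (inv h)) (\<lambda>h. row_sum (inv h)) = ga_mult n column_sum row_sum"
        by (rule ga_mult_cong) (simp_all add: row_sum_inv column_sum_inv)
      finally show "young (inv h) = ga_mult n column_sum row_sum h" .
    qed (rule row_sum_inv)
    also have "\<dots> = ?w" by (simp add: young_def ga_mult_assoc)
    finally show ?thesis .
  qed
  have real: "?w g \<in> \<real>" for g
    by (auto simp: ga_mult_def row_sum_def intro!: sum_in_Reals Reals_mult young_real)
  have "ga_mult n row_sum young = (\<lambda>g. of_nat (card R) * young g)"
  proof
    fix g show "ga_mult n row_sum young g = of_nat (card R) * young g"
    proof (cases "g permutes {1..n}")
      case True
      have "ga_mult n row_sum young g = (\<Sum>p\<in>R. young (inv p \<circ> g))"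
        by (simp add: ga_mult_apply True sum_row_sum)
      also have "\<dots> = (\<Sum>p\<in>R. young g)"
        by (intro sum.cong refl equivariantD(2)[OF young_equivariant] R_closed True)
      finally show ?thesis by simp
    qed (simp add: ga_mult_outside equivariantD(1)[OF young_equivariant])
  qed
  then have "ga_mult n ?w ?w = ga_mult n young (ga_mult n (\<lambda>g. of_nat (card R) * young g) row_sum)"
    by (metis ga_mult_assoc)
  also have "\<dots> = (\<lambda>g. of_nat (card R) * ga_mult n (ga_mult n young young) row_sum g)"
    by (simp add: ga_mult_scale_left ga_mult_scale_right ga_mult_assoc)
  also have "\<dots> = (\<lambda>g. 0)" unfolding young_square k0 by (simp add: ga_mult_def fun_eq_iff)
  finally have "0 = ga_mult n ?w ?w id" by simp
  also have "\<dots> = (\<Sum>h\<in>Sym n. ?w h * ?w h)"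
    unfolding ga_mult_apply[OF permutes_id]
  proof (rule sum.cong[OF refl])
    fix h assume "h \<in> Sym n"
    then have "?w (inv h) = ?w h" by (intro sym) simp
    then show "?w h * ?w (inv h \<circ> id) = ?w h * ?w h" by simp
  qed
  finally have "(\<Sum>h\<in>Sym n. (Re (?w h))\<^sup>2) = 0"
  proof -
    assume z: "0 = (\<Sum>h\<in>Sym n. ?w h * ?w h)"
    have "(\<Sum>h\<in>Sym n. ?w h * ?w h) = complex_of_real (\<Sum>h\<in>Sym n. (Re (?w h))\<^sup>2)"
      unfolding of_real_sum
    proof (rule sum.cong[OF refl])
      fix h have "?w h = complex_of_real (Re (?w h))" using real[of h] by (simp add: of_real_Re)
      then show "?w h * ?w h = complex_of_real ((Re (?w h))\<^sup>2)" by (metis of_real_mult power2_eq_square)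
    qed
    with z have "complex_of_real (\<Sum>h\<in>Sym n. (Re (?w h))\<^sup>2) = 0" by (simp only:)
    then show ?thesis by (simp only: of_real_eq_0_iff)
  qed
  then have "Re (?w id) = 0"
    using finite_Sym[of n] permutes_id[of "{1..n}"] by (simp add: sum_nonneg_eq_0_iff)
  moreover have "?w id = of_nat (card R)"
  proof -
    have "?w id = (\<Sum>h\<in>Sym n. young h * row_sum (inv h))"
      by (simp add: ga_mult_apply permutes_id)
    also have "\<dots> = (\<Sum>h\<in>Sym n. row_sum h * young h)"
      by (intro sum.cong refl) (simp add: row_sum_inv mult.commute)
    also have "\<dots> = (\<Sum>p\<in>R. young p)" by (rule sum_row_sum)
    also have "\<dots> = (\<Sum>p\<in>R. 1)"
      using equivariantD(2)[OF young_equivariant _ permutes_id] young_id by (intro sum.cong refl) simp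
    finally show ?thesis by simp
  qed
  moreover have "card R \<noteq> 0" using finite_R R_closed(1) by (auto simp: card_eq_0_iff)
  ultimately show False by simp
qed

section \<open>The character afforded by the Young symmetrizer\<close>

text \<open>
  The trace of w on the left ideal of \<open>young\<close>, since right multiplication by \<open>young / kappa\<close> is a
  projection onto this ideal.
\<close>

definition chi :: "(nat \<Rightarrow> nat) \<Rightarrow> complex" where
  "chi w = (\<Sum>h\<in>Sym n. young (inv h \<circ> inv w \<circ> h)) / kappa"

lemma conj_permutes: "h permutes {1..n} \<Longrightarrow> w permutes {1..n} \<Longrightarrow> inv h \<circ> w \<circ> h permutes {1..n}"
  by (simp add: permutes_compose permutes_inv)

lemma young_inv:
  assumes "g permutes {1..n}"
  shows "young (inv g) = ga_mult n column_sum row_sum g"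
proof -
  have "young (inv g) = ga_mult n (\<lambda>h. column_sum (inv h)) (\<lambda>h. row_sum (inv h)) g"
    unfolding young_def by (rule ga_mult_inv[OF assms])
  also have "ga_mult n (\<lambda>h. column_sum (inv h)) (\<lambda>h. row_sum (inv h)) = ga_mult n column_sum row_sum"
    by (rule ga_mult_cong) (simp_all add: row_sum_inv column_sum_inv)
  finally show ?thesis .
qed

text \<open>
  The value does not change if w is replaced by its inverse: inversion exchanges the two
  factors of \<open>young\<close>, and their order does not matter for sums over conjugacy classes.
\<close>

lemma chi_eq:
  assumes w: "w permutes {1..n}"
  shows "chi w = (\<Sum>h\<in>Sym n. young (inv h \<circ> w \<circ> h)) / kappa"
proof -
  have "(\<Sum>h\<in>Sym n. young (inv h \<circ> inv w \<circ> h)) = (\<Sum>h\<in>Sym n. ga_mult n column_sum row_sum (inv h \<circ> w \<circ> h))"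
  proof (rule sum.cong[OF refl])
    fix h assume "h \<in> Sym n"
    then have h: "h permutes {1..n}" by simp
    have "inv h \<circ> inv w \<circ> h = inv (inv h \<circ> w \<circ> h)"
      by (simp add: inv_comp_permutes[where S = "{1..n}"] permutes_compose permutes_inv w h
          permutes_inv_inv[OF h] comp_assoc)
    then show "young (inv h \<circ> inv w \<circ> h) = ga_mult n column_sum row_sum (inv h \<circ> w \<circ> h)"
      by (simp only: young_inv[OF conj_permutes[OF h w]])
  qed
  also have "\<dots> = (\<Sum>h\<in>Sym n. ga_mult n row_sum column_sum (inv h \<circ> w \<circ> h))"
    by (rule class_sum_ga_mult_commute[OF w])
  finally show ?thesis by (simp add: chi_def young_def)
qed

lemma chi_real: "chi w \<in> \<real>"
  unfolding chi_def by (intro Reals_divide sum_in_Reals young_real kappa_real)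

text \<open>
  After conjugation the sum runs over the coefficients of \<open>young \<cdot> k \<cdot> young\<close> at k. By the sandwich
  property these are \<open>(young \<cdot> k \<cdot> young) id \<cdot> young k\<close>, and they add up to the coefficient of
  \<open>young \<cdot> young \<cdot> young\<close> at id, which is \<open>kappa\<^sup>2\<close>.
\<close>

lemma sum_chi_square: "(\<Sum>w\<in>Sym n. chi w * chi w) = fact n"
proof -
  let ?Y = "\<lambda>w g h. young (inv g \<circ> inv w \<circ> g) * young (inv h \<circ> w \<circ> h)"
  define A where "A k v = young (inv v) * young (inv k \<circ> v \<circ> k)" for k v
  have "(\<Sum>w\<in>Sym n. chi w * chi w) =
      (\<Sum>w\<in>Sym n. \<Sum>g\<in>Sym n. \<Sum>h\<in>Sym n. ?Y w g h) / (kappa * kappa)"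
    unfolding sum_divide_distrib
  proof (rule sum.cong[OF refl])
    fix w assume "w \<in> Sym n"
    then have w: "w permutes {1..n}" by simp
    show "chi w * chi w = (\<Sum>g\<in>Sym n. \<Sum>h\<in>Sym n. ?Y w g h / (kappa * kappa))"
      by (subst (2) chi_eq[OF w]) (simp add: chi_def sum_product sum_divide_distrib)
  qed
  also have "(\<Sum>w\<in>Sym n. \<Sum>g\<in>Sym n. \<Sum>h\<in>Sym n. ?Y w g h) =
      (\<Sum>g\<in>Sym n. \<Sum>w\<in>Sym n. \<Sum>h\<in>Sym n. ?Y w g h)"
    by (rule sum.swap)
  also have "\<dots> = (\<Sum>g\<in>Sym n. \<Sum>v\<in>Sym n. \<Sum>k\<in>Sym n. A k v)"
  proof (rule sum.cong[OF refl])
    fix g assume "g \<in> Sym n"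
    then have g: "g permutes {1..n}" by simp
    have "(\<Sum>w\<in>Sym n. \<Sum>h\<in>Sym n. ?Y w g h) =
        (\<Sum>v\<in>Sym n. \<Sum>h\<in>Sym n. ?Y (g \<circ> v \<circ> inv g) g h)"
      by (rule sum_Sym_conj[OF g, symmetric])
    also have "\<dots> = (\<Sum>v\<in>Sym n. \<Sum>k\<in>Sym n. A k v)"
    proof (rule sum.cong[OF refl])
      fix v assume "v \<in> Sym n"
      then have v: "v permutes {1..n}" by simp
      have "inv g \<circ> inv (g \<circ> v \<circ> inv g) \<circ> g = inv v"
        by (simp add: inv_comp_permutes[where S = "{1..n}"] permutes_compose permutes_inv v g
            permutes_group_simps[OF g] comp_assoc)
      then have "(\<Sum>h\<in>Sym n. ?Y (g \<circ> v \<circ> inv g) g h) =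
        (\<Sum>h\<in>Sym n. young (inv v) * young (inv h \<circ> (g \<circ> v \<circ> inv g) \<circ> h))" by simp
      also have "\<dots> = (\<Sum>k\<in>Sym n. young (inv v) * young (inv (g \<circ> k) \<circ> (g \<circ> v \<circ> inv g) \<circ> (g \<circ> k)))"
        by (rule sum_Sym_left[OF g, symmetric])
      also have "\<dots> = (\<Sum>k\<in>Sym n. A k v)"
        by (intro sum.cong refl)
          (simp add: A_def inv_comp_permutes[OF g] permutes_group_simps[OF g] comp_assoc)
      finally show "(\<Sum>h\<in>Sym n. ?Y (g \<circ> v \<circ> inv g) g h) =
          (\<Sum>k\<in>Sym n. A k v)" .
    qed
    finally show "(\<Sum>w\<in>Sym n. \<Sum>h\<in>Sym n. ?Y w g h) =
        (\<Sum>v\<in>Sym n. \<Sum>k\<in>Sym n. A k v)" .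
  qed
  also have "\<dots> = fact n * (\<Sum>v\<in>Sym n. \<Sum>k\<in>Sym n. A k v)" by (simp add: card_Sym)
  also have "(\<Sum>v\<in>Sym n. \<Sum>k\<in>Sym n. A k v) = (\<Sum>k\<in>Sym n. \<Sum>v\<in>Sym n. A k v)" by (rule sum.swap)
  also have "\<dots> = kappa * kappa"
  proof -
    have "(\<Sum>v\<in>Sym n. A k v) = ga_mult n young (ga_mult n (ga_single k) young) id * young k"
      if k: "k permutes {1..n}" for k
    proof -
      have "(\<Sum>v\<in>Sym n. A k v) = (\<Sum>u\<in>Sym n. A k (inv u))" by (rule sum_Sym_inv[symmetric])
      also have "\<dots> = (\<Sum>u\<in>Sym n. young u * ga_mult n (ga_single k) young (inv u \<circ> k))"
        by (intro sum.cong refl)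
          (simp add: A_def permutes_group_simps[where S = "{1..n}"] ga_mult_single_left k permutes_compose comp_assoc)
      also have "\<dots> = ga_mult n young (ga_mult n (ga_single k) young) k" by (simp add: ga_mult_apply k)
      also have "\<dots> = ga_mult n young (ga_mult n (ga_single k) young) id * young k"
        by (subst young_sandwich) simp
      finally show ?thesis .
    qed
    moreover have "ga_mult n young (ga_mult n (ga_single k) young) id = (\<Sum>u\<in>Sym n. young u * young (inv k \<circ> inv u))"
      if k: "k permutes {1..n}" for k
      unfolding ga_mult_apply[OF permutes_id]
      by (intro sum.cong refl) (simp add: ga_mult_single_left k permutes_inv)
    ultimately have "(\<Sum>k\<in>Sym n. \<Sum>v\<in>Sym n. A k v) =
        (\<Sum>k\<in>Sym n. \<Sum>u\<in>Sym n. young u * (young k * young (inv k \<circ> inv u)))"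
      by - (rule sum.cong[OF refl], simp add: sum_distrib_left mult_ac)
    also have "\<dots> = (\<Sum>u\<in>Sym n. \<Sum>k\<in>Sym n. young u * (young k * young (inv k \<circ> inv u)))" by (rule sum.swap)
    also have "\<dots> = (\<Sum>u\<in>Sym n. young u * ga_mult n young young (inv u))"
      by (intro sum.cong refl) (simp add: ga_mult_apply permutes_inv sum_distrib_left)
    also have "\<dots> = (\<Sum>u\<in>Sym n. young u * young (inv u)) * kappa"
      by (simp add: young_square sum_distrib_left mult_ac)
    also have "(\<Sum>u\<in>Sym n. young u * young (inv u)) = kappa"
      by (simp add: kappa_def ga_mult_apply permutes_id)
    finally show ?thesis .
  qed
  finally show ?thesis using kappa_nonzero by simp
qed

lemma trace_on_left_ideal:
  assumes w: "w permutes {1..n}"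
  shows "trace_on ((\<lambda>x. ga_mult n x young) ` group_algebra n) (ga_mult n (ga_single w)) = chi w"
proof -
  let ?V = "(\<lambda>x. ga_mult n x young) ` group_algebra n"
  define F where "F g t = (if t permutes {1..n} then young (inv g \<circ> (inv w \<circ> t)) / kappa else 0)" for g t
  have "trace_on ?V (ga_mult n (ga_single w)) = (\<Sum>g\<in>Sym n. F g g)"
  proof (rule trace_on_eq_sum[where F = F])
    show "finite (Sym n)" by (rule finite_Sym)
    show "cfun.subspace ?V"
    proof (rule cfun.subspaceI)
      have "ga_mult n (\<lambda>_. 0) young = 0" by (simp add: ga_mult_def fun_eq_iff)
      then show "0 \<in> ?V" by (intro image_eqI[of _ _ "\<lambda>_. 0"]) (auto simp: group_algebra_def)
      show "x + y \<in> ?V" if "x \<in> ?V" "y \<in> ?V" for x y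
      proof -
        from that obtain a b where ab: "a \<in> group_algebra n" "b \<in> group_algebra n"
          "x = ga_mult n a young" "y = ga_mult n b young" by auto
        then have "x + y = ga_mult n (a + b) young" by (simp add: ga_mult_add_left)
        moreover have "a + b \<in> group_algebra n" using ab by (simp add: group_algebra_def)
        ultimately show ?thesis by blast
      qed
      show "(\<lambda>t. c * x t) \<in> ?V" if "x \<in> ?V" for c x
      proof -
        from that obtain a where a: "a \<in> group_algebra n" "x = ga_mult n a young" by auto
        then have "(\<lambda>t. c * x t) = ga_mult n (\<lambda>t. c * a t) young" by (simp add: ga_mult_scale_left)
        moreover have "(\<lambda>t. c * a t) \<in> group_algebra n" using a by (simp add: group_algebra_def)
        ultimately show ?thesis by blast
      qed
    qed
    show "v g = 0" if "v \<in> ?V" "g \<notin> Sym n" for v g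
      using that by (auto simp: ga_mult_outside)
    show "F g \<in> ?V" if "g \<in> Sym n" for g
    proof (rule image_eqI[of _ _ "\<lambda>t. inverse kappa * ga_single (w \<circ> g) t"])
      have wg: "w \<circ> g permutes {1..n}" using that w by (simp add: permutes_compose)
      show "(\<lambda>t. inverse kappa * ga_single (w \<circ> g) t) \<in> group_algebra n"
        using wg by (auto simp: group_algebra_def ga_single_def)
      show "F g = ga_mult n (\<lambda>t. inverse kappa * ga_single (w \<circ> g) t) young"
        unfolding ga_mult_scale_left
      proof
        fix t show "F g t = inverse kappa * ga_mult n (ga_single (w \<circ> g)) young t"
          using that w wg
          by (cases "t permutes {1..n}")
            (simp_all add: F_def ga_mult_single_left inv_comp_permutes[OF w] comp_assoc ga_mult_outside field_simps)
      qed
    qed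
    show "ga_mult n (ga_single w) v = (\<lambda>t. \<Sum>g\<in>Sym n. v g * F g t)" if "v \<in> ?V" for v
    proof
      fix t
      from that obtain a where a: "v = ga_mult n a young" by auto
      \<comment> \<open>v lies in the left ideal, on which right multiplication by the Young symmetrizer is scaling.\<close>
      have vk: "ga_mult n v young = (\<lambda>g. kappa * v g)"
        by (simp add: a ga_mult_assoc young_square ga_mult_scale_right)
      show "ga_mult n (ga_single w) v t = (\<Sum>g\<in>Sym n. v g * F g t)"
      proof (cases "t permutes {1..n}")
        case t: True
        have wt: "inv w \<circ> t permutes {1..n}" using t w by (simp add: permutes_compose permutes_inv)
        have "ga_mult n (ga_single w) v t = v (inv w \<circ> t)" by (rule ga_mult_single_left[OF w t])
        also have "\<dots> = ga_mult n v young (inv w \<circ> t) / kappa" using kappa_nonzero by (simp add: vk)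
        also have "\<dots> = (\<Sum>g\<in>Sym n. v g * F g t)"
          by (simp add: ga_mult_apply[OF wt] F_def t sum_divide_distrib)
        finally show ?thesis .
      qed (simp add: ga_mult_outside F_def)
    qed
  qed
  also have "\<dots> = chi w" by (simp add: chi_def F_def sum_divide_distrib comp_assoc)
  finally show ?thesis .
qed

lemma fixed_colorings_conj:
  assumes v: "v permutes {1..n}" and h: "h permutes {1..n}"
  shows "fixed_colorings n b (h \<circ> v \<circ> inv h) = fixed_colorings n b v"
  unfolding fixed_colorings_def
proof (rule bij_betw_same_card[of "\<lambda>f. f \<circ> h"], rule bij_betw_byWitness[where f' = "\<lambda>f. f \<circ> inv h"])
  have c: "f \<circ> h \<circ> inv h = f" "f \<circ> inv h \<circ> h = f" for f :: "nat \<Rightarrow> nat"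
    by (simp_all add: comp_assoc permutes_inv_o[OF h])
  show "\<forall>f\<in>{f \<in> colorings n b. f \<circ> (h \<circ> v \<circ> inv h) = f}. f \<circ> h \<circ> inv h = f"
    "\<forall>f\<in>{f \<in> colorings n b. f \<circ> v = f}. f \<circ> inv h \<circ> h = f" by (simp_all add: c)
  show "(\<lambda>f. f \<circ> h) ` {f \<in> colorings n b. f \<circ> (h \<circ> v \<circ> inv h) = f} \<subseteq> {f \<in> colorings n b. f \<circ> v = f}"
    using colorings_comp_iff[OF h] c(2) by auto (metis c(2) comp_assoc)
  show "(\<lambda>f. f \<circ> inv h) ` {f \<in> colorings n b. f \<circ> v = f} \<subseteq> {f \<in> colorings n b. f \<circ> (h \<circ> v \<circ> inv h) = f}"
    using colorings_comp_iff[OF permutes_inv[OF h]] c(2) by (auto simp flip: comp_assoc)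
qed

text \<open>
  The count of fixed colorings is constant on conjugacy classes, so chi may be replaced by \<open>n! / kappa\<close>
  times the Young symmetrizer.
\<close>

lemma sum_chi_fixed_colorings:
  "(\<Sum>w\<in>Sym n. chi w * of_nat (fixed_colorings n b w)) =
    fact n / kappa * (\<Sum>p\<in>R. \<Sum>q\<in>C. of_int (sign q) * of_nat (fixed_colorings n b (p \<circ> q)))"
proof -
  let ?x = "\<lambda>w. complex_of_nat (fixed_colorings n b w)"
  have "(\<Sum>w\<in>Sym n. chi w * ?x w) = (\<Sum>w\<in>Sym n. \<Sum>h\<in>Sym n. young (inv h \<circ> w \<circ> h) * ?x w) / kappa"
    unfolding sum_divide_distrib
    by (intro sum.cong refl) (simp add: chi_eq sum_divide_distrib sum_distrib_right)
  also have "(\<Sum>w\<in>Sym n. \<Sum>h\<in>Sym n. young (inv h \<circ> w \<circ> h) * ?x w) =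
      (\<Sum>h\<in>Sym n. \<Sum>w\<in>Sym n. young (inv h \<circ> w \<circ> h) * ?x w)" by (rule sum.swap)
  also have "\<dots> = (\<Sum>h\<in>Sym n. \<Sum>v\<in>Sym n. young v * ?x v)"
  proof (rule sum.cong[OF refl])
    fix h assume "h \<in> Sym n"
    then have h: "h permutes {1..n}" by simp
    have "(\<Sum>w\<in>Sym n. young (inv h \<circ> w \<circ> h) * ?x w) =
        (\<Sum>v\<in>Sym n. young (inv h \<circ> (h \<circ> v \<circ> inv h) \<circ> h) * ?x (h \<circ> v \<circ> inv h))"
      by (rule sum_Sym_conj[OF h, symmetric])
    also have "\<dots> = (\<Sum>v\<in>Sym n. young v * ?x v)"
      by (intro sum.cong refl)
        (simp add: fixed_colorings_conj[OF _ h, unfolded comp_assoc] comp_assoc permutes_group_simps[OF h])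
    finally show "(\<Sum>w\<in>Sym n. young (inv h \<circ> w \<circ> h) * ?x w) = (\<Sum>v\<in>Sym n. young v * ?x v)" .
  qed
  also have "\<dots> = fact n * (\<Sum>v\<in>Sym n. young v * ?x v)" by (simp add: card_Sym)
  also have "(\<Sum>v\<in>Sym n. young v * ?x v) = (\<Sum>v\<in>Sym n. \<Sum>p\<in>R. column_sum (inv p \<circ> v) * ?x v)"
    by (intro sum.cong refl) (simp add: young_apply sum_distrib_right)
  also have "\<dots> = (\<Sum>p\<in>R. \<Sum>v\<in>Sym n. column_sum (inv p \<circ> v) * ?x v)" by (rule sum.swap)
  also have "\<dots> = (\<Sum>p\<in>R. \<Sum>q\<in>C. of_int (sign q) * ?x (p \<circ> q))"
  proof (rule sum.cong[OF refl])
    fix p assume "p \<in> R"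
    then have p: "p permutes {1..n}" by (rule R_permutes)
    have "(\<Sum>v\<in>Sym n. column_sum (inv p \<circ> v) * ?x v) =
        (\<Sum>v\<in>Sym n. column_sum (inv p \<circ> (p \<circ> v)) * ?x (p \<circ> v))"
      by (rule sum_Sym_left[OF p, symmetric])
    also have "\<dots> = (\<Sum>q\<in>C. of_int (sign q) * ?x (p \<circ> q))"
      by (simp add: permutes_group_simps[OF p] sum_column_sum)
    finally show "(\<Sum>v\<in>Sym n. column_sum (inv p \<circ> v) * ?x v) = (\<Sum>q\<in>C. of_int (sign q) * ?x (p \<circ> q))" .
  qed
  finally show ?thesis by simp
qed

text \<open>
  Composing q with the transposition of y and z changes its sign but not \<open>f \<circ> q\<close>.
\<close>

lemma signed_column_sum_zero:
  assumes yz: "y \<in> {1..n}" "z \<in> {1..n}" "y \<noteq> z" "col y = col z" "f y = f z"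
  shows "(\<Sum>q\<in>C. of_int (sign q) * (if f \<circ> q = g then 1 else 0)) = (0 :: complex)"
proof -
  let ?F = "\<lambda>q. of_int (sign q) * (if f \<circ> q = g then 1 else 0) :: complex"
  let ?t = "transpose y z"
  have t: "?t \<in> C" using yz by (auto simp: C_def permutes_swap_id transpose_def)
  have ft: "f \<circ> (?t \<circ> q) = f \<circ> q" for q using yz(5) by (auto simp: fun_eq_iff transpose_def)
  have "(\<Sum>q\<in>C. ?F q) = (\<Sum>q\<in>C. ?F (?t \<circ> q))" by (rule sum_C_left[OF t, symmetric])
  also have "\<dots> = (\<Sum>q\<in>C. - ?F q)"
    using yz(3) by (intro sum.cong refl) (simp add: C_sign(1)[OF t] ft sign_swap_id)
  also have "\<dots> = - (\<Sum>q\<in>C. ?F q)" by (rule sum_negf)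
  finally show ?thesis by simp
qed

lemma sum_signed_fixed_colorings:
  assumes p: "p \<in> R"
  shows "(\<Sum>q\<in>C. of_int (sign q) * of_nat (fixed_colorings n b (p \<circ> q))) =
    (\<Sum>f\<in>colorings n b. \<Sum>q\<in>C. of_int (sign q) * (if f \<circ> q = f \<circ> inv p then 1 else 0) :: complex)"
proof -
  have pp: "p permutes {1..n}" by (rule R_permutes[OF p])
  have "(\<Sum>q\<in>C. of_int (sign q) * of_nat (fixed_colorings n b (p \<circ> q))) =
      (\<Sum>q\<in>C. \<Sum>f\<in>colorings n b. of_int (sign q) * (if f \<circ> p \<circ> q = f then 1 else 0) :: complex)"
  proof (rule sum.cong[OF refl])
    fix q
    have "of_nat (fixed_colorings n b (p \<circ> q)) = (\<Sum>f\<in>colorings n b. if f \<circ> p \<circ> q = f then 1 else 0 :: complex)"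
      by (simp add: fixed_colorings_def sum.If_cases finite_colorings Int_def comp_assoc)
    then show "of_int (sign q) * of_nat (fixed_colorings n b (p \<circ> q)) =
        (\<Sum>f\<in>colorings n b. of_int (sign q) * (if f \<circ> p \<circ> q = f then 1 else 0) :: complex)"
      by (simp only: sum_distrib_left)
  qed
  also have "\<dots> = (\<Sum>f\<in>colorings n b. \<Sum>q\<in>C. of_int (sign q) * (if f \<circ> p \<circ> q = f then 1 else 0))"
    by (rule sum.swap)
  also have "\<dots> = (\<Sum>f\<in>colorings n b. \<Sum>q\<in>C. of_int (sign q) * (if f \<circ> q = f \<circ> inv p then 1 else 0))"
    by (rule sum.reindex_bij_witness[of _ "\<lambda>f. f \<circ> inv p" "\<lambda>f. f \<circ> p"])
      (use colorings_comp_iff[OF pp] colorings_comp_iff[OF permutes_inv[OF pp]] in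
        \<open>simp_all add: comp_assoc permutes_inv_o[OF pp]\<close>)
  finally show ?thesis .
qed

text \<open>
  A surviving coloring would be injective on columns with a total below the minimum.
\<close>

lemma sum_chi_fixed_colorings_zero:
  assumes small: "\<And>f. f \<in> colorings n b \<Longrightarrow> (\<Sum>x\<in>{1..n}. f x) < (\<Sum>x\<in>{1..n}. row x)"
  shows "(\<Sum>w\<in>Sym n. chi w * of_nat (fixed_colorings n b w)) = 0"
proof -
  have "(\<Sum>q\<in>C. of_int (sign q) * (if f \<circ> q = f \<circ> inv p then 1 else 0)) = (0 :: complex)"
    if f: "f \<in> colorings n b" for f p
  proof (cases "\<exists>y\<in>{1..n}. \<exists>z\<in>{1..n}. y \<noteq> z \<and> col y = col z \<and> f y = f z")
    case True
    then show ?thesis using signed_column_sum_zero[of _ _ f "f \<circ> inv p"] by blast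
  next
    case False
    then have inj: "y = z" if "y \<in> {1..n}" "z \<in> {1..n}" "col y = col z" "f y = f z" for y z
      using that by blast
    obtain q where q: "q \<in> C" "\<And>x. x \<in> {1..n} \<Longrightarrow> f x = row (q x)"
      using column_injective_minimal[of f, OF inj less_imp_le[OF small[OF f]]] by blast
    have "(\<Sum>x\<in>{1..n}. f x) = (\<Sum>x\<in>{1..n}. row (q x))" using q(2) by simp
    also have "\<dots> = (\<Sum>x\<in>{1..n}. row x)" using sum.permute[OF C_permutes[OF q(1)], of row] by (simp add: o_def)
    finally show ?thesis using small[OF f] by simp
  qed
  then show ?thesis by (simp add: sum_chi_fixed_colorings sum_signed_fixed_colorings)
qed

definition row_coloring :: "nat \<Rightarrow> nat" where "row_coloring = restrict row {1..n}"

lemma row_coloring_eq_iff: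
  assumes g: "g permutes {1..n}" and h: "h permutes {1..n}"
  shows "row_coloring \<circ> g = row_coloring \<circ> h \<longleftrightarrow> g \<circ> inv h \<in> R"
proof
  assume eq: "row_coloring \<circ> g = row_coloring \<circ> h"
  have "row (g (inv h x)) = row x" if x: "x \<in> {1..n}" for x
  proof -
    have "g (inv h x) \<in> {1..n}"
      using x permutes_in_image[OF g] permutes_in_image[OF permutes_inv[OF h]] by blast
    then show ?thesis using fun_cong[OF eq, of "inv h x"] x permutes_inverses[OF h] by (simp add: row_coloring_def)
  qed
  then show "g \<circ> inv h \<in> R" by (simp add: R_def permutes_compose permutes_inv g h)
next
  assume r: "g \<circ> inv h \<in> R"
  show "row_coloring \<circ> g = row_coloring \<circ> h"
  proof
    fix x
    have gx: "g x \<in> {1..n} \<longleftrightarrow> x \<in> {1..n}" and hx: "h x \<in> {1..n} \<longleftrightarrow> x \<in> {1..n}"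
      using permutes_in_image[OF g] permutes_in_image[OF h] by blast+
    show "(row_coloring \<circ> g) x = (row_coloring \<circ> h) x"
    proof (cases "x \<in> {1..n}")
      case True
      then have "row ((g \<circ> inv h) (h x)) = row (h x)" using r hx unfolding R_def by blast
      then show ?thesis using True gx hx permutes_inverses[OF h] by (simp add: row_coloring_def)
    qed (simp add: permutes_not_in[OF g] permutes_not_in[OF h])
  qed
qed

lemma young_apply_columns:
  assumes g: "g permutes {1..n}"
  shows "young g = (\<Sum>q\<in>C. of_int (sign q) * (if g \<circ> inv q \<in> R then 1 else 0))"
proof -
  have "young g = (\<Sum>h\<in>Sym n. row_sum h * column_sum (inv h \<circ> g))" by (simp add: young_def ga_mult_apply g)
  also have "\<dots> = (\<Sum>h\<in>Sym n. row_sum (g \<circ> h) * column_sum (inv (g \<circ> h) \<circ> g))"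
    by (rule sum_Sym_left[OF g, symmetric])
  also have "\<dots> = (\<Sum>h\<in>Sym n. row_sum (g \<circ> h) * column_sum (inv h))"
    by (intro sum.cong refl) (simp add: inv_comp_permutes[OF g] comp_assoc permutes_group_simps[OF g])
  also have "\<dots> = (\<Sum>h\<in>Sym n. row_sum (g \<circ> inv h) * column_sum (inv (inv h)))"
    by (rule sum_Sym_inv[symmetric])
  also have "\<dots> = (\<Sum>h\<in>Sym n. column_sum h * row_sum (g \<circ> inv h))"
    by (intro sum.cong refl) (simp add: permutes_group_simps[where S = "{1..n}"])
  also have "\<dots> = (\<Sum>q\<in>C. of_int (sign q) * (if g \<circ> inv q \<in> R then 1 else 0))"
    by (simp add: sum_column_sum row_sum_def)
  finally show ?thesis .
qed

text \<open>
  Expands \<open>kappa = (young \<cdot> young) id\<close> so that it can be matched with the colorings \<open>row_coloring \<circ> q\<close>.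
\<close>

lemma kappa_eq:
  "kappa = (\<Sum>p\<in>R. \<Sum>q\<in>C. \<Sum>s\<in>C. of_int (sign q) * of_int (sign s) * (if s \<circ> p \<circ> inv q \<in> R then 1 else 0))"
proof -
  let ?S = "\<lambda>p q. (\<Sum>s\<in>C. of_int (sign q) * of_int (sign s) * (if s \<circ> p \<circ> inv q \<in> R then 1 else 0)) :: complex"
  have "kappa = (\<Sum>h\<in>Sym n. \<Sum>p\<in>R. column_sum (inv p \<circ> h) * young (inv h))"
    by (simp add: kappa_def ga_mult_apply permutes_id young_apply sum_distrib_right)
  also have "\<dots> = (\<Sum>p\<in>R. \<Sum>h\<in>Sym n. column_sum (inv p \<circ> h) * young (inv h))" by (rule sum.swap)
  also have "\<dots> = (\<Sum>p\<in>R. \<Sum>q\<in>C. \<Sum>s\<in>C. of_int (sign q) * of_int (sign s) * (if s \<circ> p \<circ> inv q \<in> R then 1 else 0))"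
  proof (rule sum.cong[OF refl])
    fix p assume "p \<in> R"
    then have p: "p permutes {1..n}" by (rule R_permutes)
    have "(\<Sum>h\<in>Sym n. column_sum (inv p \<circ> h) * young (inv h)) =
        (\<Sum>h\<in>Sym n. column_sum (inv p \<circ> (p \<circ> h)) * young (inv (p \<circ> h)))"
      by (rule sum_Sym_left[OF p, symmetric])
    also have "\<dots> = (\<Sum>q\<in>C. of_int (sign q) * young (inv (p \<circ> q)))"
      by (simp add: permutes_group_simps[OF p] sum_column_sum)
    also have "\<dots> = (\<Sum>q\<in>C. of_int (sign (inv q)) * young (inv (p \<circ> inv q)))"
      by (rule sum_C_inv[symmetric])
    also have "\<dots> = (\<Sum>q\<in>C. ?S p q)"
    proof (rule sum.cong[OF refl])
      fix q assume qC: "q \<in> C"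
      then have q: "q permutes {1..n}" by (rule C_permutes)
      have pq: "p \<circ> inv q permutes {1..n}" by (simp add: permutes_compose permutes_inv p q)
      have "young (inv (p \<circ> inv q)) =
          (\<Sum>s\<in>C. of_int (sign s) * (if inv (p \<circ> inv q) \<circ> inv s \<in> R then 1 else 0))"
        by (rule young_apply_columns[OF permutes_inv[OF pq]])
      also have "\<dots> = (\<Sum>s\<in>C. of_int (sign s) * (if s \<circ> p \<circ> inv q \<in> R then 1 else 0))"
      proof (rule sum.cong[OF refl])
        fix s assume "s \<in> C"
        then have s: "s permutes {1..n}" by (rule C_permutes)
        have spq: "s \<circ> (p \<circ> inv q) permutes {1..n}" using s pq by (simp add: permutes_compose)
        have "inv (p \<circ> inv q) \<circ> inv s = inv (s \<circ> (p \<circ> inv q))" by (simp add: inv_comp_permutes[OF s pq])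
        then have "inv (p \<circ> inv q) \<circ> inv s \<in> R \<longleftrightarrow> s \<circ> p \<circ> inv q \<in> R"
          using row_sum_inv[OF spq] by (simp add: row_sum_def comp_assoc split: if_splits)
        then show "of_int (sign s) * (if inv (p \<circ> inv q) \<circ> inv s \<in> R then 1 else 0) =
            of_int (sign s) * (if s \<circ> p \<circ> inv q \<in> R then 1 else 0 :: complex)" by simp
      qed
      finally show "of_int (sign (inv q)) * young (inv (p \<circ> inv q)) =
         ?S p q"
        by (simp add: C_sign(2)[OF qC] sum_distrib_left mult.assoc)
    qed
    finally show "(\<Sum>h\<in>Sym n. column_sum (inv p \<circ> h) * young (inv h)) =
      (\<Sum>q\<in>C. ?S p q)" .
  qed
  finally show ?thesis .
qed

text \<open>
  Now the total equals the minimum, so the surviving colorings are \<open>row_coloring \<circ> q\<close> for q in C, one for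
  each q. Their contributions are the summands of \<open>kappa\<close>.
\<close>

lemma sum_chi_fixed_colorings_row:
  assumes b: "row_coloring \<in> colorings n b"
  shows "(\<Sum>w\<in>Sym n. chi w * of_nat (fixed_colorings n b w)) = fact n"
proof -
  let ?H = "\<lambda>p q s. of_int (sign q) * of_int (sign s) * (if s \<circ> p \<circ> inv q \<in> R then 1 else 0 :: complex)"
  let ?G = "\<lambda>p f. \<Sum>q\<in>C. of_int (sign q) * (if f \<circ> q = f \<circ> inv p then 1 else 0) :: complex"
  \<comment> \<open>Colorings that are not injective on some column contribute 0.\<close>
  have supp: "f \<in> (\<lambda>q. row_coloring \<circ> q) ` C" if f: "f \<in> colorings n b" and nz: "?G p f \<noteq> 0" for f p
  proof -
    have inj: "y = z" if "y \<in> {1..n}" "z \<in> {1..n}" "col y = col z" "f y = f z" for y z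
      using signed_column_sum_zero[of y z f "f \<circ> inv p"] that nz by blast
    obtain t where t: "t permutes {1..n}" "f = row_coloring \<circ> t" using f colorings_orbit[OF b] by blast
    have "(\<Sum>x\<in>{1..n}. f x) = (\<Sum>x\<in>{1..n}. row_coloring x)"
      using sum.permute[OF t(1), of row_coloring] by (simp add: t(2) o_def)
    then have "(\<Sum>x\<in>{1..n}. f x) \<le> (\<Sum>x\<in>{1..n}. row x)" by (simp add: row_coloring_def)
    with inj obtain q where q: "q \<in> C" "\<And>x. x \<in> {1..n} \<Longrightarrow> f x = row (q x)"
      using column_injective_minimal[of f] by blast
    have "f = row_coloring \<circ> q"
    proof
      fix x
      have qx: "q x \<in> {1..n} \<longleftrightarrow> x \<in> {1..n}" using permutes_in_image[OF C_permutes[OF q(1)]] by blast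
      show "f x = (row_coloring \<circ> q) x"
        using q(2)[of x] qx f by (cases "x \<in> {1..n}") (auto simp: row_coloring_def colorings_def PiE_def extensional_def)
    qed
    with q(1) show ?thesis by blast
  qed
  have inj: "inj_on (\<lambda>q. row_coloring \<circ> q) C"
  proof (rule inj_onI)
    fix q s assume qs: "q \<in> C" "s \<in> C" "row_coloring \<circ> q = row_coloring \<circ> s"
    have "q \<circ> inv s \<in> R" using row_coloring_eq_iff[OF C_permutes[OF qs(1)] C_permutes[OF qs(2)]] qs(3) by blast
    moreover have "q \<circ> inv s \<in> C" using C_closed qs by blast
    ultimately have "q \<circ> inv s = id" by (rule R_C_trivial)
    then have "q \<circ> inv s \<circ> s = s" by simp
    then show "q = s" by (simp add: comp_assoc permutes_group_simps[OF C_permutes[OF qs(2)]])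
  qed
  have col: "(\<lambda>q. row_coloring \<circ> q) ` C \<subseteq> colorings n b"
    using colorings_comp_iff[OF C_permutes] b by blast
  have "(\<Sum>q\<in>C. of_int (sign q) * of_nat (fixed_colorings n b (p \<circ> q))) =
      (\<Sum>q\<in>C. \<Sum>s\<in>C. ?H p q s)"
    if pR: "p \<in> R" for p
  proof -
    have p: "p permutes {1..n}" by (rule R_permutes[OF pR])
    have "(\<Sum>q\<in>C. of_int (sign q) * of_nat (fixed_colorings n b (p \<circ> q))) = (\<Sum>f\<in>colorings n b. ?G p f)"
      by (rule sum_signed_fixed_colorings[OF pR])
    also have "\<dots> = (\<Sum>f\<in>(\<lambda>q. row_coloring \<circ> q) ` C. ?G p f)"
      by (rule sum.mono_neutral_right[OF finite_colorings col]) (use supp in blast)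
    also have "\<dots> = (\<Sum>q\<in>C. ?G p (row_coloring \<circ> q))" by (simp add: sum.reindex[OF inj])
    also have "\<dots> = (\<Sum>q\<in>C. \<Sum>s\<in>C. ?H p q s)"
    proof (rule sum.cong[OF refl])
      fix q assume qC: "q \<in> C"
      then have q: "q permutes {1..n}" by (rule C_permutes)
      have "?G p (row_coloring \<circ> q) = (\<Sum>s\<in>C. ?H p q (q \<circ> s))"
      proof (rule sum.cong[OF refl])
        fix s assume sC: "s \<in> C"
        then have s: "s permutes {1..n}" by (rule C_permutes)
        have qs: "q \<circ> s permutes {1..n}" and qp: "q \<circ> inv p permutes {1..n}"
          using q s p by (simp_all add: permutes_compose permutes_inv)
        have "inv (q \<circ> inv p) = p \<circ> inv q"
          by (simp add: inv_comp_permutes[OF q permutes_inv[OF p]] permutes_group_simps[OF p])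
        then have "row_coloring \<circ> q \<circ> s = row_coloring \<circ> q \<circ> inv p \<longleftrightarrow> q \<circ> s \<circ> p \<circ> inv q \<in> R"
          using row_coloring_eq_iff[OF qs qp] by (simp add: comp_assoc)
        moreover have "of_int (sign q) * of_int (sign (q \<circ> s)) = (of_int (sign s) :: complex)"
          unfolding C_sign(1)[OF qC sC] of_int_mult[symmetric] by simp
        ultimately show "of_int (sign s) * (if row_coloring \<circ> q \<circ> s = row_coloring \<circ> q \<circ> inv p then 1 else 0) = ?H p q (q \<circ> s)"
          by simp
      qed
      also have "\<dots> = (\<Sum>s\<in>C. ?H p q s)" by (rule sum_C_left[OF qC])
      finally show "?G p (row_coloring \<circ> q) = (\<Sum>s\<in>C. ?H p q s)" .
    qed
    finally show ?thesis .
  qed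
  then have "(\<Sum>p\<in>R. \<Sum>q\<in>C. of_int (sign q) * of_nat (fixed_colorings n b (p \<circ> q))) = kappa"
    by (simp only: kappa_eq cong: sum.cong)
  then show ?thesis using kappa_nonzero by (simp add: sum_chi_fixed_colorings)
qed

end

section \<open>Irreducible characters of Young diagrams\<close>

definition box_of :: "nat list \<Rightarrow> nat \<Rightarrow> nat \<times> nat" where
  "box_of l = inv_into (diagram l) (row_reading_tableau l)"

lemma row_reading_tableau_bij:
  "bij_betw (row_reading_tableau l) (diagram l) {1..sum_list l}"
proof -
  let ?T = "row_reading_tableau l"
  have step: "sum_list (take r l) + l ! r \<le> sum_list (take r' l)" if "r < r'" "r < length l" for r r'
  proof -
    have "sum_list (take r l) + l ! r = sum_list (take (Suc r) l)"
      using that by (simp add: take_Suc_conv_app_nth)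
    also have "\<dots> \<le> sum_list (take (Suc r) l) + sum_list (take (r' - Suc r) (drop (Suc r) l))" by simp
    also have "\<dots> = sum_list (take (Suc r + (r' - Suc r)) l)" by (simp only: take_add sum_list_append)
    also have "Suc r + (r' - Suc r) = r'" using that by simp
    finally show ?thesis .
  qed
  have less: "?T (r, c) < ?T (r', c')" if "r < r'" "(r, c) \<in> diagram l" for r r' c c'
    using step[of r r'] that by (auto simp: row_reading_tableau_def diagram_def)
  have inj: "inj_on ?T (diagram l)"
  proof (rule inj_onI, clarify)
    fix r c r' c' assume d: "(r, c) \<in> diagram l" "(r', c') \<in> diagram l" "?T (r, c) = ?T (r', c')"
    then have "r = r'" using less[of r r' c c'] less[of r' r c' c] by (metis less_irrefl linorder_neqE_nat)
    with d show "r = r' \<and> c = c'" by (simp add: row_reading_tableau_def)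
  qed
  moreover have "?T ` diagram l = {1..sum_list l}"
  proof (rule card_subset_eq)
    show "?T ` diagram l \<subseteq> {1..sum_list l}"
    proof
      fix x assume "x \<in> ?T ` diagram l"
      then obtain r c where rc: "(r, c) \<in> diagram l" "x = ?T (r, c)" by auto
      then have "r < length l" "c < l ! r" by (auto simp: diagram_def)
      with step[of r "length l"] rc(2) show "x \<in> {1..sum_list l}" by (simp add: row_reading_tableau_def)
    qed
    show "card (?T ` diagram l) = card {1..sum_list l}" by (simp add: card_image[OF inj] card_diagram)
  qed simp
  ultimately show ?thesis by (simp add: bij_betw_def)
qed

lemma box_of:
  assumes "x \<in> {1..sum_list l}"
  shows "box_of l x \<in> diagram l" "row_reading_tableau l (box_of l x) = x"
  using assms row_reading_tableau_bij[of l] inv_into_into[of x "row_reading_tableau l" "diagram l"]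
    f_inv_into_f[of x "row_reading_tableau l" "diagram l"]
  by (auto simp: bij_betw_def box_of_def)

lemma box_of_tableau: "b \<in> diagram l \<Longrightarrow> box_of l (row_reading_tableau l b) = b"
  using row_reading_tableau_bij[of l] by (simp add: bij_betw_def box_of_def)

lemma tableau_in_range: "b \<in> diagram l \<Longrightarrow> row_reading_tableau l b \<in> {1..sum_list l}"
  using row_reading_tableau_bij[of l] by (auto simp: bij_betw_def)

lemma image_row_reading:
  "row_reading_tableau l ` {b \<in> diagram l. F b = i} = {x \<in> {1..sum_list l}. F (box_of l x) = i}"
proof (intro equalityI subsetI)
  fix x assume "x \<in> row_reading_tableau l ` {b \<in> diagram l. F b = i}"
  then obtain b where "b \<in> diagram l" "F b = i" "x = row_reading_tableau l b" by auto
  then show "x \<in> {x \<in> {1..sum_list l}. F (box_of l x) = i}"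
    by (simp add: tableau_in_range box_of_tableau del: atLeastAtMost_iff)
next
  fix x assume "x \<in> {x \<in> {1..sum_list l}. F (box_of l x) = i}"
  then show "x \<in> row_reading_tableau l ` {b \<in> diagram l. F b = i}"
    using box_of[of x l] by (intro image_eqI[of _ _ "box_of l x"]) auto
qed

text \<open>
  Connects the stabilizers of rows and columns as sets with permutations that preserve an index.
\<close>

lemma permutes_preserves_fibers_iff:
  assumes p: "p permutes S" and S: "finite S"
  shows "(\<forall>i. p ` {x \<in> S. F x = i} = {x \<in> S. F x = i}) \<longleftrightarrow> (\<forall>x\<in>S. F (p x) = F x)"
proof
  assume "\<forall>i. p ` {x \<in> S. F x = i} = {x \<in> S. F x = i}"
  then show "\<forall>x\<in>S. F (p x) = F x" by blast
next
  assume F: "\<forall>x\<in>S. F (p x) = F x"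
  show "\<forall>i. p ` {x \<in> S. F x = i} = {x \<in> S. F x = i}"
  proof
    fix i
    have "p ` {x \<in> S. F x = i} \<subseteq> {x \<in> S. F x = i}" using F permutes_in_image[OF p] by auto
    moreover have "inj_on p {x \<in> S. F x = i}" by (rule inj_on_subset[OF permutes_inj[OF p]]) simp
    ultimately show "p ` {x \<in> S. F x = i} = {x \<in> S. F x = i}"
      by (intro endo_inj_surj) (simp_all add: S)
  qed
qed

lemma sum_coloring:
  assumes "f \<in> colorings n b"
  shows "int (\<Sum>x\<in>{1..n}. f x) = (\<Sum>i<n. int i * b i)"
proof -
  have "(\<Sum>x\<in>{1..n}. f x) = (\<Sum>i<n. \<Sum>x | x \<in> {1..n} \<and> f x = i. f x)"
    by (rule sum.group[symmetric]) (use assms in \<open>auto simp: colorings_def\<close>)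
  also have "\<dots> = (\<Sum>i<n. i * card {x \<in> {1..n}. f x = i})" by (intro sum.cong) (auto simp: mult.commute)
  finally show ?thesis using assms by (simp add: colorings_def)
qed

lemma diagram_row_column:
  assumes l: "l \<in> partitions n"
  shows "row_column n (\<lambda>x. fst (box_of l x)) (\<lambda>x. snd (box_of l x))"
proof
  have n: "sum_list l = n" using l by (simp add: partitions_def)
  show "x = y" if "x \<in> {1..n}" "y \<in> {1..n}" "fst (box_of l x) = fst (box_of l y)" "snd (box_of l x) = snd (box_of l y)" for x y
    using box_of(2)[of x l] box_of(2)[of y l] that by (simp add: n prod_eq_iff) (metis prod_eq_iff)
  show "\<exists>y\<in>{1..n}. snd (box_of l y) = snd (box_of l x) \<and> fst (box_of l y) = i"
    if x: "x \<in> {1..n}" and i: "i < fst (box_of l x)" for x i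
  proof -
    obtain r c where rc: "box_of l x = (r, c)" by fastforce
    then have "(r, c) \<in> diagram l" using box_of(1)[of x l] x by (simp add: n)
    then have "(i, c) \<in> diagram l"
      using i rc partition_nonincreasing[OF l, of i r] by (auto simp: diagram_def)
    then show ?thesis
      using tableau_in_range[of "(i, c)" l] box_of_tableau[of "(i, c)" l] rc n by (intro bexI[of _ "row_reading_tableau l (i, c)"]) auto
  qed
qed

context
  fixes l n
  assumes l: "l \<in> partitions n"
begin

interpretation row_column n "\<lambda>x. fst (box_of l x)" "\<lambda>x. snd (box_of l x)"
  by (rule diagram_row_column[OF l])

lemma sum_list_eq: "sum_list l = n"
  using l by (simp add: partitions_def)

lemma row_group_eq: "row_group l = R"
  unfolding row_group_def R_def image_row_reading sum_list_eq
  by (intro Collect_cong conj_cong refl permutes_preserves_fibers_iff) simp_all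

lemma column_group_eq: "column_group l = C"
  unfolding column_group_def C_def image_row_reading sum_list_eq
  by (intro Collect_cong conj_cong refl permutes_preserves_fibers_iff) simp_all

lemma young_symmetrizer_eq: "young_symmetrizer l = young"
proof -
  have "(\<Sum>p\<in>R. ga_single p) = row_sum"
    by (rule ext) (simp add: sum_fun_apply ga_single_def row_sum_def finite_R)
  moreover have "(\<Sum>q\<in>C. (\<lambda>g. of_int (sign q) * ga_single q g)) = column_sum"
  proof
    fix g
    have "(\<Sum>q\<in>C. (\<lambda>g. of_int (sign q) * ga_single q g)) g = (\<Sum>q\<in>C. if g = q then of_int (sign q) else 0)"
      unfolding sum_fun_apply by (intro sum.cong) (auto simp: ga_single_def)
    then show "(\<Sum>q\<in>C. (\<lambda>g. of_int (sign q) * ga_single q g)) g = column_sum g"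
      by (simp add: column_sum_def finite_C)
  qed
  ultimately show ?thesis
    by (simp add: young_symmetrizer_def young_def row_group_eq column_group_eq sum_list_eq)
qed

lemma irr_character_eq_chi: "w permutes {1..n} \<Longrightarrow> irr_character l w = chi w"
  using trace_on_left_ideal[of w]
  by (simp add: irr_character_def specht_module_def young_symmetrizer_eq sum_list_eq)

lemma irr_character_real: "w permutes {1..n} \<Longrightarrow> irr_character l w \<in> \<real>"
  using chi_real by (simp add: irr_character_eq_chi)

lemma sum_irr_character_square: "(\<Sum>w\<in>Sym n. irr_character l w * irr_character l w) = fact n"
  using sum_chi_square by (simp add: irr_character_eq_chi)

lemma card_row: "int (card {x \<in> {1..n}. fst (box_of l x) = i}) = row_lengths l i"
proof -
  have "inj_on (row_reading_tableau l) {b \<in> diagram l. fst b = i}"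
    using row_reading_tableau_bij[of l] by (auto simp: bij_betw_def intro: inj_on_subset)
  from card_image[OF this]
  have "card {x \<in> {1..n}. fst (box_of l x) = i} = card {b \<in> diagram l. fst b = i}"
    by (simp only: image_row_reading sum_list_eq)
  also have "{b \<in> diagram l. fst b = i} = Pair i ` {c. (i, c) \<in> diagram l}" by auto
  also have "card \<dots> = card {c. (i, c) \<in> diagram l}" by (rule card_image) (auto simp: inj_on_def)
  finally show ?thesis by (simp add: int_card_diagram_row)
qed

lemma row_coloring_in: "row_coloring \<in> colorings n (row_lengths l)"
proof -
  have "fst (box_of l x) < n" if "x \<in> {1..n}" for x
    using box_of(1)[of x l] that partition_length_le[OF l] by (auto simp: sum_list_eq diagram_def split: prod.splits)
  moreover have "{x \<in> {1..n}. row_coloring x = i} = {x \<in> {1..n}. fst (box_of l x) = i}" for i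
    by (auto simp: row_coloring_def)
  ultimately show ?thesis using card_row by (auto simp: colorings_def row_coloring_def)
qed

lemma sum_irr_character_fixed_colorings_row_lengths:
  "(\<Sum>w\<in>Sym n. irr_character l w * of_nat (fixed_colorings n (row_lengths l) w)) = fact n"
  using sum_chi_fixed_colorings_row[OF row_coloring_in] by (simp add: irr_character_eq_chi)

lemma sum_irr_character_fixed_colorings_zero:
  assumes "(\<Sum>i<n. int i * b i) < (\<Sum>i<n. int i * row_lengths l i)"
  shows "(\<Sum>w\<in>Sym n. irr_character l w * of_nat (fixed_colorings n b w)) = 0"
proof -
  have "(\<Sum>x\<in>{1..n}. f x) < (\<Sum>x\<in>{1..n}. fst (box_of l x))" if "f \<in> colorings n b" for f
  proof -
    have "int (\<Sum>x\<in>{1..n}. f x) < int (\<Sum>x\<in>{1..n}. row_coloring x)"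
      unfolding sum_coloring[OF that] sum_coloring[OF row_coloring_in] by (rule assms)
    then have "(\<Sum>x\<in>{1..n}. f x) < (\<Sum>x\<in>{1..n}. row_coloring x)" by (simp only: of_nat_less_iff)
    then show ?thesis by (simp add: row_coloring_def)
  qed
  then show ?thesis using sum_chi_fixed_colorings_zero[of b] by (simp add: irr_character_eq_chi)
qed

end

section \<open>Colorings as words\<close>

definition has_breaks :: "nat \<Rightarrow> (nat \<Rightarrow> nat) \<Rightarrow> nat set \<Rightarrow> bool" where
  "has_breaks n k I \<longleftrightarrow> (\<forall>i. 1 \<le> i \<longrightarrow> i < n \<longrightarrow> (i \<in> I \<longleftrightarrow> k i \<noteq> k (Suc i)))"

lemma decreasing_on_blocks_iff:
  assumes k: "mono_on {1..n} k" and I: "has_breaks n k I"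
  shows "decreasing_on_blocks n k h \<longleftrightarrow> ascents_within I (map h [1..<Suc n])"
proof -
  have "ascents_within I (map h [1..<Suc n]) \<longleftrightarrow> (\<forall>i. 1 \<le> i \<longrightarrow> i < n \<longrightarrow> i \<notin> I \<longrightarrow> h (Suc i) \<le> h i)" (is "_ \<longleftrightarrow> ?A")
  proof
    assume L: "ascents_within I (map h [1..<Suc n])"
    show ?A
    proof (intro allI impI)
      fix i assume i: "1 \<le> i" "i < n" "i \<notin> I"
      then obtain j where "i = Suc j" by (cases i) auto
      then show "h (Suc i) \<le> h i"
        using L[unfolded ascents_within_def, rule_format, of j] i by (simp add: One_nat_def del: upt_Suc)
    qed
  next
    assume ?A
    then show "ascents_within I (map h [1..<Suc n])"
      unfolding ascents_within_def by (auto simp add: One_nat_def simp del: upt_Suc)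
  qed
  moreover have "decreasing_on_blocks n k h \<longleftrightarrow> ?A"
  proof
    assume D: "decreasing_on_blocks n k h"
    show ?A
    proof (intro allI impI)
      fix i assume "1 \<le> i" "i < n" "i \<notin> I"
      then show "h (Suc i) \<le> h i"
        using D[unfolded decreasing_on_blocks_def, rule_format, of i "Suc i"] I by (simp add: has_breaks_def)
    qed
  next
    assume A: ?A
    have "h y \<le> h x" if "1 \<le> x" "x \<le> y" "y \<le> n" "k x = k y" for x y
      using that(2-4)
    proof (induction y rule: dec_induct)
      case (step y)
      have "k x \<le> k y" "k y \<le> k (Suc y)"
        using mono_onD[OF k, of x y] mono_onD[OF k, of y "Suc y"] step that(1) by auto
      then have "k x = k y" "k y = k (Suc y)" using step.prems by auto
      then have "y \<notin> I" using I step that(1) by (simp add: has_breaks_def)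
      then have "h (Suc y) \<le> h y" using A step that(1) by simp
      also have "h y \<le> h x" using step \<open>k x = k y\<close> by simp
      finally show ?case .
    qed simp
    then show "decreasing_on_blocks n k h" by (auto simp: decreasing_on_blocks_def)
  qed
  ultimately show ?thesis by simp
qed

lemma colorings_words_bij:
  assumes k: "mono_on {1..n} k" and I: "has_breaks n k I"
  shows "bij_betw (\<lambda>h. map h [1..<Suc n]) {h \<in> colorings n b. decreasing_on_blocks n k h} (words n n I b)"
proof (rule bij_betw_byWitness[where f' = "\<lambda>x. restrict (\<lambda>i. x ! (i - 1)) {1..n}"])
  have inv1: "restrict (\<lambda>i. map h [1..<Suc n] ! (i - 1)) {1..n} = h" if "h \<in> extensional {1..n}" for h :: "nat \<Rightarrow> nat"
    using that by (auto simp: fun_eq_iff extensional_def simp del: upt_Suc)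
  have inv2: "map (restrict (\<lambda>i. x ! (i - 1)) {1..n}) [1..<Suc n] = x" if "length x = n" for x :: "nat list"
    using that by (intro nth_equalityI) (auto simp: One_nat_def simp del: upt_Suc)
  show "\<forall>h\<in>{h \<in> colorings n b. decreasing_on_blocks n k h}. restrict (\<lambda>i. map h [1..<Suc n] ! (i - 1)) {1..n} = h"
    using inv1 by (auto simp: colorings_def PiE_def simp del: upt_Suc)
  show "\<forall>x\<in>words n n I b. map (restrict (\<lambda>i. x ! (i - 1)) {1..n}) [1..<Suc n] = x"
    using inv2 by (auto simp: words_def simp del: upt_Suc)
  show "(\<lambda>h. map h [1..<Suc n]) ` {h \<in> colorings n b. decreasing_on_blocks n k h} \<subseteq> words n n I b"
    using decreasing_on_blocks_iff[OF k I]
    by (auto simp: words_def colorings_def PiE_def Pi_def count_list_map_upt less_Suc_eq_le simp del: upt_Suc)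
  show "(\<lambda>x. restrict (\<lambda>i. x ! (i - 1)) {1..n}) ` words n n I b \<subseteq> {h \<in> colorings n b. decreasing_on_blocks n k h}"
  proof (intro image_subsetI)
    fix x assume x: "x \<in> words n n I b"
    let ?h = "restrict (\<lambda>i. x ! (i - 1)) {1..n}"
    have m: "map ?h [1..<Suc n] = x" using inv2 x by (simp add: words_def del: upt_Suc)
    have "card {i \<in> {1..n}. ?h i = j} = count_list x j" for j
      using count_list_map_upt[of ?h n j] unfolding m by simp
    moreover have "x ! (i - 1) < n" if "i \<in> {1..n}" for i
      using x that nth_mem[of "i - 1" x] by (fastforce simp: words_def)
    moreover have "decreasing_on_blocks n k ?h"
      unfolding decreasing_on_blocks_iff[OF k I] m using x by (simp add: words_def)
    ultimately show "?h \<in> {h \<in> colorings n b. decreasing_on_blocks n k h}"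
      using x by (auto simp: colorings_def words_def)
  qed
qed

lemma sum_fixed_colorings_words:
  assumes k: "k \<in> colorings n a" "mono_on {1..n} k" and I: "has_breaks n k I"
  shows "(\<Sum>w\<in>Sym n. fixed_colorings n a w * fixed_colorings n b w) = fact n * card (words n n I b)"
  using sum_fixed_colorings_mult[OF k, of b] bij_betw_same_card[OF colorings_words_bij[OF k(2) I, of b]] by simp

section \<open>Jacobi-Trudi functions and Young's rule\<close>

text \<open>
  The expansion of the determinant of the complete homogeneous symmetric functions
  \<open>h (l i - i + j)\<close>, with permutation characters in place of products of the h's.
\<close>

definition jacobi_trudi :: "nat \<Rightarrow> nat list \<Rightarrow> (nat \<Rightarrow> nat) \<Rightarrow> complex" where
  "jacobi_trudi n l w = (\<Sum>p | p permutes {..<n}. of_int (sign p) *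
     of_nat (fixed_colorings n (\<lambda>i. row_lengths l i - int i + int (p i)) w))"

lemma sum_fixed_jacobi_trudi:
  assumes l: "l \<in> partitions n" and k: "k \<in> colorings n a" "mono_on {1..n} k" and I: "has_breaks n k I"
  shows "(\<Sum>w\<in>Sym n. of_nat (fixed_colorings n a w) * jacobi_trudi n l w) =
    fact n * of_nat (card (lattice_words n n I (row_lengths l)))"
proof -
  let ?b = "\<lambda>p i. row_lengths l i - int i + int (p i)"
  have "(\<Sum>w\<in>Sym n. of_nat (fixed_colorings n a w) * jacobi_trudi n l w) =
      (\<Sum>w\<in>Sym n. \<Sum>p | p permutes {..<n}. of_int (sign p) * of_nat (fixed_colorings n a w * fixed_colorings n (?b p) w))"
    by (simp add: jacobi_trudi_def sum_distrib_left mult_ac)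
  also have "\<dots> = (\<Sum>p | p permutes {..<n}. \<Sum>w\<in>Sym n. of_int (sign p) * of_nat (fixed_colorings n a w * fixed_colorings n (?b p) w))"
    by (rule sum.swap)
  also have "\<dots> = (\<Sum>p | p permutes {..<n}. of_int (sign p) * of_nat (fact n * card (words n n I (?b p))))"
    by (simp only: sum_fixed_colorings_words[OF k I, symmetric] of_nat_sum sum_distrib_left)
  also have "\<dots> = fact n * of_int (alternating_words n n I (\<lambda>i. row_lengths l i - int i))"
    by (simp add: alternating_words_def sum_distrib_left mult_ac)
  also have "alternating_words n n I (\<lambda>i. row_lengths l i - int i) = int (card (lattice_words n n I (row_lengths l)))"
    by (rule alternating_words_eq_lattice_words)
      (use row_lengths_nonincreasing[OF l] row_lengths_beyond[OF l] in auto)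
  finally show ?thesis by simp
qed

text \<open>
  A new maximal letter of a lattice word exceeds the letters before it by at most 1, and inside a
  block the letters do not increase. So the letters cannot grow faster than the block index k.
\<close>

lemma lattice_word_le:
  assumes k: "mono_on {1..n} k" and I: "has_breaks n k I" and x: "x \<in> lattice_words n n I b" and "j < n"
  shows "x ! j \<le> k (Suc j)"
  using \<open>j < n\<close>
proof (induction j rule: less_induct)
  case (less j)
  have len: "length x = n" and Y: "yamanouchi x" and asc: "ascents_within I x"
    using x by (auto simp: lattice_words_def words_def)
  show ?case
  proof (cases "x ! j")
    case (Suc r)
    have "0 < count_list (take (Suc j) x) (Suc r)"
      using less.prems len Suc by (simp add: take_Suc_conv_app_nth)
    also have "\<dots> \<le> count_list (take (Suc j) x) r"
      using Y less.prems len by (simp add: yamanouchi_def)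
    finally have "r \<in> set (take (Suc j) x)" by (metis count_list_0_iff less_irrefl)
    then obtain i where i: "i < Suc j" "x ! i = r" using len less.prems by (auto simp: in_set_conv_nth)
    then have "i < j" using Suc by (metis less_antisym n_not_Suc_n)
    then have "r \<le> k (Suc i)" using less.IH[of i] i less.prems by simp
    obtain j' where j': "j = Suc j'" using \<open>i < j\<close> by (cases j) auto
    have ri: "r \<le> k j"
    proof -
      have "k (Suc i) \<le> k j" using mono_onD[OF k, of "Suc i" j] \<open>i < j\<close> less.prems by auto
      with \<open>r \<le> k (Suc i)\<close> show ?thesis by simp
    qed
    have kk: "k j \<le> k (Suc j)" using mono_onD[OF k, of j "Suc j"] j' less.prems by auto
    show ?thesis
    proof (cases "j \<in> I")
      case True
      then have "k j \<noteq> k (Suc j)" using I j' less.prems by (simp add: has_breaks_def One_nat_def)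
      then show ?thesis using ri kk Suc by simp
    next
      case False
      then have "x ! j \<le> x ! j'" using asc j' len less.prems by (simp add: ascents_within_def)
      also have "\<dots> \<le> k j" using less.IH[of j'] j' less.prems by simp
      finally show ?thesis using kk by simp
    qed
  qed simp
qed

text \<open>
  For a partition this is the statistic usually written n(l): the sum of the row indices of all
  boxes.
\<close>

definition weight :: "nat \<Rightarrow> (nat \<Rightarrow> int) \<Rightarrow> int" where
  "weight n b = (\<Sum>i<n. int i * b i)"

lemma weight_coloring: "f \<in> colorings n b \<Longrightarrow> weight n b = int (\<Sum>x\<in>{1..n}. f x)"
  by (simp only: weight_def sum_coloring)

lemma weight_word:
  assumes x: "x \<in> words n n I b"
  shows "weight n b = int (\<Sum>j<n. x ! j)"
proof -
  have "(\<Sum>j<n. x ! j) = sum_list x"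
    using x by (simp add: words_def sum_list_sum_nth atLeast0LessThan)
  also have "\<dots> = (\<Sum>i<n. count_list x i * i)"
  proof -
    have "sum_list (map (\<lambda>i. i) x) = (\<Sum>i\<in>{..<n}. count_list x i * i)"
      by (subst sum_list_map_eq_sum_count2[of x "{..<n}" "\<lambda>i. i"]) (use x in \<open>auto simp: words_def\<close>)
    then show ?thesis by simp
  qed
  finally show ?thesis using x by (simp add: weight_def words_def mult.commute)
qed

text \<open>
  This is the triangularity of Kostka numbers, with the weight in the role of the dominance order.
\<close>

lemma lattice_word_weight:
  assumes k: "k \<in> colorings n a" "mono_on {1..n} k" and I: "has_breaks n k I" and x: "x \<in> lattice_words n n I b"
  shows "weight n b \<le> weight n a" and "weight n a \<le> weight n b \<Longrightarrow> x = map k [1..<Suc n] \<and> a = b"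
proof -
  have xw: "x \<in> words n n I b" using x by (simp add: lattice_words_def)
  have a: "weight n a = int (\<Sum>j<n. k (Suc j))"
  proof -
    have "(\<Sum>x\<in>{1..n}. k x) = (\<Sum>j<n. k (Suc j))"
      by (rule sum.reindex_bij_witness[of _ Suc "\<lambda>x. x - 1"]) (auto simp: One_nat_def)
    then show ?thesis using weight_coloring[OF k(1)] by simp
  qed
  have le: "x ! j \<le> k (Suc j)" if "j < n" for j by (rule lattice_word_le[OF k(2) I x that])
  have "(\<Sum>j<n. x ! j) \<le> (\<Sum>j<n. k (Suc j))" by (rule sum_mono) (use le in auto)
  then show "weight n b \<le> weight n a" unfolding a weight_word[OF xw] by (simp only: of_nat_le_iff)
  assume "weight n a \<le> weight n b"
  then have ge: "(\<Sum>j<n. k (Suc j)) \<le> (\<Sum>j<n. x ! j)" unfolding a weight_word[OF xw] by (simp only: of_nat_le_iff)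
  have eq: "x ! j = k (Suc j)" if "j < n" for j
  proof (rule ccontr)
    assume "x ! j \<noteq> k (Suc j)"
    then have "(\<Sum>j<n. x ! j) < (\<Sum>j<n. k (Suc j))"
      using le that by (intro sum_strict_mono_ex1 bexI[of _ j]) (auto simp: le_less)
    with ge show False by simp
  qed
  then have xk: "x = map k [1..<Suc n]"
    using xw by (intro nth_equalityI) (auto simp: words_def One_nat_def simp del: upt_Suc)
  moreover have "a i = b i" for i
  proof -
    have "b i = int (count_list x i)" using xw by (simp add: words_def)
    also have "count_list x i = card {x \<in> {1..n}. k x = i}" unfolding xk by (rule count_list_map_upt)
    finally show ?thesis using k(1) by (simp add: colorings_def)
  qed
  ultimately show "x = map k [1..<Suc n] \<and> a = b" by blast
qed

lemma sorted_coloring_lattice_word: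
  assumes l: "l \<in> partitions n" and k: "k \<in> colorings n (row_lengths l)" "mono_on {1..n} k" and I: "has_breaks n k I"
  shows "map k [1..<Suc n] \<in> lattice_words n n I (row_lengths l)"
proof -
  have "decreasing_on_blocks n k k" by (auto simp: decreasing_on_blocks_def)
  then have w: "map k [1..<Suc n] \<in> words n n I (row_lengths l)"
    using colorings_words_bij[OF k(2) I, of "row_lengths l"] k(1) unfolding bij_betw_def by blast
  have "yamanouchi (map k [1..<Suc n])"
    unfolding yamanouchi_def
  proof (intro allI impI)
    fix j i assume "j \<le> length (map k [1..<Suc n])"
    then have j: "j \<le> n" by (simp del: upt_Suc)
    have tk: "take j (map k [1..<Suc n]) = map k [1..<Suc j]"
      using j by (intro nth_equalityI) (simp_all del: upt_Suc)
    show "count_list (take j (map k [1..<Suc n])) (Suc i) \<le> count_list (take j (map k [1..<Suc n])) i"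
      unfolding tk count_list_map_upt
    proof (cases "{x \<in> {1..j}. k x = Suc i} = {}")
      case False
      then obtain y where y: "y \<in> {1..j}" "k y = Suc i" by blast
      have "card {x \<in> {1..j}. k x = Suc i} \<le> card {x \<in> {1..n}. k x = Suc i}"
        using j by (intro card_mono) auto
      also have "\<dots> \<le> card {x \<in> {1..n}. k x = i}"
      proof -
        have "row_lengths l i = int (card {x \<in> {1..n}. k x = i})" for i
          using k(1) by (simp add: colorings_def)
        from row_lengths_nonincreasing[OF l, of i, unfolded this] show ?thesis by (simp only: of_nat_le_iff)
      qed
      also have "\<dots> \<le> card {x \<in> {1..j}. k x = i}"
      proof (rule card_mono)
        show "{x \<in> {1..n}. k x = i} \<subseteq> {x \<in> {1..j}. k x = i}"
        proof clarify
          fix x assume x: "x \<in> {1..n}" "i = k x"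
          have "\<not> y \<le> x" using mono_onD[OF k(2), of y x] x y j by auto
          then show "x \<in> {1..j} \<and> k x = k x" using x y by auto
        qed
      qed simp
      finally show "card {x \<in> {1..j}. k x = Suc i} \<le> card {x \<in> {1..j}. k x = i}" .
    next
      case True
      show "card {x \<in> {1..j}. k x = Suc i} \<le> card {x \<in> {1..j}. k x = i}"
        unfolding True by (simp only: card.empty zero_le)
    qed
  qed
  with w show ?thesis by (simp add: lattice_words_def)
qed

lemma exists_sorted_coloring:
  assumes "f \<in> colorings n b"
  obtains k I where "k \<in> colorings n b" "mono_on {1..n} k" "has_breaks n k I"
proof -
  obtain t where "t permutes {1..n}" "mono_on {1..n} (f \<circ> t)" by (rule exists_sorting_permutation)
  moreover have "has_breaks n (f \<circ> t) {i. (f \<circ> t) i \<noteq> (f \<circ> t) (Suc i)}" by (simp add: has_breaks_def)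
  ultimately show ?thesis using that colorings_comp_iff assms by blast
qed

text \<open>
  The inner product of real class functions, hence without conjugation.
\<close>

definition pairing :: "nat \<Rightarrow> ((nat \<Rightarrow> nat) \<Rightarrow> complex) \<Rightarrow> ((nat \<Rightarrow> nat) \<Rightarrow> complex) \<Rightarrow> complex" where
  "pairing n f g = (\<Sum>w\<in>Sym n. f w * g w) / fact n"

abbreviation perm_character :: "nat \<Rightarrow> (nat \<Rightarrow> int) \<Rightarrow> (nat \<Rightarrow> nat) \<Rightarrow> complex" where
  "perm_character n b w \<equiv> of_nat (fixed_colorings n b w)"

lemma pairing_commute: "pairing n f g = pairing n g f"
  by (simp add: pairing_def mult.commute)

lemma pairing_sum_right: "pairing n f (\<lambda>w. \<Sum>i\<in>A. c i * g i w) = (\<Sum>i\<in>A. c i * pairing n f (g i))"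
proof -
  have "(\<Sum>w\<in>Sym n. f w * (\<Sum>i\<in>A. c i * g i w)) = (\<Sum>i\<in>A. c i * (\<Sum>w\<in>Sym n. f w * g i w))"
    by (simp add: sum_distrib_left mult.left_commute) (rule sum.swap)
  then show ?thesis by (simp only: pairing_def times_divide_eq_right sum_divide_distrib[symmetric])
qed

lemma pairing_jacobi_trudi_perm:
  assumes l: "l \<in> partitions n"
  shows "weight n b \<le> weight n (row_lengths l) \<Longrightarrow>
    pairing n (jacobi_trudi n l) (perm_character n b) = (if b = row_lengths l then 1 else 0)"
proof -
  assume le: "weight n b \<le> weight n (row_lengths l)"
  show ?thesis
  proof (cases "colorings n b = {}")
    case True
    then have "b \<noteq> row_lengths l"
      using row_column.row_coloring_def row_coloring_in[OF l] by blast
    then show ?thesis using True by (simp add: pairing_def fixed_colorings_def)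
  next
    case False
    then obtain k I where k: "k \<in> colorings n b" "mono_on {1..n} k" "has_breaks n k I"
      using exists_sorted_coloring by blast
    have p: "pairing n (jacobi_trudi n l) (perm_character n b) = of_nat (card (lattice_words n n I (row_lengths l)))"
      using sum_fixed_jacobi_trudi[OF l k] by (simp add: pairing_def mult.commute)
    show ?thesis
    proof (cases "b = row_lengths l")
      case True
      have "lattice_words n n I (row_lengths l) = {map k [1..<Suc n]}"
        using sorted_coloring_lattice_word[OF l _ k(2,3)] lattice_word_weight(2)[OF k _ le] k(1) True by blast
      then show ?thesis using p True by simp
    next
      case False
      then have "lattice_words n n I (row_lengths l) = {}"
        using lattice_word_weight(2)[OF k _ le] by blast
      then show ?thesis using p False by simp
    qed
  qed
qed

text \<open>
  The difference of the weights is half of the sum of the squares of \<open>i - p i\<close>.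
\<close>

lemma weight_jacobi_trudi_term:
  assumes p: "p permutes {..<n}"
  shows "weight n (\<lambda>i. b i - int i + int (p i)) \<le> weight n b"
    and "p \<noteq> id \<Longrightarrow> weight n (\<lambda>i. b i - int i + int (p i)) < weight n b"
proof -
  have sq: "(\<Sum>i<n. (int (p i))\<^sup>2) = (\<Sum>i<n. (int i)\<^sup>2)"
    using sum.permute[OF p, of "\<lambda>i. (int i)\<^sup>2"] by (simp add: o_def)
  have "2 * (weight n b - weight n (\<lambda>i. b i - int i + int (p i))) =
      (\<Sum>i<n. 2 * (int i)\<^sup>2 - 2 * int i * int (p i))"
    by (simp add: weight_def sum_distrib_left power2_eq_square algebra_simps flip: sum_subtractf)
  also have "\<dots> = (\<Sum>i<n. (int i - int (p i))\<^sup>2 + ((int i)\<^sup>2 - (int (p i))\<^sup>2))"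
    by (intro sum.cong refl) (simp add: power2_eq_square algebra_simps)
  also have "\<dots> = (\<Sum>i<n. (int i - int (p i))\<^sup>2)"
    using sq by (simp add: sum.distrib sum_subtractf)
  finally have eq: "2 * (weight n b - weight n (\<lambda>i. b i - int i + int (p i))) = (\<Sum>i<n. (int i - int (p i))\<^sup>2)" .
  have half: "y \<le> x \<and> (0 < s \<longrightarrow> y < x)" if "2 * (x - y) = s" "0 \<le> s" for x y s :: int
    using that by auto
  have nonneg: "0 \<le> (\<Sum>i<n. (int i - int (p i))\<^sup>2)" by (intro sum_nonneg) simp
  show "weight n (\<lambda>i. b i - int i + int (p i)) \<le> weight n b" using half[OF eq nonneg] by blast
  assume "p \<noteq> id"
  then obtain i where i: "p i \<noteq> i" by (auto simp: fun_eq_iff)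
  then have "i < n" using permutes_not_in[OF p, of i] by auto
  then have "0 < (\<Sum>i<n. (int i - int (p i))\<^sup>2)"
    using i by (intro sum_pos2[of _ i]) auto
  then show "weight n (\<lambda>i. b i - int i + int (p i)) < weight n b" using half[OF eq nonneg] by blast
qed

text \<open>
  All terms of the expansion other than the leading one have smaller weight.
\<close>

lemma pairing_jacobi_trudi_expand:
  assumes zero: "\<And>b. weight n b < weight n (row_lengths m) \<Longrightarrow> pairing n f (perm_character n b) = 0"
  shows "pairing n f (jacobi_trudi n m) = pairing n f (perm_character n (row_lengths m))"
proof -
  let ?b = "\<lambda>p i. row_lengths m i - int i + int (p i)"
  have "pairing n f (jacobi_trudi n m) =
      (\<Sum>p | p permutes {..<n}. of_int (sign p) * pairing n f (perm_character n (?b p)))"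
    unfolding jacobi_trudi_def by (rule pairing_sum_right)
  also have "\<dots> = (\<Sum>p | p permutes {..<n}. if p = id then pairing n f (perm_character n (row_lengths m)) else 0)"
    by (intro sum.cong refl) (auto simp: zero weight_jacobi_trudi_term(2))
  also have "\<dots> = pairing n f (perm_character n (row_lengths m))"
    by (simp add: finite_permutations permutes_id)
  finally show ?thesis .
qed

lemma row_lengths_inj:
  assumes l: "l \<in> partitions n" and m: "m \<in> partitions n" and eq: "row_lengths l = row_lengths m"
  shows "l = m"
proof (rule nth_equalityI)
  have len: "i < length k \<longleftrightarrow> row_lengths k i > 0" if "k \<in> partitions n" for k i
    using that nth_mem[of i k] by (auto simp: row_lengths_def partitions_def)
  show "length l = length m" using len[OF l] len[OF m] eq by (metis less_irrefl linorder_neqE_nat)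
  then show "l ! i = m ! i" if "i < length l" for i
    using fun_cong[OF eq, of i] that by (simp add: row_lengths_def)
qed

lemma jacobi_trudi_orthonormal_le:
  assumes l: "l \<in> partitions n" and m: "m \<in> partitions n"
    and le: "weight n (row_lengths m) \<le> weight n (row_lengths l)"
  shows "pairing n (jacobi_trudi n l) (jacobi_trudi n m) = (if l = m then 1 else 0)"
proof -
  have "pairing n (jacobi_trudi n l) (jacobi_trudi n m) =
      pairing n (jacobi_trudi n l) (perm_character n (row_lengths m))"
    by (rule pairing_jacobi_trudi_expand) (use pairing_jacobi_trudi_perm[OF l] le in auto)
  also have "\<dots> = (if l = m then 1 else 0)"
    using pairing_jacobi_trudi_perm[OF l le] row_lengths_inj[OF l m] by auto
  finally show ?thesis .
qed

text \<open>
  Triangularity settles the case in which the second partition does not have larger weight, and the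
  inner product is symmetric.
\<close>

lemma jacobi_trudi_orthonormal:
  assumes l: "l \<in> partitions n" and m: "m \<in> partitions n"
  shows "pairing n (jacobi_trudi n l) (jacobi_trudi n m) = (if l = m then 1 else 0)"
  using jacobi_trudi_orthonormal_le[OF l m] jacobi_trudi_orthonormal_le[OF m l]
    pairing_commute[of n "jacobi_trudi n l"] by (cases "weight n (row_lengths m) \<le> weight n (row_lengths l)") auto

text \<open>
  The difference of the two real functions has norm \<open>1 - 2 + 1 = 0\<close>.
\<close>

theorem irr_character_eq_jacobi_trudi:
  assumes l: "l \<in> partitions n" and w: "w permutes {1..n}"
  shows "irr_character l w = jacobi_trudi n l w"
proof -
  let ?d = "\<lambda>w. irr_character l w - jacobi_trudi n l w"
  have "pairing n (irr_character l) (jacobi_trudi n l) =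
      pairing n (irr_character l) (perm_character n (row_lengths l))"
    by (rule pairing_jacobi_trudi_expand)
      (use sum_irr_character_fixed_colorings_zero[OF l] in \<open>simp add: pairing_def weight_def\<close>)
  also have "\<dots> = 1"
    using sum_irr_character_fixed_colorings_row_lengths[OF l] by (simp add: pairing_def)
  finally have mixed: "pairing n (irr_character l) (jacobi_trudi n l) = 1" .
  have "(\<Sum>w\<in>Sym n. ?d w * ?d w) = (\<Sum>w\<in>Sym n. irr_character l w * irr_character l w
      - 2 * (irr_character l w * jacobi_trudi n l w) + jacobi_trudi n l w * jacobi_trudi n l w)"
    by (intro sum.cong refl) (simp add: algebra_simps)
  also have "\<dots> = (\<Sum>w\<in>Sym n. irr_character l w * irr_character l w)
      - 2 * (\<Sum>w\<in>Sym n. irr_character l w * jacobi_trudi n l w)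
      + (\<Sum>w\<in>Sym n. jacobi_trudi n l w * jacobi_trudi n l w)"
    by (simp only: sum.distrib sum_subtractf sum_distrib_left)
  also have "\<dots> = 0"
    using mixed jacobi_trudi_orthonormal[OF l l] sum_irr_character_square[OF l]
    by (simp add: pairing_def)
  finally have zero: "(\<Sum>w\<in>Sym n. ?d w * ?d w) = 0" .
  have real: "?d w \<in> \<real>" if "w \<in> Sym n" for w
    using irr_character_real[OF l, of w] that
    by (auto simp: jacobi_trudi_def intro!: Reals_diff sum_in_Reals Reals_mult)
  have "(\<Sum>w\<in>Sym n. ?d w * ?d w) = complex_of_real (\<Sum>w\<in>Sym n. (Re (?d w))\<^sup>2)"
    unfolding of_real_sum
  proof (rule sum.cong[OF refl])
    fix w assume "w \<in> Sym n"
    then have "?d w = complex_of_real (Re (?d w))" using real[of w] by (simp only: of_real_Re)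
    then show "?d w * ?d w = complex_of_real ((Re (?d w))\<^sup>2)" by (metis of_real_mult power2_eq_square)
  qed
  with zero have "complex_of_real (\<Sum>w\<in>Sym n. (Re (?d w))\<^sup>2) = 0" by simp
  then have "(\<Sum>w\<in>Sym n. (Re (?d w))\<^sup>2) = 0" by (simp only: of_real_eq_0_iff)
  then have "Re (?d w) = 0" using w finite_Sym[of n] by (simp add: sum_nonneg_eq_0_iff)
  moreover have "?d w = complex_of_real (Re (?d w))" using real[of w] w by (simp only: of_real_Re mem_Collect_eq)
  ultimately have "?d w = 0" by (metis of_real_0)
  then show ?thesis by simp
qed

lemma fixed_colorings_comp_permutes:
  assumes r: "r permutes {..<n}" and w: "w permutes {1..n}"
  shows "fixed_colorings n (b \<circ> r) w = fixed_colorings n b w"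
proof -
  let ?relabel = "\<lambda>r f. restrict (\<lambda>x. r (f x)) {1..n}"
  have maps: "?relabel q f \<in> {f \<in> colorings n (c \<circ> inv q). f \<circ> w = f}"
    if q: "q permutes {..<n}" and f: "f \<in> {f \<in> colorings n c. f \<circ> w = f}" for q f c
  proof -
    have fm: "f \<in> {1..n} \<rightarrow>\<^sub>E {..<n}" "\<And>i. int (card {x \<in> {1..n}. f x = i}) = c i" "f \<circ> w = f"
      using f by (auto simp: colorings_def)
    have "?relabel q f \<in> {1..n} \<rightarrow>\<^sub>E {..<n}"
      using fm(1) permutes_in_image[OF q] by (auto simp: PiE_def Pi_def)
    moreover have "{x \<in> {1..n}. ?relabel q f x = i} = {x \<in> {1..n}. f x = inv q i}" for i
    proof -
      have "q (f x) = i \<longleftrightarrow> f x = inv q i" for x using permutes_inverses[OF q] by metis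
      then show ?thesis by auto
    qed
    moreover have "?relabel q f \<circ> w = ?relabel q f"
      using fun_cong[OF fm(3)] permutes_in_image[OF w] by (auto simp: fun_eq_iff)
    ultimately show ?thesis using fm(2) by (simp add: colorings_def)
  qed
  have canc: "?relabel (inv q) (?relabel q f) = f" if q: "q permutes {..<n}" and f: "f \<in> colorings n c" for q f c
    using f permutes_inverses[OF q] by (auto simp: fun_eq_iff colorings_def PiE_def extensional_def)
  have ir: "inv r permutes {..<n}" by (rule permutes_inv[OF r])
  show ?thesis
    unfolding fixed_colorings_def
  proof (rule bij_betw_same_card[of "?relabel r"], rule bij_betw_byWitness[where f' = "?relabel (inv r)"])
    show "\<forall>f\<in>{f \<in> colorings n (b \<circ> r). f \<circ> w = f}. ?relabel (inv r) (?relabel r f) = f"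
      using canc[OF r] by blast
    show "\<forall>f\<in>{f \<in> colorings n b. f \<circ> w = f}. ?relabel r (?relabel (inv r) f) = f"
      using canc[OF ir] unfolding permutes_inv_inv[OF r] by blast
    have "b \<circ> r \<circ> inv r = b" by (simp add: comp_assoc permutes_inv_o[OF r])
    then show "?relabel r ` {f \<in> colorings n (b \<circ> r). f \<circ> w = f} \<subseteq> {f \<in> colorings n b. f \<circ> w = f}"
      using maps[OF r, of _ "b \<circ> r"] by auto
    show "?relabel (inv r) ` {f \<in> colorings n b. f \<circ> w = f} \<subseteq> {f \<in> colorings n (b \<circ> r). f \<circ> w = f}"
      using maps[OF ir, of _ b] unfolding permutes_inv_inv[OF r] by blast
  qed
qed

lemma coloring_content:
  assumes f: "f \<in> colorings n b"
  shows "0 \<le> b i" "i \<ge> n \<Longrightarrow> b i = 0" "(\<Sum>i<n. b i) = int n"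
proof -
  have b: "b i = int (card {x \<in> {1..n}. f x = i})" for i using f by (simp add: colorings_def)
  show "0 \<le> b i" by (simp add: b)
  show "b i = 0" if "i \<ge> n"
  proof -
    have "{x \<in> {1..n}. f x = i} = {}" using f that by (fastforce simp: colorings_def PiE_def Pi_def)
    then show ?thesis by (simp add: b)
  qed
  have "(\<Sum>i<n. card {x \<in> {1..n}. f x = i}) = card {1..n}"
    using sum.group[of "{1..n}" "{..<n}" f "\<lambda>_. 1::nat"] f by (auto simp: colorings_def)
  then show "(\<Sum>i<n. b i) = int n" by (simp add: b flip: of_nat_sum)
qed

lemma nonincreasing_is_row_lengths:
  assumes nn: "\<And>i. 0 \<le> b i" and zero: "\<And>i. i \<ge> n \<Longrightarrow> b i = 0" and tot: "(\<Sum>i<n. b i) = int n"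
    and dec: "\<And>i. Suc i < n \<Longrightarrow> b (Suc i) \<le> b i"
  shows "\<exists>l\<in>partitions n. row_lengths l = b"
proof -
  have dec: "b j \<le> b i" if "i \<le> j" for i j
    using that
  proof (induction j rule: dec_induct)
    case (step j)
    then show ?case using dec[of j] zero[of "Suc j"] nn[of j] by (cases "Suc j < n") auto
  qed simp
  define m where "m = (LEAST i. b i = 0)"
  have bm: "b m = 0" unfolding m_def by (rule LeastI[of _ n]) (simp add: zero)
  have mn: "m \<le> n" unfolding m_def by (rule Least_le) (simp add: zero)
  have pos: "0 < b i" if "i < m" for i
    using not_less_Least[of i "\<lambda>i. b i = 0"] that nn[of i] unfolding m_def by (simp add: order.strict_iff_order)
  have zero': "b i = 0" if "m \<le> i" for i using dec[OF that] bm nn[of i] by simp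
  define l where "l = map (\<lambda>i. nat (b i)) [0..<m]"
  have rl: "row_lengths l = b" using nn zero' by (auto simp: fun_eq_iff row_lengths_def l_def)
  have "sum_list l = (\<Sum>i<m. nat (b i))"
    by (simp add: l_def interv_sum_list_conv_sum_set_nat atLeast0LessThan)
  then have "int (sum_list l) = (\<Sum>i<m. b i)" using nn by simp
  also have "\<dots> = (\<Sum>i<n. b i)" using mn zero' by (intro sum.mono_neutral_left) auto
  finally have "sum_list l = n" using tot by simp
  moreover have "sorted_wrt (\<ge>) l" using dec by (auto simp: l_def sorted_wrt_map sorted_wrt_iff_nth_less intro!: nat_mono)
  moreover have "\<forall>x\<in>set l. 0 < x" using pos by (auto simp: l_def)
  ultimately show ?thesis using rl by (auto simp: partitions_def)
qed

lemma finite_partitions: "finite (partitions n)"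
proof (rule finite_subset)
  show "partitions n \<subseteq> {l. set l \<subseteq> {..n} \<and> length l \<le> n}"
    using partition_length_le member_le_sum_list by (fastforce simp: partitions_def)
  show "finite {l. set l \<subseteq> {..n} \<and> length l \<le> n}" by (rule finite_lists_length_le) simp
qed

text \<open>
  Induction on the weight. If the content b increases somewhere, swapping these two entries lowers the
  weight without changing the character. Otherwise b is a partition, and the permutation
  character is its Jacobi-Trudi function minus terms of smaller weight.
\<close>

lemma perm_character_in_span:
  "\<exists>c. \<forall>w\<in>Sym n. perm_character n b w = (\<Sum>l\<in>partitions n. c l * jacobi_trudi n l w)"
proof (induction "nat (weight n b)" arbitrary: b rule: less_induct)
  case less
  show ?case
  proof (cases "colorings n b = {}")
    case True
    then show ?thesis by (intro exI[of _ "\<lambda>_. 0"]) (simp add: fixed_colorings_def)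
  next
    case False
    then obtain f where f: "f \<in> colorings n b" by blast
    note b = coloring_content[OF f]
    have wpos: "0 \<le> weight n b" unfolding weight_def by (intro sum_nonneg) (simp add: b)
    show ?thesis
    proof (cases "\<exists>i. Suc i < n \<and> b i < b (Suc i)")
      case True
      then obtain i where i: "Suc i < n" "b i < b (Suc i)" by blast
      let ?t = "transpose i (Suc i)"
      have t: "?t permutes {..<n}" using i(1) by (intro permutes_swap_id) auto
      have "weight n (b \<circ> ?t) = (\<Sum>j<n. int (?t j) * b j)"
        using sum.permute[OF t, of "\<lambda>j. int (?t j) * b j"] by (simp add: weight_def o_def)
      also have "\<dots> = (\<Sum>j<n. int j * b j + (if j = i then b i else 0) + (if j = Suc i then - b (Suc i) else 0))"
        by (intro sum.cong refl) (auto simp: transpose_def algebra_simps)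
      also have "\<dots> = weight n b + b i - b (Suc i)" using i(1) by (simp add: sum.distrib weight_def)
      finally have eq: "weight n (b \<circ> ?t) = weight n b + b i - b (Suc i)" .
      have "0 \<le> weight n (b \<circ> ?t)" unfolding weight_def by (intro sum_nonneg) (simp add: b)
      then have "nat (weight n (b \<circ> ?t)) < nat (weight n b)" using eq i(2) by linarith
      from less.hyps[OF this] show ?thesis by (simp add: fixed_colorings_comp_permutes[OF t])
    next
      case False
      then obtain l where l: "l \<in> partitions n" "row_lengths l = b"
        using nonincreasing_is_row_lengths[of b n] b by (meson not_le)
      let ?P = "{p. p permutes {..<n}}"
      let ?b = "\<lambda>p i. b i - int i + int (p i)"
      have "\<exists>c. \<forall>w\<in>Sym n. perm_character n (?b p) w = (\<Sum>m\<in>partitions n. c m * jacobi_trudi n m w)"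
        if p: "p \<in> ?P - {id}" for p
      proof (cases "colorings n (?b p) = {}")
        case True
        then show ?thesis by (intro exI[of _ "\<lambda>_. 0"]) (simp add: fixed_colorings_def)
      next
        case False
        then obtain g where g: "g \<in> colorings n (?b p)" by blast
        have "0 \<le> weight n (?b p)" unfolding weight_def
          by (intro sum_nonneg mult_nonneg_nonneg coloring_content(1)[OF g]) simp
        moreover have "weight n (?b p) < weight n b" using weight_jacobi_trudi_term(2)[of p n b] p by auto
        ultimately have "nat (weight n (?b p)) < nat (weight n b)" by linarith
        then show ?thesis by (rule less.hyps)
      qed
      then have "\<forall>p\<in>?P - {id}. \<exists>c. \<forall>w\<in>Sym n.
          perm_character n (?b p) w = (\<Sum>m\<in>partitions n. c m * jacobi_trudi n m w)" by blast
      from bchoice[OF this] obtain c where "\<forall>p\<in>?P - {id}. \<forall>w\<in>Sym n.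
          perm_character n (?b p) w = (\<Sum>m\<in>partitions n. c p m * jacobi_trudi n m w)" by blast
      then have c: "perm_character n (?b p) w = (\<Sum>m\<in>partitions n. c p m * jacobi_trudi n m w)"
        if "p \<in> ?P - {id}" "w \<in> Sym n" for p w using that by blast
      define d where "d m = (if m = l then 1 else 0) - (\<Sum>p\<in>?P - {id}. of_int (sign p) * c p m)" for m
      have "perm_character n b w = (\<Sum>m\<in>partitions n. d m * jacobi_trudi n m w)" if w: "w \<in> Sym n" for w
      proof -
        have "jacobi_trudi n l w = (\<Sum>p\<in>?P. of_int (sign p) * perm_character n (?b p) w)"
          by (simp add: jacobi_trudi_def l(2))
        also have "\<dots> = perm_character n b w + (\<Sum>p\<in>?P - {id}. of_int (sign p) * perm_character n (?b p) w)"
          by (subst sum.remove[of _ id]) (simp_all add: finite_permutations permutes_id)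
        also have "(\<Sum>p\<in>?P - {id}. of_int (sign p) * perm_character n (?b p) w) =
            (\<Sum>p\<in>?P - {id}. \<Sum>m\<in>partitions n. of_int (sign p) * c p m * jacobi_trudi n m w)"
          by (intro sum.cong refl) (simp add: c w[simplified] sum_distrib_left mult.assoc)
        also have "\<dots> = (\<Sum>m\<in>partitions n. (\<Sum>p\<in>?P - {id}. of_int (sign p) * c p m) * jacobi_trudi n m w)"
          by (subst sum.swap) (simp add: sum_distrib_right)
        finally have "perm_character n b w = jacobi_trudi n l w -
            (\<Sum>m\<in>partitions n. (\<Sum>p\<in>?P - {id}. of_int (sign p) * c p m) * jacobi_trudi n m w)" by simp
        also have "jacobi_trudi n l w = (\<Sum>m\<in>partitions n. (if m = l then 1 else 0) * jacobi_trudi n m w)"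
          using l(1) finite_partitions[of n] by (simp add: if_distrib[of "\<lambda>x. x * _"] cong: if_cong)
        finally show ?thesis by (simp only: d_def left_diff_distrib sum_subtractf)
      qed
      then show ?thesis by blast
    qed
  qed
qed

text \<open>
  By orthonormality the coefficients are the inner products with the Jacobi-Trudi functions.
\<close>

theorem youngs_rule:
  assumes k: "k \<in> colorings n a" "mono_on {1..n} k" and I: "has_breaks n k I" and w: "w permutes {1..n}"
  shows "perm_character n a w = (\<Sum>l\<in>partitions n. of_nat (card (lattice_words n n I (row_lengths l))) * irr_character l w)"
proof -
  obtain c where c: "\<And>w. w \<in> Sym n \<Longrightarrow> perm_character n a w = (\<Sum>l\<in>partitions n. c l * jacobi_trudi n l w)"
    using perm_character_in_span by blast
  have "c l = of_nat (card (lattice_words n n I (row_lengths l)))" if l: "l \<in> partitions n" for l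
  proof -
    have "of_nat (card (lattice_words n n I (row_lengths l))) = pairing n (jacobi_trudi n l) (perm_character n a)"
      using sum_fixed_jacobi_trudi[OF l k I] by (simp add: pairing_def mult.commute)
    also have "\<dots> = pairing n (jacobi_trudi n l) (\<lambda>w. \<Sum>m\<in>partitions n. c m * jacobi_trudi n m w)"
      unfolding pairing_def by (intro arg_cong[of _ _ "\<lambda>x. x / fact n"] sum.cong refl) (simp add: c)
    also have "\<dots> = (\<Sum>m\<in>partitions n. c m * (if l = m then 1 else 0))"
      unfolding pairing_sum_right by (intro sum.cong refl) (simp add: jacobi_trudi_orthonormal[OF l])
    also have "\<dots> = c l" using l finite_partitions[of n] by (simp add: if_distrib[of "\<lambda>x. _ * x"] cong: if_cong)
    finally show ?thesis by simp
  qed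
  then show ?thesis using c[of w] w by (simp add: irr_character_eq_jacobi_trudi)
qed

section \<open>Descent sets and Kronecker coefficients\<close>

definition break_coloring :: "nat \<Rightarrow> nat set \<Rightarrow> nat \<Rightarrow> nat" where
  "break_coloring n I = restrict (\<lambda>x. card {i \<in> I. i < x}) {1..n}"

definition block_sizes :: "nat \<Rightarrow> nat set \<Rightarrow> nat \<Rightarrow> int" where
  "block_sizes n I j = int (card {x \<in> {1..n}. break_coloring n I x = j})"

lemma break_coloring:
  assumes I: "I \<subseteq> {1..n - 1}"
  shows "break_coloring n I \<in> colorings n (block_sizes n I)" and "mono_on {1..n} (break_coloring n I)"
    and "has_breaks n (break_coloring n I) I"
proof -
  have fin: "finite I" using I finite_subset by blast
  have "card {i \<in> I. i < x} < n" if "x \<in> {1..n}" for x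
  proof -
    have "card {i \<in> I. i < x} \<le> card {1..x - 1}" using I by (intro card_mono) auto
    then show ?thesis using that by auto
  qed
  then show "break_coloring n I \<in> colorings n (block_sizes n I)"
    by (auto simp: colorings_def block_sizes_def break_coloring_def)
  show "mono_on {1..n} (break_coloring n I)"
    by (rule mono_onI) (auto simp: break_coloring_def fin intro!: card_mono)
  show "has_breaks n (break_coloring n I) I"
    unfolding has_breaks_def
  proof (intro allI impI)
    fix i assume i: "1 \<le> i" "i < n"
    have "{j \<in> I. j < Suc i} = (if i \<in> I then insert i {j \<in> I. j < i} else {j \<in> I. j < i})"
      by (auto simp: less_Suc_eq)
    then have "card {j \<in> I. j < Suc i} = (if i \<in> I then Suc (card {j \<in> I. j < i}) else card {j \<in> I. j < i})"
      using fin by simp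
    then show "i \<in> I \<longleftrightarrow> break_coloring n I i \<noteq> break_coloring n I (Suc i)"
      using i by (simp add: break_coloring_def)
  qed
qed

lemma increasing_on_blocks_iff_descent_set:
  assumes I: "I \<subseteq> {1..n - 1}" and s: "s permutes {1..n}"
  shows "increasing_on_blocks n (break_coloring n I) s \<longleftrightarrow> descent_set n s \<subseteq> I"
proof
  note k = break_coloring[OF I]
  assume inc: "increasing_on_blocks n (break_coloring n I) s"
  show "descent_set n s \<subseteq> I"
  proof
    fix i assume i: "i \<in> descent_set n s"
    then have "1 \<le> i" "i < n" "s (Suc i) < s i" by (auto simp: descent_set_def Suc_eq_plus1)
    then show "i \<in> I"
      using inc[unfolded increasing_on_blocks_def, rule_format, of i "Suc i"] k(3) by (auto simp: has_breaks_def)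
  qed
next
  note k = break_coloring[OF I]
  assume D: "descent_set n s \<subseteq> I"
  have "s x \<le> s y" if "1 \<le> x" "x \<le> y" "y \<le> n" "break_coloring n I x = break_coloring n I y" for x y
    using that(2-4)
  proof (induction y rule: dec_induct)
    case (step y)
    have "break_coloring n I x \<le> break_coloring n I y" "break_coloring n I y \<le> break_coloring n I (Suc y)"
      using mono_onD[OF k(2), of x y] mono_onD[OF k(2), of y "Suc y"] step that(1) by auto
    then have eq: "break_coloring n I x = break_coloring n I y" "break_coloring n I y = break_coloring n I (Suc y)"
      using step.prems by auto
    then have "y \<notin> descent_set n s" using k(3) step that(1) D by (auto simp: has_breaks_def)
    then have "s y \<le> s (Suc y)" using step that(1) by (auto simp: descent_set_def Suc_eq_plus1)
    with step eq show ?case by simp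
  qed simp
  moreover have "s x \<noteq> s y" if "x < y" for x y using permutes_inj[OF s] that by (auto dest: injD)
  ultimately show "increasing_on_blocks n (break_coloring n I) s"
    unfolding increasing_on_blocks_def by (metis atLeastAtMost_iff le_neq_implies_less less_imp_le)
qed

text \<open>
  The uniqueness part of Moebius inversion on the subset lattice.
\<close>

lemma subset_sums_determine:
  fixes f g :: "'a set \<Rightarrow> 'b::ab_group_add"
  assumes U: "finite U" and sums: "\<And>I. I \<subseteq> U \<Longrightarrow> (\<Sum>X\<in>Pow I. f X) = (\<Sum>X\<in>Pow I. g X)"
    and I: "I \<subseteq> U"
  shows "f I = g I"
  using finite_subset[OF I U] I
proof (induction I rule: finite_psubset_induct)
  case (psubset I)
  have split: "(\<Sum>X\<in>Pow I. h X) = h I + (\<Sum>X\<in>Pow I - {I}. h X)" for h :: "'a set \<Rightarrow> 'b"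
    using psubset.hyps by (intro sum.remove) auto
  have "(\<Sum>X\<in>Pow I - {I}. f X) = (\<Sum>X\<in>Pow I - {I}. g X)"
    by (intro sum.cong refl psubset.IH) (use psubset.prems in auto)
  then show ?case using sums[OF psubset.prems] by (simp add: split)
qed

lemma sum_product3:
  fixes f :: "'a \<Rightarrow> 's \<Rightarrow> 'r::comm_semiring_0"
  shows "(\<Sum>a\<in>A. \<Sum>b\<in>B. \<Sum>c\<in>C. \<Sum>w\<in>S. f a w * g b w * h c w) =
    (\<Sum>w\<in>S. (\<Sum>a\<in>A. f a w) * (\<Sum>b\<in>B. g b w) * (\<Sum>c\<in>C. h c w))"
proof -
  have "(\<Sum>w\<in>S. (\<Sum>a\<in>A. f a w) * (\<Sum>b\<in>B. g b w) * (\<Sum>c\<in>C. h c w)) =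
      (\<Sum>w\<in>S. \<Sum>a\<in>A. \<Sum>b\<in>B. \<Sum>c\<in>C. f a w * g b w * h c w)"
    by (subst sum_product, simp only: sum_distrib_right, simp only: sum_distrib_left)
  also have "\<dots> = (\<Sum>a\<in>A. \<Sum>w\<in>S. \<Sum>b\<in>B. \<Sum>c\<in>C. f a w * g b w * h c w)" by (rule sum.swap)
  also have "\<dots> = (\<Sum>a\<in>A. \<Sum>b\<in>B. \<Sum>w\<in>S. \<Sum>c\<in>C. f a w * g b w * h c w)"
    by (intro sum.cong refl sum.swap)
  also have "\<dots> = (\<Sum>a\<in>A. \<Sum>b\<in>B. \<Sum>c\<in>C. \<Sum>w\<in>S. f a w * g b w * h c w)"
    by (intro sum.cong refl sum.swap)
  finally show ?thesis by simp
qed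

lemma sum_card_fibers:
  assumes "finite A" "finite T"
  shows "(\<Sum>a\<in>A. card {t \<in> T. F t = a}) = card {t \<in> T. F t \<in> A}"
proof -
  have "(\<Sum>a\<in>A. card {t \<in> T. F t = a}) = (\<Sum>a\<in>A. \<Sum>t | t \<in> {t \<in> T. F t \<in> A} \<and> F t = a. 1)"
    by (intro sum.cong refl) (auto intro: arg_cong[of _ _ card])
  also have "\<dots> = card {t \<in> T. F t \<in> A}"
    by (subst sum.group) (use assms in auto)
  finally show ?thesis .
qed

lemma finite_standard_tableaux: "finite (standard_tableaux l)"
proof (rule finite_subset)
  show "standard_tableaux l \<subseteq> diagram l \<rightarrow>\<^sub>E {1..sum_list l}"
    by (auto simp: standard_tableaux_def PiE_def dest: bij_betwE)
  show "finite (diagram l \<rightarrow>\<^sub>E {1..sum_list l})" by (intro finite_PiE finite_diagram) simp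
qed

lemma sum_num_tableaux:
  assumes "l \<in> partitions n" "finite I"
  shows "(\<Sum>X\<in>Pow I. num_tableaux l X) = card (lattice_words n n I (row_lengths l))"
  unfolding num_tableaux_def card_tableaux_eq_card_lattice_words[OF assms(1), symmetric]
  using sum_card_fibers[of "Pow I" "standard_tableaux l" "tableau_descent_set l"] assms(2) finite_standard_tableaux
  by simp

text \<open>
  Foulkes' character of the ribbon with descent set I.
\<close>

definition ribbon_character :: "nat \<Rightarrow> nat set \<Rightarrow> (nat \<Rightarrow> nat) \<Rightarrow> complex" where
  "ribbon_character n I w = (\<Sum>l\<in>partitions n. of_nat (num_tableaux l I) * irr_character l w)"

lemma sum_ribbon_character:
  assumes I: "I \<subseteq> {1..n - 1}" and w: "w permutes {1..n}"
  shows "(\<Sum>X\<in>Pow I. ribbon_character n X w) = perm_character n (block_sizes n I) w"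
proof -
  have fin: "finite I" using I finite_subset by blast
  have "(\<Sum>X\<in>Pow I. ribbon_character n X w) =
      (\<Sum>l\<in>partitions n. (\<Sum>X\<in>Pow I. of_nat (num_tableaux l X)) * irr_character l w)"
    unfolding ribbon_character_def by (subst sum.swap) (simp add: sum_distrib_right)
  also have "\<dots> = (\<Sum>l\<in>partitions n. of_nat (card (lattice_words n n I (row_lengths l))) * irr_character l w)"
    by (intro sum.cong refl) (simp add: sum_num_tableaux[OF _ fin, symmetric])
  also have "\<dots> = perm_character n (block_sizes n I) w"
    by (rule youngs_rule[OF break_coloring[OF I] w, symmetric])
  finally show ?thesis .
qed

lemma kronecker_sum_eq:
  "(\<Sum>lam\<in>partitions n. \<Sum>mu\<in>partitions n. \<Sum>nu\<in>partitions n.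
      kronecker_coeff n lam mu nu * of_nat (num_tableaux lam I) * of_nat (num_tableaux mu J) * of_nat (num_tableaux nu K)) =
    (\<Sum>w\<in>Sym n. ribbon_character n I w * ribbon_character n J w * ribbon_character n K w) / fact n"
proof -
  have "kronecker_coeff n lam mu nu * of_nat (num_tableaux lam I) * of_nat (num_tableaux mu J) * of_nat (num_tableaux nu K) =
      (\<Sum>w\<in>Sym n. (of_nat (num_tableaux lam I) * irr_character lam w) * (of_nat (num_tableaux mu J) * irr_character mu w)
        * (of_nat (num_tableaux nu K) * irr_character nu w)) / fact n" for lam mu nu
    by (simp add: kronecker_coeff_def sum_distrib_left sum_distrib_right sum_divide_distrib mult_ac)
  then show ?thesis
    by (simp only: sum_product3 ribbon_character_def flip: sum_divide_distrib)
qed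

definition descent_triples :: "nat \<Rightarrow> nat set \<Rightarrow> nat set \<Rightarrow> nat set \<Rightarrow> ((nat \<Rightarrow> nat) \<times> (nat \<Rightarrow> nat) \<times> (nat \<Rightarrow> nat)) set" where
  "descent_triples n I J K = {(s1, s2, s3). s1 permutes {1..n} \<and> s2 permutes {1..n} \<and> s3 permutes {1..n} \<and>
     descent_set n s1 = I \<and> descent_set n s2 = J \<and> descent_set n s3 = K \<and> s1 \<circ> s2 \<circ> s3 = id}"

lemma sum_descent_triples:
  assumes I: "I \<subseteq> {1..n - 1}" and J: "J \<subseteq> {1..n - 1}" and K: "K \<subseteq> {1..n - 1}"
  shows "(\<Sum>X\<in>Pow I. \<Sum>Y\<in>Pow J. \<Sum>Z\<in>Pow K. of_nat (card (descent_triples n X Y Z))) =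
    (\<Sum>w\<in>Sym n. perm_character n (block_sizes n I) w * perm_character n (block_sizes n J) w
      * perm_character n (block_sizes n K) w) / fact n"
proof -
  let ?T = "{(s1, s2, s3). s1 permutes {1..n} \<and> s2 permutes {1..n} \<and> s3 permutes {1..n} \<and> s1 \<circ> s2 \<circ> s3 = id}"
  let ?F = "\<lambda>(s1, s2, s3). (descent_set n s1, descent_set n s2, descent_set n s3)"
  have fin: "finite I" "finite J" "finite K" using I J K finite_subset by blast+
  have finT: "finite ?T" by (rule finite_subset[of _ "Sym n \<times> Sym n \<times> Sym n"]) (auto simp: finite_Sym)
  have eq: "descent_triples n X Y Z = {t \<in> ?T. ?F t = (X, Y, Z)}" for X Y Z
    by (auto simp: descent_triples_def)
  have "(\<Sum>X\<in>Pow I. \<Sum>Y\<in>Pow J. \<Sum>Z\<in>Pow K. card (descent_triples n X Y Z)) =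
      (\<Sum>a\<in>Pow I \<times> Pow J \<times> Pow K. card {t \<in> ?T. ?F t = a})"
    by (simp only: eq sum.cartesian_product case_prod_unfold prod.collapse)
  also have "\<dots> = card {t \<in> ?T. ?F t \<in> Pow I \<times> Pow J \<times> Pow K}"
    by (rule sum_card_fibers) (use fin finT in auto)
  also have "{t \<in> ?T. ?F t \<in> Pow I \<times> Pow J \<times> Pow K} =
      {(s1, s2, s3). s1 permutes {1..n} \<and> s2 permutes {1..n} \<and> s3 permutes {1..n} \<and>
        increasing_on_blocks n (break_coloring n I) s1 \<and> increasing_on_blocks n (break_coloring n J) s2 \<and>
        increasing_on_blocks n (break_coloring n K) s3 \<and> s1 \<circ> s2 \<circ> s3 = id}" (is "_ = ?S")
    using increasing_on_blocks_iff_descent_set[OF I] increasing_on_blocks_iff_descent_set[OF J]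
      increasing_on_blocks_iff_descent_set[OF K] by auto
  finally have count: "(\<Sum>X\<in>Pow I. \<Sum>Y\<in>Pow J. \<Sum>Z\<in>Pow K. card (descent_triples n X Y Z)) = card ?S" .
  have "of_nat (\<Sum>w\<in>Sym n. fixed_colorings n (block_sizes n I) w * fixed_colorings n (block_sizes n J) w
      * fixed_colorings n (block_sizes n K) w) = (of_nat (fact n * card ?S) :: complex)"
    using sum_fixed_colorings_mult3[OF break_coloring(1,2)[OF I] break_coloring(1,2)[OF J] break_coloring(1,2)[OF K]]
    by (simp only:)
  then have "(\<Sum>w\<in>Sym n. perm_character n (block_sizes n I) w * perm_character n (block_sizes n J) w
      * perm_character n (block_sizes n K) w) = fact n * of_nat (card ?S)"
    by simp
  then have "(\<Sum>w\<in>Sym n. perm_character n (block_sizes n I) w * perm_character n (block_sizes n J) w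
      * perm_character n (block_sizes n K) w) / fact n = of_nat (card ?S)"
    by simp
  also have "\<dots> = (\<Sum>X\<in>Pow I. \<Sum>Y\<in>Pow J. \<Sum>Z\<in>Pow K. of_nat (card (descent_triples n X Y Z)))"
    by (simp only: count[symmetric] of_nat_sum)
  finally show ?thesis by (rule sym)
qed

theorem theorem2:
  fixes n :: nat and I J K :: "nat set"
  assumes "n \<ge> 1"
    and "I \<subseteq> {1..n - 1}" and "J \<subseteq> {1..n - 1}" and "K \<subseteq> {1..n - 1}"
  shows "of_nat (card {(\<sigma>\<^sub>1, \<sigma>\<^sub>2, \<sigma>\<^sub>3).
            \<sigma>\<^sub>1 permutes {1..n} \<and> \<sigma>\<^sub>2 permutes {1..n} \<and> \<sigma>\<^sub>3 permutes {1..n} \<and>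
            descent_set n \<sigma>\<^sub>1 = I \<and> descent_set n \<sigma>\<^sub>2 = J \<and> descent_set n \<sigma>\<^sub>3 = K \<and>
            \<sigma>\<^sub>1 \<circ> \<sigma>\<^sub>2 \<circ> \<sigma>\<^sub>3 = id})
    = (\<Sum>lam\<in>partitions n. \<Sum>mu\<in>partitions n. \<Sum>nu\<in>partitions n.
         kronecker_coeff n lam mu nu * of_nat (num_tableaux lam I) * of_nat (num_tableaux mu J)
           * of_nat (num_tableaux nu K))"
proof -
  let ?U = "{1..n - 1}"
  let ?A = "\<lambda>X Y Z. of_nat (card (descent_triples n X Y Z)) :: complex"
  let ?B = "\<lambda>X Y Z. (\<Sum>w\<in>Sym n. ribbon_character n X w * ribbon_character n Y w * ribbon_character n Z w) / fact n"
  have sums: "(\<Sum>X\<in>Pow I. \<Sum>Y\<in>Pow J. \<Sum>Z\<in>Pow K. ?A X Y Z) = (\<Sum>X\<in>Pow I. \<Sum>Y\<in>Pow J. \<Sum>Z\<in>Pow K. ?B X Y Z)"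
    if "I \<subseteq> ?U" "J \<subseteq> ?U" "K \<subseteq> ?U" for I J K
  proof -
    have "(\<Sum>X\<in>Pow I. \<Sum>Y\<in>Pow J. \<Sum>Z\<in>Pow K. ?B X Y Z) =
        (\<Sum>w\<in>Sym n. (\<Sum>X\<in>Pow I. ribbon_character n X w) * (\<Sum>Y\<in>Pow J. ribbon_character n Y w)
          * (\<Sum>Z\<in>Pow K. ribbon_character n Z w)) / fact n"
      by (simp only: sum_product3 flip: sum_divide_distrib)
    also have "\<dots> = (\<Sum>X\<in>Pow I. \<Sum>Y\<in>Pow J. \<Sum>Z\<in>Pow K. ?A X Y Z)"
      unfolding sum_descent_triples[OF that]
      by (intro arg_cong[of _ _ "\<lambda>x. x / fact n"] sum.cong refl) (simp add: sum_ribbon_character that)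
    finally show ?thesis by (rule sym)
  qed
  have U: "finite ?U" by simp
  have s1: "(\<Sum>Y\<in>Pow J. \<Sum>Z\<in>Pow K. ?A I Y Z) = (\<Sum>Y\<in>Pow J. \<Sum>Z\<in>Pow K. ?B I Y Z)"
    if "I \<subseteq> ?U" "J \<subseteq> ?U" "K \<subseteq> ?U" for I J K
    by (rule subset_sums_determine[OF U _ that(1)]) (rule sums[OF _ that(2,3)])
  have s2: "(\<Sum>Z\<in>Pow K. ?A I J Z) = (\<Sum>Z\<in>Pow K. ?B I J Z)"
    if "I \<subseteq> ?U" "J \<subseteq> ?U" "K \<subseteq> ?U" for I J K
    by (rule subset_sums_determine[OF U _ that(2)]) (rule s1[OF that(1) _ that(3)])
  have "?A I J K = ?B I J K"
    by (rule subset_sums_determine[OF U _ assms(4)]) (rule s2[OF assms(2,3)])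
  then show ?thesis by (simp only: kronecker_sum_eq descent_triples_def)
qed

end
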